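(* Let $n\ge2$, $k\ge1$ and set $z=1$. For $\lambda\in\mathcal P_{\le n-1,k}$ let $s_\lambda(a)_k\in\operatorname{End}(\mathbb C P_k^+)$ denote the restriction to $\mathbb C P_k^+$ of the affine plactic Schur polynomial $s_\lambda(\mathcal A)$, and let $\mathcal F'_{n,k}\subset\operatorname{End}(\mathbb C P_k^+)$ be the subalgebra generated by $\{s_\lambda(a)_k\}_{\lambda\in\mathcal P_{\le n-1,k}}$. Then the map $s_\lambda(a)_k\mapsto[s_{\lambda^t}]$ provides an isomorphism of algebras $$\mathcal F'_{n,k}\cong\mathbb C[e_1,\dots,e_k]/\mathcal I(\mathbb V_{n,k}).$$ In particular, for all $\lambda,\mu\in\mathcal P_{\le n-1,k}$, $$s_\lambda(a)_k\,s_\mu(a)_k=\sum_{\nu\in\mathcal P_{\le n-1,k}}\mathcal N_{\hat\lambda\hat\mu}^{(k),\hat\nu}\,s_\nu(a)_k .$$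
   Context: $P_k^+$ is the set of level-$k$ dominant integral weights $\hat\lambda=\sum_{i=1}^n m_i\hat\omega_i$ of $\widehat{\mathfrak{su}}(n)$ ($m_i\in\mathbb Z_{\ge0}$, $\sum_i m_i=k$, with $\hat\omega_i$ the fundamental affine weights and label $n$ the affine node). $\mathcal P_{\le n-1,k}$ is the set of partitions $\lambda=(\lambda_1\ge\dots\ge\lambda_{n-1}\ge0)$ with $\lambda_1\le k$. The two sets are in bijection via $m_i=\lambda_i-\lambda_{i+1}$ for $1\le i\le n-1$ (with $\lambda_n=0$), $m_n=k-\lambda_1$. $\mathbb C P^+=\bigoplus_{k\ge0}\mathbb C P_k^+$ is the complex vector space with basis all tuples $\boldsymbol m=(m_1,\dots,m_n)\in\mathbb Z_{\ge0}^n$, and $\mathbb C P_k^+$ is spanned by those with $\sum_i m_i=k$. Operators on $\mathbb C P^+$: $\varphi_i^*\boldsymbol m=(m_1,\dots,m_i+1,\dots,m_n)$; $\varphi_i\boldsymbol m=(m_1,\dots,m_i-1,\dots,m_n)$ if $m_i>0$ and $0$ otherwise; $a_j=\varphi_{j+1}^*\varphi_j$ for $1\le j\le n-1$. At $z=1$ the affine plactic complete symmetric polynomials are $$h_r(\mathcal A)=\sum_{\substack{\varepsilon_0,\dots,\varepsilon_{n-1}\ge0\\ \varepsilon_0+\dots+\varepsilon_{n-1}=r}}(\varphi_1^* )^{\varepsilon_0}a_1^{\varepsilon_1}\cdots a_{n-1}^{\varepsilon_{n-1}}\varphi_n^{\varepsilon_0}\quad(r\ge0),\qquad h_r(\mathcal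 A)=0\ (r<0).$$ They preserve each $\mathbb C P_k^+$ and commute with each other, and the affine plactic Schur polynomials are defined by $s_\lambda(\mathcal A)=\det\big(h_{\lambda_i-i+j}(\mathcal A)\big)_{1\le i,j\le n-1}$. $\mathbb C[e_1,\dots,e_k]=\mathbb C[x_1,\dots,x_k]^{\mathbb S_k}$ is the ring of symmetric polynomials in $k$ variables, with $e_i$ and $h_r=\det(e_{1-i+j})_{1\le i,j\le r}$ the elementary and complete symmetric polynomials; $s_{\lambda^t}$ is the Schur polynomial in $x_1,\dots,x_k$ of the transposed partition $\lambda^t$, and $[\cdot]$ is the class in the quotient. At $z=1$, $\mathbb V_{n,k}\subset\mathbb C^k$ (with coordinates $e_1,\dots,e_k$) is the affine variety of common zeros of $h_n-1,h_{n+1},\dots,h_{n+k-1}$, and $\mathcal I(\mathbb V_{n,k})=\{f\in\mathbb C[e_1,\dots,e_k]: f(v)=0\text{ for all }v\in\mathbb V_{n,k}\}$ is its vanishing ideal. The fusion coefficients are defined by the Verlinde formula $$\mathcal N_{\hat\lambda\hat\mu}^{(k),\hat\nu}=\sum_{\sigma\in\mathcal P_{\le n-1,k}}\frac{S_{\lambda\sigma}S_{\mu\sigma}\overline{S_{\nu\sigma}}}{S_{\emptyset\sigma}},$$ where $\emptyset$ is the empty partition and $S$ is the (unitary) modular $S$-matrix given by $$S_{\lambda\sigma}=\frac{e^{i\pi n(n-1)/4}}{\sqrt{n(k+n)^{n-1}}}\sum_{w\in W}(-1)^{\ell(w)}e^{-\frac{2\pi i}{k+n}(\sigma+\rho,\,w(\lambda+\rho))}.$$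 Here $W\cong \mathbb S_n$ is the Weyl group of $\mathfrak{su}(n)$, acting by permuting the coordinates of $\mathbb R^n$, a partition $\lambda$ is identified with the finite weight $(\lambda_1,\dots,\lambda_{n-1},0)-\frac{|\lambda|}{n}(1,\dots,1)\in\mathbb R^n$, $\rho=(\frac{n-1}{2},\frac{n-3}{2},\dots,-\frac{n-1}{2})$ is the Weyl vector, and $(\cdot,\cdot)$ is the standard inner product on $\mathbb R^n$. *)

theory Defs
  imports
    Complex_Main
    "HOL-Library.Poly_Mapping"
    "HOL-Library.FuncSet"
    "HOL-Combinatorics.Permutations"
    "HOL-Algebra.QuotRing"
    "HOL-Algebra.Subrings"
    "HOL-Algebra.Module"
    "Jordan_Normal_Form.Determinant"
begin

text \<open>
  All finite tuples are functions on \<^typ>\<open>nat\<close> with 1-based indices, equal to 0 outside their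
  index range.
\<close>

section \<open>Weights, partitions and the space they span\<close>

definition weights :: "nat \<Rightarrow> nat \<Rightarrow> (nat \<Rightarrow> nat) set" where
  "weights n k = {m. (\<forall>i. i \<notin> {1..n} \<longrightarrow> m i = 0) \<and> (\<Sum>i=1..n. m i) = k}"

definition partitions :: "nat \<Rightarrow> nat \<Rightarrow> (nat \<Rightarrow> nat) set" where
  "partitions n k = {lam. (\<forall>i. i \<notin> {1..n-1} \<longrightarrow> lam i = 0)
      \<and> (\<forall>i j. 1 \<le> i \<and> i \<le> j \<longrightarrow> lam j \<le> lam i) \<and> lam 1 \<le> k}"

definition transpose_part :: "(nat \<Rightarrow> nat) \<Rightarrow> nat \<Rightarrow> nat" where
  "transpose_part lam j = (if j = 0 then 0 else card {i. 1 \<le> i \<and> j \<le> lam i})"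

type_synonym cvec = "(nat \<Rightarrow> nat) \<Rightarrow>\<^sub>0 complex"

abbreviation basis_vec :: "(nat \<Rightarrow> nat) \<Rightarrow> cvec" where
  "basis_vec m \<equiv> Poly_Mapping.single m 1"

definition scale :: "complex \<Rightarrow> cvec \<Rightarrow> cvec" where
  "scale c = Poly_Mapping.map ((*) c)"

definition CP :: "nat \<Rightarrow> nat \<Rightarrow> cvec set" where
  "CP n k = {v. Poly_Mapping.keys v \<subseteq> weights n k}"

section \<open>The affine plactic operators\<close>

definition lin_ext :: "((nat \<Rightarrow> nat) \<Rightarrow> cvec) \<Rightarrow> cvec \<Rightarrow> cvec" where
  "lin_ext f v = (\<Sum>m\<in>Poly_Mapping.keys v. scale (Poly_Mapping.lookup v m) (f m))"

definition phi_star :: "nat \<Rightarrow> cvec \<Rightarrow> cvec" where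
  "phi_star i = lin_ext (\<lambda>m. basis_vec (m(i := m i + 1)))"

definition phi :: "nat \<Rightarrow> cvec \<Rightarrow> cvec" where
  "phi i = lin_ext (\<lambda>m. if m i > 0 then basis_vec (m(i := m i - 1)) else 0)"

definition a_op :: "nat \<Rightarrow> cvec \<Rightarrow> cvec" where
  "a_op j = phi_star (j + 1) \<circ> phi j"

definition oprod :: "('a \<Rightarrow> 'a) list \<Rightarrow> 'a \<Rightarrow> 'a" where
  "oprod fs = foldr (\<circ>) fs id"

definition plactic_h :: "nat \<Rightarrow> int \<Rightarrow> cvec \<Rightarrow> cvec" where
  "plactic_h n r v =
     (if r < 0 then 0
      else \<Sum>eps | (\<forall>i. n \<le> i \<longrightarrow> eps i = 0) \<and> (\<Sum>i<n. eps i) = nat r.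
        (phi_star 1 ^^ eps 0 \<circ> oprod (map (\<lambda>j. a_op j ^^ eps j) [1..<n]) \<circ> phi n ^^ eps 0) v)"

text \<open>
  The Jacobi--Trudi determinant, written out by the Leibniz formula because the entries live in a
  noncommutative ring (although the entries themselves commute); factors are in row order.
\<close>

definition plactic_schur :: "nat \<Rightarrow> (nat \<Rightarrow> nat) \<Rightarrow> cvec \<Rightarrow> cvec" where
  "plactic_schur n lam v =
     (\<Sum>p | p permutes {1..n-1}.
        scale (of_int (sign p))
          (oprod (map (\<lambda>i. plactic_h n (int (lam i) - int i + int (p i))) [1..<n]) v))"

definition plactic_schur_level :: "nat \<Rightarrow> nat \<Rightarrow> (nat \<Rightarrow> nat) \<Rightarrow> cvec \<Rightarrow> cvec" where
  "plactic_schur_level n k lam = restrict (plactic_schur n lam) (CP n k)"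

section \<open>Complex algebras, subalgebras, quotients and isomorphisms\<close>

text \<open>
  An algebra over the complex numbers is given by a \<^typ>\<open>(complex, 'a) module\<close> record: a ring
  together with a scalar multiplication.
\<close>

definition generated_subalg :: "(complex, 'a) module \<Rightarrow> 'a set \<Rightarrow> (complex, 'a) module" where
  "generated_subalg A S =
     A\<lparr>carrier := \<Inter>{B. S \<subseteq> B \<and> subring B A \<and> (\<forall>c. \<forall>x\<in>B. c \<odot>\<^bsub>A\<^esub> x \<in> B)}\<rparr>"

text \<open>
  In the quotient, \<open>c\<close> times the coset \<open>X\<close> is \<open>I + c X\<close>; adding \<open>I\<close> makes this a full coset also for
  \<open>c = 0\<close>.
\<close>

definition quot_alg :: "(complex, 'a) module \<Rightarrow> 'a set \<Rightarrow> (complex, 'a set) module" where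
  "quot_alg A I =
     ring.extend (A Quot I) (module.fields (\<lambda>c X. I <+>\<^bsub>A\<^esub> (\<lambda>x. c \<odot>\<^bsub>A\<^esub> x) ` X))"

definition alg_iso :: "(complex, 'a) module \<Rightarrow> (complex, 'b) module \<Rightarrow> ('a \<Rightarrow> 'b) set" where
  "alg_iso A B =
     {h \<in> ring_iso A B. \<forall>c. \<forall>x\<in>carrier A. h (c \<odot>\<^bsub>A\<^esub> x) = c \<odot>\<^bsub>B\<^esub> h x}"

definition End_alg :: "nat \<Rightarrow> nat \<Rightarrow> (complex, cvec \<Rightarrow> cvec) module" where
  "End_alg n k =
     \<lparr>carrier = {f \<in> CP n k \<rightarrow>\<^sub>E CP n k.
        (\<forall>u\<in>CP n k. \<forall>v\<in>CP n k. f (u + v) = f u + f v) \<and>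
        (\<forall>c. \<forall>v\<in>CP n k. f (scale c v) = scale c (f v))},
      monoid.mult = compose (CP n k),
      one = (\<lambda>v\<in>CP n k. v),
      zero = (\<lambda>v\<in>CP n k. 0),
      add = (\<lambda>f g. \<lambda>v\<in>CP n k. f v + g v),
      module.smult = (\<lambda>c f. \<lambda>v\<in>CP n k. scale c (f v))\<rparr>"

definition F'_alg :: "nat \<Rightarrow> nat \<Rightarrow> (complex, cvec \<Rightarrow> cvec) module" where
  "F'_alg n k = generated_subalg (End_alg n k) (plactic_schur_level n k ` partitions n k)"

section \<open>Polynomials in k variables\<close>

text \<open>
  A polynomial maps exponent vectors to coefficients. The same type serves for polynomials in the
  variables \<open>x\<^sub>1, \<dots>, x\<^sub>k\<close> and for polynomials in the coordinates \<open>e\<^sub>1, \<dots>, e\<^sub>k\<close>.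
\<close>

type_synonym cpoly = "(nat \<Rightarrow>\<^sub>0 nat) \<Rightarrow>\<^sub>0 complex"

definition Const :: "complex \<Rightarrow> cpoly" where
  "Const c = Poly_Mapping.single 0 c"

definition Var :: "nat \<Rightarrow> cpoly" where
  "Var i = Poly_Mapping.single (Poly_Mapping.single i 1) 1"

definition polys :: "nat \<Rightarrow> cpoly set" where
  "polys k = {p. \<forall>m\<in>Poly_Mapping.keys p. Poly_Mapping.keys m \<subseteq> {1..k}}"

definition poly_alg :: "nat \<Rightarrow> (complex, cpoly) module" where
  "poly_alg k =
     \<lparr>carrier = polys k, monoid.mult = (*), one = 1, zero = 0, add = (+),
      module.smult = (\<lambda>c p. Const c * p)\<rparr>"

definition subst_poly :: "(complex \<Rightarrow> 'r) \<Rightarrow> (nat \<Rightarrow> 'r) \<Rightarrow> cpoly \<Rightarrow> 'r::comm_ring_1" where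
  "subst_poly emb f p =
     (\<Sum>m\<in>Poly_Mapping.keys p. emb (Poly_Mapping.lookup p m) *
        (\<Prod>i\<in>Poly_Mapping.keys m. f i ^ Poly_Mapping.lookup m i))"

abbreviation eval_poly :: "(nat \<Rightarrow> complex) \<Rightarrow> cpoly \<Rightarrow> complex" where
  "eval_poly v \<equiv> subst_poly (\<lambda>c. c) v"

section \<open>Symmetric polynomials\<close>

definition elem_x :: "nat \<Rightarrow> nat \<Rightarrow> cpoly" where
  "elem_x k r = (\<Sum>S | S \<subseteq> {1..k} \<and> card S = r. \<Prod>i\<in>S. Var i)"

text \<open>
  The Schur polynomial of a partition \<open>\<mu>\<close> with at most \<open>k\<close> parts as the quotient of alternants
  \<open>det (x\<^sub>i ^ (\<mu>\<^sub>j + k - j)) / det (x\<^sub>i ^ (k - j))\<close>, where \<open>1 \<le> i, j \<le> k\<close>; matrix indices start at 0.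
\<close>

definition alternant :: "nat \<Rightarrow> (nat \<Rightarrow> nat) \<Rightarrow> cpoly" where
  "alternant k mu = det (mat k k (\<lambda>(i, j). Var (i + 1) ^ (mu (j + 1) + (k - (j + 1)))))"

definition schur_x :: "nat \<Rightarrow> (nat \<Rightarrow> nat) \<Rightarrow> cpoly" where
  "schur_x k mu = (THE s. s * alternant k (\<lambda>_. 0) = alternant k mu)"

text \<open>
  The ring of symmetric polynomials in \<open>x\<^sub>1, \<dots>, x\<^sub>k\<close> is identified with the ring \<^term>\<open>polys k\<close> of
  polynomials in the coordinates \<open>e\<^sub>1, \<dots>, e\<^sub>k\<close> by the substitution \<open>from_e k\<close>,
  \<open>F \<mapsto> F(e\<^sub>1(x), \<dots>, e\<^sub>k(x))\<close>, which is injective on \<^term>\<open>polys k\<close> with the symmetric polynomials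
  as its image; \<open>schur_e k mu\<close> is the Schur polynomial written in these coordinates.
\<close>

definition from_e :: "nat \<Rightarrow> cpoly \<Rightarrow> cpoly" where
  "from_e k = subst_poly Const (elem_x k)"

definition schur_e :: "nat \<Rightarrow> (nat \<Rightarrow> nat) \<Rightarrow> cpoly" where
  "schur_e k mu = inv_into (polys k) (from_e k) (schur_x k mu)"

definition elem_e :: "nat \<Rightarrow> int \<Rightarrow> cpoly" where
  "elem_e k r = (if r = 0 then 1 else if 1 \<le> r \<and> r \<le> int k then Var (nat r) else 0)"

definition complete_e :: "nat \<Rightarrow> nat \<Rightarrow> cpoly" where
  "complete_e k r = det (mat r r (\<lambda>(i, j). elem_e k (1 - int i + int j)))"

section \<open>The variety and its coordinate ring\<close>

definition variety :: "nat \<Rightarrow> nat \<Rightarrow> (nat \<Rightarrow> complex) set" where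
  "variety n k =
     {v. (\<forall>i. i \<notin> {1..k} \<longrightarrow> v i = 0) \<and> eval_poly v (complete_e k n - 1) = 0 \<and>
         (\<forall>r\<in>{n+1..n+k-1}. eval_poly v (complete_e k r) = 0)}"

definition vanishing_ideal :: "nat \<Rightarrow> (nat \<Rightarrow> complex) set \<Rightarrow> cpoly set" where
  "vanishing_ideal k V = {f \<in> polys k. \<forall>v\<in>V. eval_poly v f = 0}"

definition coord_alg :: "nat \<Rightarrow> nat \<Rightarrow> (complex, cpoly set) module" where
  "coord_alg n k = quot_alg (poly_alg k) (vanishing_ideal k (variety n k))"

definition coord_class :: "nat \<Rightarrow> nat \<Rightarrow> cpoly \<Rightarrow> cpoly set" where
  "coord_class n k f = vanishing_ideal k (variety n k) +>\<^bsub>poly_alg k\<^esub> f"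

section \<open>Fusion coefficients\<close>

definition rho :: "nat \<Rightarrow> nat \<Rightarrow> real" where
  "rho n i = (real n + 1) / 2 - real i"

definition finite_weight :: "nat \<Rightarrow> (nat \<Rightarrow> nat) \<Rightarrow> nat \<Rightarrow> real" where
  "finite_weight n lam i = real (lam i) - real (\<Sum>j=1..n. lam j) / real n"

text \<open>A permutation \<open>w\<close> sends the vector with coordinates \<open>x\<^sub>i\<close> to the one with coordinates \<open>x\<^bsub>w\<^sup>-\<^sup>1(i)\<^esub>\<close>.\<close>

definition S_matrix :: "nat \<Rightarrow> nat \<Rightarrow> (nat \<Rightarrow> nat) \<Rightarrow> (nat \<Rightarrow> nat) \<Rightarrow> complex" where
  "S_matrix n k lam sig =
     exp (\<i> * of_real (pi * real n * (real n - 1) / 4)) /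
       of_real (sqrt (real n * real (k + n) ^ (n - 1))) *
     (\<Sum>w | w permutes {1..n}. of_int (sign w) *
        exp (- (2 * of_real pi * \<i> / of_nat (k + n)) *
          of_real (\<Sum>i=1..n. (finite_weight n sig i + rho n i) *
             (finite_weight n lam (inv_into UNIV w i) + rho n (inv_into UNIV w i)))))"

definition fusion_coeff ::
  "nat \<Rightarrow> nat \<Rightarrow> (nat \<Rightarrow> nat) \<Rightarrow> (nat \<Rightarrow> nat) \<Rightarrow> (nat \<Rightarrow> nat) \<Rightarrow> complex" where
  "fusion_coeff n k lam mu nu =
     (\<Sum>sig\<in>partitions n k.
        S_matrix n k lam sig * S_matrix n k mu sig * cnj (S_matrix n k nu sig) /
        S_matrix n k (\<lambda>_. 0) sig)"

end

theory Submission
  imports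
    Defs
    "HOL-Computational_Algebra.Fundamental_Theorem_Algebra"
begin

text \<open>
  Let \<open>y\<^sub>1, \<dots>, y\<^sub>n\<close> be distinct with product \<open>1\<close> and a common power \<open>\<zeta> = y\<^sub>j\<^sup>N\<close>, where \<open>N = n + k\<close>. Then
  \<open>m \<mapsto> det (y\<^sub>j ^ l\<^sub>i)\<close>, where \<open>l\<^sub>i = \<lambda>\<^sub>i + n - i\<close> for the partition \<open>\<lambda>\<close> of the weight \<open>m\<close>, is a
  simultaneous eigenfunctional of the operators \<open>h\<^sub>r(A)\<close>: the generating function of the values is a
  determinant of geometric series that telescopes, and the eigenvalues are the coefficients of
  \<open>E(t) = (1 - \<zeta> t\<^sup>N) / (\<Prod>j. 1 - y\<^sub>j t)\<close>. For the points \<open>y\<close> given by the weights \<open>\<sigma>\<close> these functionals are,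
  up to scalars, the columns of the S-matrix. Its unitarity makes them a basis of the dual space, so
  the \<open>h\<^sub>r(A)\<close> are simultaneously diagonal. Their joint spectrum is the variety: the defining equations
  of a point with generating polynomial \<open>E\<close> say that \<open>E(t) H(-t) = 1 - \<zeta> t\<^sup>N\<close> for the complete symmetric
  functions truncated at degree \<open>n\<close>, and \<open>H(-t)\<close> then splits as \<open>\<Prod>j. 1 - y\<^sub>j t\<close> with \<open>y\<close> as above.
  By the Jacobi--Trudi formula \<open>s\<^sub>\<lambda>(A)\<close> has the eigenvalues \<open>S\<^sub>\<lambda>\<^sub>\<sigma> / S\<^sub>0\<^sub>\<sigma>\<close>, and by the dual formula
  these are the values of \<open>s\<^bsub>\<lambda>\<^sup>t\<^esub>\<close> on the variety. The fusion rule is then the unitarity of \<open>S\<close>.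
\<close>

section \<open>Particle hopping\<close>

text \<open>Operators are tested on functionals rather than on vectors: a hop shifts the exponents
  of an alternant, and the sum over all hops acts on the rows of the determinant independently.
  Since the resulting functionals span the dual space, every operator identity becomes an identity
  of eigenvalues, and both algebras become algebras of functions on the finite set of weights
  \<sigma>. Unitarity is the delicate point. The last exponent of an alternant is normalised to 0,
  which leaves n - 1 free exponents. Summed over a full period they give geometric sums, and these
  are N or 0 only if each product of a \<open>y_i\<close> with the conjugate of a
  \<open>y'_j\<close> is an N-th root of unity, that is, for equal values of \<zeta>. Different
  values are separated by the rotation symmetry instead. For equal values the sums detect n - 1
  coordinates, and the product condition supplies the last. The variety has no further points
  because any admissible y yields a nonzero joint eigenfunctional, which must share its eigenvalues
  with one of the joint eigenvectors built from S.\<close>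

definition linear_op :: "(cvec \<Rightarrow> cvec) \<Rightarrow> bool" where
  "linear_op T \<longleftrightarrow> (\<forall>u v. T (u + v) = T u + T v) \<and> (\<forall>c v. T (scale c v) = scale c (T v))"

text \<open>Bilinear, with no conjugation: \<open>\<psi>\<close> stands for the functional whose
  value at the basis vector of \<open>m\<close> is \<open>\<psi> m\<close>.\<close>

definition pairing :: "((nat \<Rightarrow> nat) \<Rightarrow> complex) \<Rightarrow> cvec \<Rightarrow> complex" where
  "pairing \<psi> v = (\<Sum>m\<in>Poly_Mapping.keys v. Poly_Mapping.lookup v m * \<psi> m)"

lemma lookup_scale [simp]: "Poly_Mapping.lookup (scale c v) m = c * Poly_Mapping.lookup v m"
  by (simp add: scale_def Poly_Mapping.map.rep_eq when_def)

lemma scale_simps: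
  "scale c (u + v) = scale c u + scale c v" "scale (a + b) v = scale a v + scale b v"
  "scale a (scale b v) = scale (a * b) v" "scale 1 v = v" "scale 0 v = 0" "scale c 0 = 0"
  by (rule poly_mapping_eqI, simp add: lookup_add algebra_simps)+

lemma scale_sum: "scale c (\<Sum>i\<in>I. f i) = (\<Sum>i\<in>I. scale c (f i))"
  by (induction I rule: infinite_finite_induct) (simp_all add: scale_simps)

lemma linear_op_zero: "linear_op T \<Longrightarrow> T 0 = 0"
  unfolding linear_op_def by (metis scale_simps(5))

lemma linear_op_sum: "linear_op T \<Longrightarrow> T (\<Sum>i\<in>I. f i) = (\<Sum>i\<in>I. T (f i))"
  by (induction I rule: infinite_finite_induct) (simp_all add: linear_op_zero, simp add: linear_op_def)

lemma linear_op_scale: "linear_op T \<Longrightarrow> T (scale c v) = scale c (T v)"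
  by (simp add: linear_op_def)

lemma linear_op_id: "linear_op id" by (simp add: linear_op_def)

lemma linear_op_comp: "linear_op S \<Longrightarrow> linear_op T \<Longrightarrow> linear_op (S \<circ> T)"
  by (simp add: linear_op_def)

lemma linear_op_funpow: "linear_op T \<Longrightarrow> linear_op (T ^^ e)"
  by (induction e) (simp_all add: linear_op_comp linear_op_id)

lemma linear_op_oprod: "(\<And>f. f \<in> set fs \<Longrightarrow> linear_op f) \<Longrightarrow> linear_op (oprod fs)"
  unfolding oprod_def by (induction fs) (simp_all add: linear_op_id linear_op_comp)

lemma linear_op_sum_fun: "(\<And>i. i \<in> I \<Longrightarrow> linear_op (T i)) \<Longrightarrow> linear_op (\<lambda>v. \<Sum>i\<in>I. T i v)"
  by (auto simp: linear_op_def sum.distrib scale_sum)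

lemma linear_op_scaled: "linear_op T \<Longrightarrow> linear_op (\<lambda>v. scale c (T v))"
  by (simp add: linear_op_def scale_simps mult.commute)

text \<open>The key sets of \<open>u\<close>, \<open>v\<close> and \<open>u + v\<close> differ, so
  additivity becomes visible only after all sums run over one common finite set.\<close>

lemma lin_ext_superset:
  assumes "finite A" "Poly_Mapping.keys v \<subseteq> A"
  shows "lin_ext f v = (\<Sum>m\<in>A. scale (Poly_Mapping.lookup v m) (f m))"
  unfolding lin_ext_def
  by (rule sum.mono_neutral_left) (use assms in \<open>auto simp: scale_simps in_keys_iff\<close>)

lemma linear_op_lin_ext: "linear_op (lin_ext f)"
  unfolding linear_op_def
proof (intro conjI allI)
  fix u v :: cvec and c
  let ?A = "Poly_Mapping.keys u \<union> Poly_Mapping.keys v"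
  have "Poly_Mapping.keys (u + v) \<subseteq> ?A" by (rule Poly_Mapping.keys_add)
  then show "lin_ext f (u + v) = lin_ext f u + lin_ext f v"
    by (simp add: lin_ext_superset[of ?A] lookup_add scale_simps sum.distrib)
  have "Poly_Mapping.keys (scale c v) \<subseteq> Poly_Mapping.keys v" by (auto simp: in_keys_iff)
  then show "lin_ext f (scale c v) = scale c (lin_ext f v)"
    by (simp add: lin_ext_superset[of "Poly_Mapping.keys v"] scale_sum scale_simps)
qed

lemma lin_ext_basis: "lin_ext f (basis_vec m) = f m"
  by (simp add: lin_ext_def scale_simps)

lemma basis_expansion:
  assumes "finite A" "Poly_Mapping.keys v \<subseteq> A"
  shows "v = (\<Sum>m\<in>A. scale (Poly_Mapping.lookup v m) (basis_vec m))"
  using assms by (intro poly_mapping_eqI)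
    (auto simp: lookup_sum lookup_single when_def in_keys_iff if_distrib[of "\<lambda>x. _ * x"] cong: if_cong)

lemma linear_op_expansion:
  assumes "linear_op T"
  shows "T v = (\<Sum>m\<in>Poly_Mapping.keys v. scale (Poly_Mapping.lookup v m) (T (basis_vec m)))"
  by (subst basis_expansion[of "Poly_Mapping.keys v" v])
    (simp_all add: linear_op_sum assms linear_op_scale)

lemma pairing_superset:
  assumes "finite A" "Poly_Mapping.keys v \<subseteq> A"
  shows "pairing \<psi> v = (\<Sum>m\<in>A. Poly_Mapping.lookup v m * \<psi> m)"
  unfolding pairing_def
  by (rule sum.mono_neutral_left) (use assms in \<open>auto simp: in_keys_iff\<close>)

lemma pairing_add: "pairing \<psi> (u + v) = pairing \<psi> u + pairing \<psi> v"
proof -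
  let ?A = "Poly_Mapping.keys u \<union> Poly_Mapping.keys v"
  have "Poly_Mapping.keys (u + v) \<subseteq> ?A" by (rule Poly_Mapping.keys_add)
  then show ?thesis
    by (simp add: pairing_superset[of ?A] lookup_add algebra_simps sum.distrib)
qed

lemma pairing_scale: "pairing \<psi> (scale c v) = c * pairing \<psi> v"
proof -
  have "Poly_Mapping.keys (scale c v) \<subseteq> Poly_Mapping.keys v" by (auto simp: in_keys_iff)
  then show ?thesis
    by (simp add: pairing_superset[of "Poly_Mapping.keys v"] sum_distrib_left mult.assoc)
qed

lemma pairing_zero [simp]: "pairing \<psi> 0 = 0" by (simp add: pairing_def)

lemma pairing_sum: "pairing \<psi> (\<Sum>i\<in>I. f i) = (\<Sum>i\<in>I. pairing \<psi> (f i))"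
  by (induction I rule: infinite_finite_induct) (simp_all add: pairing_add)

lemma pairing_basis [simp]: "pairing \<psi> (basis_vec m) = \<psi> m" by (simp add: pairing_def)

section \<open>The operators on basis vectors\<close>

lemma linear_op_phi: "linear_op (phi i)" "linear_op (phi_star i)" "linear_op (a_op i)"
  unfolding phi_def phi_star_def a_op_def by (intro linear_op_lin_ext linear_op_comp)+

lemma phi_basis: "phi i (basis_vec m) = (if m i > 0 then basis_vec (m(i := m i - 1)) else 0)"
  by (simp add: phi_def lin_ext_basis)

lemma phi_star_basis: "phi_star i (basis_vec m) = basis_vec (m(i := m i + 1))"
  by (simp add: phi_star_def lin_ext_basis)

lemma funpow_phi_basis:
  "(phi i ^^ e) (basis_vec m) = (if e \<le> m i then basis_vec (m(i := m i - e)) else 0)"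
  by (induction e) (auto simp: phi_basis linear_op_zero[OF linear_op_phi(1)] simp del: fun_upd_apply,
    auto simp: Suc_diff_Suc)

lemma funpow_phi_star_basis: "(phi_star i ^^ e) (basis_vec m) = basis_vec (m(i := m i + e))"
  by (induction e) (simp_all add: phi_star_basis fun_upd_def, rule arg_cong[where f = basis_vec], auto)

lemma funpow_a_op_basis:
  "(a_op j ^^ e) (basis_vec m) =
     (if e \<le> m j then basis_vec (m(j := m j - e, j + 1 := m (j + 1) + e)) else 0)"
proof (induction e)
  case (Suc e)
  show ?case
  proof (cases "e < m j")
    case True
    let ?m = "m(j := m j - e, j + 1 := m (j + 1) + e)"
    have "(a_op j ^^ Suc e) (basis_vec m) = phi_star (j + 1) (phi j (basis_vec ?m))"
      using True by (simp add: Suc.IH) (simp add: a_op_def)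
    also have "phi j (basis_vec ?m) = basis_vec (?m(j := ?m j - 1))"
      using True by (simp add: phi_def lin_ext_basis)
    also have "phi_star (j + 1) (basis_vec (?m(j := ?m j - 1))) =
      basis_vec (m(j := m j - Suc e, j + 1 := m (j + 1) + Suc e))"
      unfolding phi_star_def lin_ext_basis
      by (rule arg_cong[where f = basis_vec]) (auto simp: fun_eq_iff)
    finally show ?thesis using True by simp
  next
    case False
    \<comment> \<open>Either \<open>e = m j\<close> and node \<open>j\<close> is empty by now, or
      the vector has already become 0.\<close>
    then show ?thesis
      by (simp add: Suc.IH linear_op_zero[OF linear_op_phi(3)])
        (simp add: a_op_def phi_basis linear_op_zero[OF linear_op_phi(2)])
  qed
qed simp

lemma oprod_Cons [simp]: "oprod (f # fs) = f \<circ> oprod fs"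
  and oprod_Nil [simp]: "oprod [] = id"
  by (simp_all add: oprod_def)

text \<open>The rightmost factor acts first, so a node emits before it receives from its
  predecessor; hence all bounds refer to the original \<open>m\<close>. Downward induction on
  \<open>s\<close> adds the factor that acts last.\<close>

lemma oprod_a_op_basis:
  assumes "1 \<le> s" "s \<le> n"
  shows "oprod (map (\<lambda>j. a_op j ^^ \<epsilon> j) [s..<n]) (basis_vec m) =
    (if \<forall>j\<in>{s..<n}. \<epsilon> j \<le> m j
     then basis_vec (\<lambda>t. if s \<le> t \<and> t < n then m t - \<epsilon> t + (if s < t then \<epsilon> (t - 1) else 0)
                         else if t = n \<and> s < n then m n + \<epsilon> (n - 1) else m t)
     else 0)"
  using assms(2,1)
proof (induction s rule: inc_induct)
  case base
  show ?case by (auto intro!: arg_cong[where f = basis_vec] simp: fun_eq_iff)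
next
  case (step s)
  have IH: "oprod (map (\<lambda>j. a_op j ^^ \<epsilon> j) [Suc s..<n]) (basis_vec m) =
    (if \<forall>j\<in>{Suc s..<n}. \<epsilon> j \<le> m j
     then basis_vec (\<lambda>t. if Suc s \<le> t \<and> t < n then m t - \<epsilon> t + (if Suc s < t then \<epsilon> (t - 1) else 0)
                         else if t = n \<and> Suc s < n then m n + \<epsilon> (n - 1) else m t)
     else 0)" (is "_ = (if ?P then basis_vec ?g else 0)")
    using step by simp
  have all: "(\<forall>j\<in>{s..<n}. \<epsilon> j \<le> m j) \<longleftrightarrow> \<epsilon> s \<le> m s \<and> ?P"
    using step.hyps by (auto simp: Suc_le_eq le_less)
  have "oprod (map (\<lambda>j. a_op j ^^ \<epsilon> j) [s..<n]) (basis_vec m) =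
      (a_op s ^^ \<epsilon> s) (oprod (map (\<lambda>j. a_op j ^^ \<epsilon> j) [Suc s..<n]) (basis_vec m))"
    using step.hyps by (simp add: upt_conv_Cons del: upt_Suc)
  also have "\<dots> = (if \<forall>j\<in>{s..<n}. \<epsilon> j \<le> m j then basis_vec (?g(s := ?g s - \<epsilon> s, s + 1 := ?g (s + 1) + \<epsilon> s)) else 0)"
    unfolding IH all
    using linear_op_zero[OF linear_op_funpow[OF linear_op_phi(3)]]
    by (simp add: funpow_a_op_basis)
  also have "?g(s := ?g s - \<epsilon> s, s + 1 := ?g (s + 1) + \<epsilon> s) =
     (\<lambda>t. if s \<le> t \<and> t < n then m t - \<epsilon> t + (if s < t then \<epsilon> (t - 1) else 0)
                         else if t = n \<and> s < n then m n + \<epsilon> (n - 1) else m t)"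
  proof
    fix t
    consider "t < s" | "t = s" | "t = Suc s" "n = Suc s" | "t = Suc s" "Suc s < n" | "Suc s < t" "n = Suc s"
      | "Suc s < t" "Suc s < n" using step.hyps by linarith
    then show "(?g(s := ?g s - \<epsilon> s, s + 1 := ?g (s + 1) + \<epsilon> s)) t =
     (if s \<le> t \<and> t < n then m t - \<epsilon> t + (if s < t then \<epsilon> (t - 1) else 0)
                         else if t = n \<and> s < n then m n + \<epsilon> (n - 1) else m t)"
      using step.hyps by cases simp_all
  qed
  finally show ?case .
qed

text \<open>
  The entry \<open>\<epsilon> 0\<close> counts the particles that leave the affine node \<open>n\<close> for the node \<open>1\<close>, and \<open>\<epsilon> j\<close>
  those that leave \<open>j\<close> for \<open>j + 1\<close>; all of them move simultaneously.
\<close>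

definition capacity :: "nat \<Rightarrow> (nat \<Rightarrow> nat) \<Rightarrow> nat \<Rightarrow> nat" where
  "capacity n m i = (if i = 0 then m n else m i)"

definition moves :: "nat \<Rightarrow> (nat \<Rightarrow> nat) \<Rightarrow> (nat \<Rightarrow> nat) set" where
  "moves n m = {\<epsilon>. (\<forall>i. n \<le> i \<longrightarrow> \<epsilon> i = 0) \<and> (\<forall>i<n. \<epsilon> i \<le> capacity n m i)}"

text \<open>The index \<open>j mod n\<close> lets the affine node \<open>n\<close> emit the entry 0.
  For \<open>\<epsilon>\<close> in \<open>moves n m\<close> the truncated subtraction is
  exact.\<close>

definition hop :: "nat \<Rightarrow> (nat \<Rightarrow> nat) \<Rightarrow> (nat \<Rightarrow> nat) \<Rightarrow> nat \<Rightarrow> nat" where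
  "hop n m \<epsilon> j = (if j \<in> {1..n} then m j - \<epsilon> (j mod n) + \<epsilon> (j - 1) else m j)"

lemma finite_bounded_tuples:
  "finite {\<epsilon> :: nat \<Rightarrow> nat. (\<forall>i. n \<le> i \<longrightarrow> \<epsilon> i = 0) \<and> (\<forall>i<n. \<epsilon> i \<le> b i)}" (is "finite ?S")
proof -
  have "?S \<subseteq> (\<lambda>g i. if i < n then g i else 0) ` (PiE {..<n} (\<lambda>i. {..b i}))"
  proof
    fix e assume e: "e \<in> ?S"
    then have "e = (\<lambda>i. if i < n then restrict e {..<n} i else 0)" by (auto simp: fun_eq_iff)
    moreover have "restrict e {..<n} \<in> PiE {..<n} (\<lambda>i. {..b i})" using e by auto
    ultimately show "e \<in> (\<lambda>g i. if i < n then g i else 0) ` (PiE {..<n} (\<lambda>i. {..b i}))" by blast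
  qed
  then show ?thesis by (rule finite_subset) (intro finite_imageI finite_PiE; simp)
qed

lemma finite_moves: "finite (moves n m)"
  unfolding moves_def by (rule finite_bounded_tuples)

lemma finite_h_index: "finite {\<epsilon> :: nat \<Rightarrow> nat. (\<forall>i. n \<le> i \<longrightarrow> \<epsilon> i = 0) \<and> (\<Sum>i<n. \<epsilon> i) = r}"
proof (rule finite_subset[OF _ finite_bounded_tuples[of n "\<lambda>_. r"]])
  show "{\<epsilon>. (\<forall>i. n \<le> i \<longrightarrow> \<epsilon> i = 0) \<and> (\<Sum>i<n. \<epsilon> i) = r}
    \<subseteq> {\<epsilon>. (\<forall>i. n \<le> i \<longrightarrow> \<epsilon> i = 0) \<and> (\<forall>i<n. \<epsilon> i \<le> r)}"
    by (auto intro: member_le_sum)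
qed

lemma linear_op_plactic_h: "linear_op (plactic_h n r)"
proof (cases "r < 0")
  case True
  then show ?thesis by (simp add: linear_op_def plactic_h_def[abs_def] scale_simps)
next
  case False
  then have eq: "plactic_h n r = (\<lambda>v. \<Sum>eps | (\<forall>i. n \<le> i \<longrightarrow> eps i = 0) \<and> (\<Sum>i<n. eps i) = nat r.
        (phi_star 1 ^^ eps 0 \<circ> oprod (map (\<lambda>j. a_op j ^^ eps j) [1..<n]) \<circ> phi n ^^ eps 0) v)"
    unfolding plactic_h_def[abs_def] by (simp only: if_False)
  have "linear_op (phi_star 1 ^^ eps 0 \<circ> oprod (map (\<lambda>j. a_op j ^^ eps j) [1..<n]) \<circ> phi n ^^ eps 0)" for eps
    by (intro linear_op_comp linear_op_funpow linear_op_oprod linear_op_phi)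
      (auto intro: linear_op_funpow linear_op_phi)
  then show ?thesis unfolding eq by (rule linear_op_sum_fun)
qed

text \<open>\<open>phi n\<close> takes its particles before node \<open>n\<close> receives any, and
  \<open>phi_star 1\<close> delivers them after node 1 has emitted. So the affine hop is
  simultaneous with the others, and each summand is one move or 0.\<close>

lemma plactic_h_basis:
  assumes "n \<ge> 2"
  shows "plactic_h n (int r) (basis_vec m) =
    (\<Sum>\<epsilon> | \<epsilon> \<in> moves n m \<and> (\<Sum>i<n. \<epsilon> i) = r. basis_vec (hop n m \<epsilon>))"
proof -
  have trm: "(phi_star 1 ^^ \<epsilon> 0 \<circ> oprod (map (\<lambda>j. a_op j ^^ \<epsilon> j) [1..<n]) \<circ> phi n ^^ \<epsilon> 0) (basis_vec m) =
    (if \<epsilon> \<in> moves n m then basis_vec (hop n m \<epsilon>) else 0)"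
    if eps: "\<forall>i. n \<le> i \<longrightarrow> \<epsilon> i = 0" for \<epsilon>
  proof (cases "\<epsilon> 0 \<le> m n")
    case False
    then have "\<epsilon> \<notin> moves n m" using assms by (auto simp: moves_def capacity_def)
    have "linear_op (phi_star 1 ^^ \<epsilon> 0 \<circ> oprod (map (\<lambda>j. a_op j ^^ \<epsilon> j) [1..<n]))"
      by (auto intro!: linear_op_comp linear_op_funpow linear_op_oprod linear_op_phi)
    from linear_op_zero[OF this] show ?thesis using False \<open>\<epsilon> \<notin> moves n m\<close>
      by (simp add: funpow_phi_basis)
  next
    case True
    let ?m = "m(n := m n - \<epsilon> 0)"
    let ?g = "\<lambda>t. if 1 \<le> t \<and> t < n then ?m t - \<epsilon> t + (if 1 < t then \<epsilon> (t - 1) else 0)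
                         else if t = n \<and> 1 < n then ?m n + \<epsilon> (n - 1) else ?m t"
    have mv: "(\<forall>j\<in>{1..<n}. \<epsilon> j \<le> ?m j) \<longleftrightarrow> \<epsilon> \<in> moves n m"
      using True eps assms by (auto simp: moves_def capacity_def)
    have "(phi_star 1 ^^ \<epsilon> 0 \<circ> oprod (map (\<lambda>j. a_op j ^^ \<epsilon> j) [1..<n]) \<circ> phi n ^^ \<epsilon> 0) (basis_vec m)
      = (phi_star 1 ^^ \<epsilon> 0) (oprod (map (\<lambda>j. a_op j ^^ \<epsilon> j) [1..<n]) (basis_vec ?m))"
      using True by (simp add: funpow_phi_basis)
    also have "\<dots> = (phi_star 1 ^^ \<epsilon> 0) (if \<epsilon> \<in> moves n m then basis_vec ?g else 0)"
      unfolding mv[symmetric] using assms by (subst oprod_a_op_basis) simp_all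
    also have "\<dots> = (if \<epsilon> \<in> moves n m then basis_vec (?g(1 := ?g 1 + \<epsilon> 0)) else 0)"
      using linear_op_zero[OF linear_op_funpow[OF linear_op_phi(2)]]
      by (simp add: funpow_phi_star_basis)
    also have "?g(1 := ?g 1 + \<epsilon> 0) = hop n m \<epsilon>"
      using assms by (auto simp: fun_eq_iff hop_def not_le)
    finally show ?thesis .
  qed
  have "plactic_h n (int r) (basis_vec m) =
    (\<Sum>\<epsilon> | (\<forall>i. n \<le> i \<longrightarrow> \<epsilon> i = 0) \<and> (\<Sum>i<n. \<epsilon> i) = r. if \<epsilon> \<in> moves n m then basis_vec (hop n m \<epsilon>) else 0)"
    unfolding plactic_h_def using trm by (auto intro!: sum.cong)
  also have "\<dots> = (\<Sum>\<epsilon>\<in>{\<epsilon>. (\<forall>i. n \<le> i \<longrightarrow> \<epsilon> i = 0) \<and> (\<Sum>i<n. \<epsilon> i) = r} \<inter> moves n m. basis_vec (hop n m \<epsilon>))"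
    by (rule sum.inter_restrict[symmetric]) (rule finite_h_index)
  also have "{\<epsilon>. (\<forall>i. n \<le> i \<longrightarrow> \<epsilon> i = 0) \<and> (\<Sum>i<n. \<epsilon> i) = r} \<inter> moves n m = {\<epsilon>. \<epsilon> \<in> moves n m \<and> (\<Sum>i<n. \<epsilon> i) = r}"
    by (auto simp: moves_def)
  finally show ?thesis .
qed

lemma finite_weights: "finite (weights n k)"
proof (rule finite_subset[OF _ finite_bounded_tuples[of "Suc n" "\<lambda>_. k"]])
  have "m i \<le> (\<Sum>j=1..n. m j)" if "i \<in> {1..n}" for m :: "nat \<Rightarrow> nat" and i
    using that by (intro member_le_sum) auto
  then show "weights n k \<subseteq> {\<epsilon>. (\<forall>i. Suc n \<le> i \<longrightarrow> \<epsilon> i = 0) \<and> (\<forall>i<Suc n. \<epsilon> i \<le> k)}"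
    unfolding weights_def by auto (metis atLeastAtMost_iff less_Suc_eq_le not_less zero_le le_zero_eq)
qed

lemma sum_rotate:
  fixes n :: nat
  assumes "n \<ge> 1"
  shows "(\<Sum>j=1..n. f (j mod n)) = (\<Sum>i<n. f i)" 
proof -
  have "(\<Sum>j=1..n. f (j mod n)) = (\<Sum>j\<in>{1..<n} \<union> {n}. f (j mod n))"
    using assms by (intro sum.cong) (auto simp: le_less)
  also have "\<dots> = (\<Sum>j\<in>{1..<n}. f j) + f 0" by (subst sum.union_disjoint) auto
  also have "\<dots> = (\<Sum>j\<in>{0..<n}. f j)" using assms by (simp add: sum.atLeast_Suc_lessThan add.commute)
  finally show ?thesis by (simp add: lessThan_atLeast0)
qed

lemma hop_weights:
  assumes "n \<ge> 2" "m \<in> weights n k" "\<epsilon> \<in> moves n m"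
  shows "hop n m \<epsilon> \<in> weights n k"
proof -
  have le: "\<epsilon> (j mod n) \<le> m j" if "j \<in> {1..n}" for j
    using assms(1) that assms(3)[unfolded moves_def capacity_def, simplified, THEN conjunct2, rule_format, of "j mod n"]
    by (cases "j = n") auto
  \<comment> \<open>The departures are added on both sides, so that no truncated subtraction is
    left.\<close>
  have "(\<Sum>j=1..n. hop n m \<epsilon> j) + (\<Sum>j=1..n. \<epsilon> (j mod n)) = (\<Sum>j=1..n. m j - \<epsilon> (j mod n) + \<epsilon> (j - 1) + \<epsilon> (j mod n))"
    unfolding sum.distrib[symmetric] by (intro sum.cong) (auto simp: hop_def)
  also have "\<dots> = (\<Sum>j=1..n. m j + \<epsilon> (j - 1))" by (intro sum.cong refl) (use le in \<open>force\<close>)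
  also have "\<dots> = (\<Sum>j=1..n. m j) + (\<Sum>j=1..n. \<epsilon> (j - 1))" by (rule sum.distrib)
  also have "(\<Sum>j=1..n. \<epsilon> (j - 1)) = (\<Sum>i<n. \<epsilon> i)"
    by (rule sum.reindex_bij_witness[of _ Suc "\<lambda>j. j - 1"]) auto
  also have "(\<Sum>j=1..n. \<epsilon> (j mod n)) = (\<Sum>i<n. \<epsilon> i)" using assms(1) by (intro sum_rotate) auto
  finally have "(\<Sum>j=1..n. hop n m \<epsilon> j) = (\<Sum>j=1..n. m j)" by simp
  then show ?thesis using assms(2) by (auto simp: weights_def hop_def)
qed

lemma CP_sum: "(\<And>i. i \<in> I \<Longrightarrow> f i \<in> CP n k) \<Longrightarrow> (\<Sum>i\<in>I. f i) \<in> CP n k"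
proof (induction I rule: infinite_finite_induct)
  case (insert x F)
  then show ?case using Poly_Mapping.keys_add[of "f x" "sum f F"] by (auto simp: CP_def)
qed (auto simp: CP_def)

lemma CP_zero: "0 \<in> CP n k" by (simp add: CP_def)

lemma CP_add: "u \<in> CP n k \<Longrightarrow> v \<in> CP n k \<Longrightarrow> u + v \<in> CP n k"
  using Poly_Mapping.keys_add[of u v] by (auto simp: CP_def)

lemma CP_scale: "v \<in> CP n k \<Longrightarrow> scale c v \<in> CP n k"
  by (auto simp: CP_def in_keys_iff)

lemma CP_basis: "m \<in> weights n k \<Longrightarrow> basis_vec m \<in> CP n k"
  by (simp add: CP_def)

lemma plactic_h_CP:
  assumes "n \<ge> 2" "v \<in> CP n k"
  shows "plactic_h n r v \<in> CP n k"
proof (cases "r < 0")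
  case True
  then show ?thesis by (simp add: plactic_h_def CP_zero)
next
  case False
  then obtain s where s: "r = int s" by (metis nonneg_int_cases not_less)
  show ?thesis
    unfolding s
    using assms by (subst linear_op_expansion[OF linear_op_plactic_h], intro CP_sum CP_scale)
      (auto intro!: CP_sum CP_basis hop_weights simp: plactic_h_basis CP_def[of n k, THEN eqset_imp_iff, of v, unfolded mem_Collect_eq] subset_iff)
qed

text \<open>The eigenvalue equation for the values on weights is the one for the transpose of
  \<open>plactic_h\<close> on the functional; it need only hold at the weights of level
  \<open>k\<close>.\<close>

lemma pairing_plactic_h:
  assumes "n \<ge> 2" "v \<in> CP n k"
    and eigen: "\<And>m. m \<in> weights n k \<Longrightarrow> (\<Sum>\<epsilon> | \<epsilon> \<in> moves n m \<and> (\<Sum>i<n. \<epsilon> i) = r. \<psi> (hop n m \<epsilon>)) = e * \<psi> m"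
  shows "pairing \<psi> (plactic_h n (int r) v) = e * pairing \<psi> v"
proof -
  have "pairing \<psi> (plactic_h n (int r) v) =
    (\<Sum>m\<in>Poly_Mapping.keys v. Poly_Mapping.lookup v m * (\<Sum>\<epsilon> | \<epsilon> \<in> moves n m \<and> (\<Sum>i<n. \<epsilon> i) = r. \<psi> (hop n m \<epsilon>)))"
    by (subst linear_op_expansion[OF linear_op_plactic_h])
      (simp add: plactic_h_basis assms(1) pairing_sum pairing_scale)
  also have "\<dots> = (\<Sum>m\<in>Poly_Mapping.keys v. Poly_Mapping.lookup v m * (e * \<psi> m))"
    using assms(2) by (intro sum.cong) (auto simp: eigen CP_def subset_iff)
  finally show ?thesis by (simp add: pairing_def sum_distrib_left mult_ac)
qed

section \<open>Determinants\<close>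

lemma det_mat_leibniz:
  "det (mat n n f) = (\<Sum>p | p permutes {0..<n}. of_int (sign p) * (\<Prod>i<n. f (i, p i)))"
proof -
  have "(\<Prod>i = 0..<n. mat n n f $$ (i, p i)) = (\<Prod>i<n. f (i, p i))" if "p permutes {0..<n}" for p
  proof (rule prod.cong)
    fix i assume "i \<in> {..<n}"
    then have "i < n" "p i < n" using permutes_in_image[OF that, of i] by auto
    then show "mat n n f $$ (i, p i) = f (i, p i)" by simp
  qed (simp add: lessThan_atLeast0)
  then show ?thesis
    by (subst det_def'[of _ n], simp, intro sum.cong refl) simp
qed

text \<open>Connects the 1-based Leibniz sums of \<open>plactic_schur\<close> and
  \<open>S_matrix\<close> with the 0-based \<open>det\<close>. Conjugation by the shift of indices
  preserves signs.\<close>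

lemma sum_permutes_shift:
  "(\<Sum>p | p permutes {1..n}. of_int (sign p) * (\<Prod>i=1..n. f i (p i))) =
   (det (mat n n (\<lambda>(i, j). f (i + 1) (j + 1))) :: 'a :: comm_ring_1)"
proof -
  have bij: "bij_betw Suc {0..<n} {1..n}"
    by (rule bij_betw_byWitness[of _ "\<lambda>i. i - 1"]) auto
  have bij': "bij_betw (\<lambda>i. i - 1) {1..n} {0..<n}"
    by (rule bij_betw_byWitness[of _ Suc]) auto
  have app: "map_permutation {0..<n} Suc p (Suc i) = Suc (p i)" if "p permutes {0..<n}" "i < n" for p i
    using map_permutation_apply[of Suc "{0..<n}" i p] bij that by (simp add: bij_betw_def)
  have "(\<Sum>p | p permutes {1..n}. of_int (sign p) * (\<Prod>i=1..n. f i (p i))) =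
    (\<Sum>p | p permutes {0..<n}. of_int (sign p) * (\<Prod>i<n. f (Suc i) (Suc (p i))))"
  proof (rule sum.reindex_bij_witness[of _ "map_permutation {0..<n} Suc" "map_permutation {1..n} (\<lambda>i. i - 1)"])
    fix p assume p: "p \<in> {p. p permutes {1..n}}"
    then show "map_permutation {0..<n} Suc (map_permutation {1..n} (\<lambda>i. i - 1) p) = p"
      by (intro map_permutation_compose_inv[OF bij']) auto
    show "map_permutation {1..n} (\<lambda>i. i - 1) p \<in> {p. p permutes {0..<n}}"
      using p map_permutation_permutes[OF bij'] by auto
    let ?q = "map_permutation {1..n} (\<lambda>i. i - 1) p"
    have q: "?q i = p (Suc i) - 1" if "i < n" for i
      using map_permutation_apply[of "\<lambda>i. i - 1" "{1..n}" "Suc i" p] bij' that p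
      by (simp add: bij_betw_def)
    have pr: "p (Suc i) \<in> {1..n}" if "i < n" for i
      using p that permutes_in_image[of p "{1..n}" "Suc i"] by auto
    have "(\<Prod>i<n. f (Suc i) (Suc (?q i))) = (\<Prod>i<n. f (Suc i) (p (Suc i)))"
    proof (intro prod.cong refl)
      fix i assume "i \<in> {..<n}"
      then have "Suc (?q i) = p (Suc i)" using q[of i] pr[of i] by (auto simp del: One_nat_def)
      then show "f (Suc i) (Suc (?q i)) = f (Suc i) (p (Suc i))" by simp
    qed
    also have "\<dots> = (\<Prod>i=1..n. f i (p i))"
      by (rule prod.reindex_bij_witness[of _ "\<lambda>i. i - 1" Suc]) auto
    finally show "of_int (sign ?q) * (\<Prod>i<n. f (Suc i) (Suc (?q i))) = of_int (sign p) * (\<Prod>i=1..n. f i (p i))"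
      using p bij' by (subst sign_map_permutation) (auto simp: bij_betw_def)
  next
    fix p assume p: "p \<in> {p. p permutes {0..<n}}"
    then show "map_permutation {1..n} (\<lambda>i. i - 1) (map_permutation {0..<n} Suc p) = p"
      by (intro map_permutation_compose_inv[OF bij]) auto
    show "map_permutation {0..<n} Suc p \<in> {p. p permutes {1..n}}"
      using p map_permutation_permutes[OF bij] by auto
  qed
  then show ?thesis by (simp add: det_mat_leibniz)
qed

lemma det_scale_rows_cols:
  "det (mat n n (\<lambda>(i, j). a i * b j * f i j)) = (\<Prod>i<n. a i) * (\<Prod>j<n. b j) * det (mat n n (\<lambda>(i, j). f i j))"
proof -
  have "(\<Prod>i<n. a i * b (p i) * f i (p i)) = (\<Prod>i<n. a i) * (\<Prod>j<n. b j) * (\<Prod>i<n. f i (p i))"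
    if "p permutes {0..<n}" for p
    using prod.permute[OF that, of b] by (simp add: prod.distrib lessThan_atLeast0)
  then have "det (mat n n (\<lambda>(i, j). a i * b j * f i j)) =
    (\<Sum>p | p permutes {0..<n}. (\<Prod>i<n. a i) * (\<Prod>j<n. b j) * (of_int (sign p) * (\<Prod>i<n. f i (p i))))"
    unfolding det_mat_leibniz by (intro sum.cong refl) (simp add: mult_ac)
  then show ?thesis by (simp add: det_mat_leibniz sum_distrib_left)
qed

lemma det_scale_cols:
  "det (mat n n (\<lambda>(i, j). b j * f i j)) = (\<Prod>j<n. b j) * det (mat n n (\<lambda>(i, j). f i j))"
  using det_scale_rows_cols[of n "\<lambda>_. 1" b f] by simp

lemma prod_list_diag: "A \<in> carrier_mat n n \<Longrightarrow> prod_list (diag_mat A) = (\<Prod>i<n. A $$ (i, i))"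
  by (simp add: diag_mat_def prod.list_conv_set_nth lessThan_atLeast0)

lemma det_upper_triangular_mat:
  assumes "\<And>i j. j < i \<Longrightarrow> i < n \<Longrightarrow> f i j = 0"
  shows "det (mat n n (\<lambda>(i, j). f i j)) = (\<Prod>i<n. f i i)"
  by (subst det_upper_triangular[of _ n])
     (use assms in \<open>auto simp: upper_triangular_def prod_list_diag[of _ n]\<close>)

lemma det_lower_triangular_mat:
  assumes "\<And>i j. i < j \<Longrightarrow> j < n \<Longrightarrow> f i j = 0"
  shows "det (mat n n (\<lambda>(i, j). f i j)) = (\<Prod>i<n. f i i)"
  by (subst det_lower_triangular[of n]) (use assms in \<open>auto simp: prod_list_diag[of _ n]\<close>)

text \<open>Left multiplication by this matrix subtracts from each row \<open>w i\<close> times the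
  cyclically preceding row.\<close>

definition cyclic_bidiagonal :: "nat \<Rightarrow> (nat \<Rightarrow> 'a :: comm_ring_1) \<Rightarrow> 'a mat" where
  "cyclic_bidiagonal n w = mat n n (\<lambda>(i, j). (if i = j then 1 else 0)
      - (if (if i = 0 then n - 1 else i - 1) = j then w i else 0))"

text \<open>Only the identity and the full cycle contribute. The sign of the n-cycle and the n signs
  of the entries \<open>- w i\<close> combine to a single minus.\<close>

lemma det_cyclic_bidiagonal:
  fixes w :: "nat \<Rightarrow> 'a :: comm_ring_1"
  assumes "n \<ge> 2"
  shows "det (cyclic_bidiagonal n w) = 1 - (\<Prod>i<n. w i)"
proof -
  let ?f = "\<lambda>i j. (if i = j then 1 else 0) - (if (if i = 0 then n - 1 else i - 1) = j then w i else 0)"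
  let ?A = "mat n n (\<lambda>(i, j). ?f i j)"
  have "det ?A = (\<Sum>j<n. ?A $$ (0, j) * cofactor ?A 0 j)"
    using assms by (intro laplace_expansion_row[of _ n]) auto
  also have "\<dots> = (\<Sum>j\<in>{0, n - 1}. ?A $$ (0, j) * cofactor ?A 0 j)"
    using assms by (intro sum.mono_neutral_right) auto
  also have "\<dots> = cofactor ?A 0 0 - w 0 * cofactor ?A 0 (n - 1)"
    using assms by auto
  also have "cofactor ?A 0 0 = 1"
  proof -
    have del: "mat_delete ?A 0 0 = mat (n - 1) (n - 1) (\<lambda>(i, j). ?f (Suc i) (Suc j))"
      by (rule eq_matI) (auto simp: mat_delete_def)
    have "det (mat (n - 1) (n - 1) (\<lambda>(i, j). ?f (Suc i) (Suc j))) = (\<Prod>i<n - 1. ?f (Suc i) (Suc i))"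
      by (subst det_lower_triangular_mat) (simp split: if_splits, simp)
    also have "\<dots> = 1" by simp
    finally show ?thesis by (simp only: cofactor_def del) simp
  qed
  also have "cofactor ?A 0 (n - 1) = (\<Prod>i<n - 1. w (Suc i))"
  proof -
    have del: "mat_delete ?A 0 (n - 1) = mat (n - 1) (n - 1) (\<lambda>(i, j). ?f (Suc i) j)"
      by (rule eq_matI) (auto simp: mat_delete_def)
    have "det (mat (n - 1) (n - 1) (\<lambda>(i, j). ?f (Suc i) j)) = (\<Prod>i<n - 1. ?f (Suc i) i)"
      by (subst det_upper_triangular_mat) (simp split: if_splits, simp)
    also have "\<dots> = (\<Prod>i<n - 1. - 1 * w (Suc i))" by simp
    also have "\<dots> = (-1) ^ (n - 1) * (\<Prod>i<n - 1. w (Suc i))" by (subst prod.distrib) simp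
    finally show ?thesis unfolding cofactor_def del
      by (simp add: mult.assoc[symmetric] power_add[symmetric] mult_2[symmetric])
  qed
  also have "w 0 * (\<Prod>i<n - 1. w (Suc i)) = (\<Prod>i<n. w i)"
    using assms by (cases n) (simp_all add: prod.lessThan_Suc_shift del: prod.lessThan_Suc)
  finally show ?thesis unfolding cyclic_bidiagonal_def by simp
qed

text \<open>By hypothesis the triangular Toeplitz matrices of \<open>e\<close> and of the signed
  \<open>h\<close> are inverse to each other. As the first has determinant 1, its adjugate is the
  second, and the corner entry of the adjugate is up to sign the determinant in question. This works
  without division.\<close>

lemma det_hessenberg_toeplitz:
  fixes e h :: "nat \<Rightarrow> 'a :: comm_ring_1"
  assumes e0: "e 0 = 1"
    and inv: "\<And>s. s \<le> r \<Longrightarrow> (\<Sum>i\<le>s. e i * ((-1) ^ (s - i) * h (s - i))) = (if s = 0 then 1 else 0)"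
  shows "det (mat r r (\<lambda>(i, j). if i \<le> Suc j then e (Suc j - i) else 0)) = h r"
proof -
  let ?T = "mat (Suc r) (Suc r) (\<lambda>(i, j). if i \<le> j then e (j - i) else 0)"
  let ?H = "mat (Suc r) (Suc r) (\<lambda>(i, j). if i \<le> j then (-1) ^ (j - i) * h (j - i) else 0)"
  have TH: "?T * ?H = 1\<^sub>m (Suc r)"
  proof (rule eq_matI)
    fix i j assume "i < dim_row (1\<^sub>m (Suc r) :: 'a mat)" "j < dim_col (1\<^sub>m (Suc r) :: 'a mat)"
    then have ij: "i < Suc r" "j < Suc r" by auto
    have "row ?T i \<bullet> col ?H j = (\<Sum>l<Suc r. (if i \<le> l \<and> l \<le> j then e (l - i) * ((-1) ^ (j - l) * h (j - l)) else 0))"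
      using ij by (auto simp: scalar_prod_def lessThan_atLeast0 intro!: sum.cong)
    also have "\<dots> = (\<Sum>l\<in>{i..j}. e (l - i) * ((-1) ^ (j - l) * h (j - l)))"
      using ij by (intro sum.mono_neutral_cong_right) auto
    also have "\<dots> = (if i = j then 1 else 0)"
    proof (cases "i \<le> j")
      case True
      have "(\<Sum>l\<in>{i..j}. e (l - i) * ((-1) ^ (j - l) * h (j - l))) =
         (\<Sum>l\<le>j - i. e l * ((-1) ^ (j - i - l) * h (j - i - l)))"
        by (rule sum.reindex_bij_witness[of _ "\<lambda>l. l + i" "\<lambda>l. l - i"]) (use True in auto)
      then show ?thesis using True ij inv[of "j - i"] by auto
    qed auto
    finally show "(?T * ?H) $$ (i, j) = 1\<^sub>m (Suc r) $$ (i, j)" using ij by simp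
  qed auto
  have detT: "det ?T = 1" by (subst det_upper_triangular_mat) (auto simp: e0)
  have "adj_mat ?T = (adj_mat ?T * ?T) * ?H"
    using adj_mat(1)[of ?T "Suc r"] TH by (subst assoc_mult_mat[of _ "Suc r" "Suc r" _ "Suc r" _ "Suc r"]) auto
  also have "adj_mat ?T * ?T = 1\<^sub>m (Suc r)"
    by (subst adj_mat(3)[of _ "Suc r"], simp, unfold detT) (rule eq_matI, auto)
  also have "1\<^sub>m (Suc r) * ?H = ?H" by (rule left_mult_one_mat[of _ "Suc r" "Suc r"]) simp
  finally have adj: "adj_mat ?T = ?H" .
  have "adj_mat ?T $$ (0, r) = cofactor ?T r 0" by (simp add: adj_mat_def)
  also have "\<dots> = (-1) ^ r * det (mat_delete ?T r 0)" by (simp add: cofactor_def)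
  also have "mat_delete ?T r 0 = mat r r (\<lambda>(i, j). if i \<le> Suc j then e (Suc j - i) else 0)"
    by (rule eq_matI) (auto simp: mat_delete_def)
  finally have "(-1) ^ r * det (mat r r (\<lambda>(i, j). if i \<le> Suc j then e (Suc j - i) else 0)) = (-1) ^ r * h r"
    unfolding adj by simp
  then have "(-1) ^ r * ((-1) ^ r * det (mat r r (\<lambda>(i, j). if i \<le> Suc j then e (Suc j - i) else 0))) = (-1) ^ r * ((-1) ^ r * h r)"
    by simp
  then show ?thesis by (simp add: mult.assoc[symmetric] power_add[symmetric] mult_2[symmetric])
qed

section \<open>Alternants as eigenfunctionals\<close>

definition alt_det :: "nat \<Rightarrow> (nat \<Rightarrow> complex) \<Rightarrow> (nat \<Rightarrow> nat) \<Rightarrow> complex" where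
  "alt_det n y l = det (mat n n (\<lambda>(i, j). y j ^ l i))"

text \<open>The exponents \<open>l\<close> of the alternant, counted from 0 and computed directly
  from the weight: the sum is the part of the associated partition with index
  \<open>Suc i\<close>.\<close>

definition heights :: "nat \<Rightarrow> (nat \<Rightarrow> nat) \<Rightarrow> nat \<Rightarrow> nat" where
  "heights n m i = (\<Sum>t\<in>{Suc i..<n}. m t) + (n - Suc i)"

definition bethe_roots :: "nat \<Rightarrow> nat \<Rightarrow> (nat \<Rightarrow> complex) \<Rightarrow> complex \<Rightarrow> bool" where
  "bethe_roots n k y \<zeta> \<longleftrightarrow>
     inj_on y {..<n} \<and> (\<forall>j<n. y j ^ (n + k) = \<zeta>) \<and> (\<Prod>j<n. y j) = 1"

definition root_poly :: "nat \<Rightarrow> (nat \<Rightarrow> complex) \<Rightarrow> complex poly" where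
  "root_poly n y = (\<Prod>j<n. [:1, - y j:])"

text \<open>The polynomial E(t). For n \<ge> 2 and Bethe roots the division is exact and the degree
  is \<open>k\<close>; the coefficients up to there are the complete symmetric functions of
  \<open>y\<close>.\<close>

definition bethe_poly :: "nat \<Rightarrow> nat \<Rightarrow> (nat \<Rightarrow> complex) \<Rightarrow> complex poly" where
  "bethe_poly n k y = (1 - Polynomial.monom (y 0 ^ (n + k)) (n + k)) div root_poly n y"

text \<open>Integer indices match the entries of Jacobi-Trudi determinants, where negative degrees
  mean 0.\<close>

definition icoeff :: "complex poly \<Rightarrow> int \<Rightarrow> complex" where
  "icoeff p r = (if r < 0 then 0 else coeff p (nat r))"

lemma alt_det_cong: "(\<And>i. i < n \<Longrightarrow> l i = l' i) \<Longrightarrow> alt_det n y l = alt_det n y l'"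
  unfolding alt_det_def by (intro arg_cong[where f = det] cong_mat) auto

lemma alt_det_shift:
  assumes "(\<Prod>j<n. y j) = 1"
  shows "alt_det n y (\<lambda>i. l i + c) = alt_det n y l"
proof -
  have "alt_det n y (\<lambda>i. l i + c) = det (mat n n (\<lambda>(i, j). y j ^ c * y j ^ l i))"
    by (simp add: alt_det_def power_add mult.commute)
  also have "\<dots> = (\<Prod>j<n. y j ^ c) * alt_det n y l"
    unfolding alt_det_def by (rule det_scale_cols)
  also have "(\<Prod>j<n. y j ^ c) = 1" using assms by (simp flip: prod_power_distrib)
  finally show ?thesis by simp
qed

lemma heights_Suc: "Suc i < n \<Longrightarrow> heights n m i = heights n m (Suc i) + m (Suc i) + 1"
  by (simp add: heights_def sum.atLeast_Suc_lessThan)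

lemma heights_last: "heights n m (n - Suc 0) = 0"
  by (cases n) (simp_all add: heights_def)

text \<open>Each exponent advances by its own \<open>\<epsilon> i\<close>; renormalising the last
  exponent to 0 subtracts the common amount \<open>\<epsilon> (n - 1)\<close>. Alternants do not see
  a common shift, because the product of the \<open>y j\<close> is 1.\<close>

lemma heights_hop:
  assumes "n \<ge> 2" "\<epsilon> \<in> moves n m" "i < n"
  shows "heights n (hop n m \<epsilon>) i + \<epsilon> (n - 1) = heights n m i + \<epsilon> i"
proof -
  have "i \<le> n - 1" using assms by simp
  then show ?thesis
  proof (induction i rule: inc_induct)
    case base
    then show ?case using assms by (simp add: heights_last)
  next
    case (step i)
    then have i: "Suc i < n" by simp
    then have "hop n m \<epsilon> (Suc i) = m (Suc i) - \<epsilon> (Suc i) + \<epsilon> i" by (simp add: hop_def)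
    moreover have "\<epsilon> (Suc i) \<le> m (Suc i)"
      using assms(2) i by (auto simp: moves_def capacity_def split: if_splits)
    ultimately show ?case using step.IH heights_Suc[OF i, of m] heights_Suc[OF i, of "hop n m \<epsilon>"] by simp
  qed
qed

lemma alt_det_hop:
  assumes "n \<ge> 2" "\<epsilon> \<in> moves n m" "(\<Prod>j<n. y j) = 1"
  shows "alt_det n y (heights n (hop n m \<epsilon>)) = alt_det n y (\<lambda>i. heights n m i + \<epsilon> i)"
proof -
  have "alt_det n y (\<lambda>i. heights n m i + \<epsilon> i) = alt_det n y (\<lambda>i. heights n (hop n m \<epsilon>) i + \<epsilon> (n - 1))"
    by (intro alt_det_cong heights_hop[OF assms(1,2), symmetric])
  then show ?thesis by (simp add: alt_det_shift[OF assms(3)])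
qed

lemma const_poly_sum: "[:\<Sum>i\<in>I. f i:] = (\<Sum>i\<in>I. [:f i:])"
proof (induction I rule: infinite_finite_induct)
  case (insert a I)
  then show ?case by (simp flip: insert.IH)
qed auto

lemma const_poly_prod: "[:\<Prod>i\<in>I. f i:] = (\<Prod>i\<in>I. [:f i:])"
  for f :: "_ \<Rightarrow> 'a :: comm_semiring_1"
proof (induction I rule: infinite_finite_induct)
  case (insert a I)
  then show ?case by (simp add: mult.commute flip: insert.IH)
qed (auto simp: one_pCons)

lemma const_poly_of_int: "[:of_int a:] = (of_int a :: 'a :: comm_ring_1 poly)"
  by (simp add: of_int_poly)

lemma prod_monom:
  "(\<Prod>i\<in>I. Polynomial.monom (c i) (e i)) = Polynomial.monom (\<Prod>i\<in>I. c i :: 'a :: comm_semiring_1) (\<Sum>i\<in>I. e i)"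
  by (induction I rule: infinite_finite_induct) (auto simp: mult_monom)

lemma det_const_poly: "det (mat n n (\<lambda>(i, j). [:f i j:])) = [:det (mat n n (\<lambda>(i, j). f i j)):]"
proof -
  have "[:of_int (sign p) * (\<Prod>i<n. f i (p i)):] = of_int (sign p) * (\<Prod>i<n. [:f i (p i):])" for p
    by (simp add: const_poly_prod[symmetric] const_poly_of_int[symmetric])
  then show ?thesis by (simp add: det_mat_leibniz const_poly_sum)
qed

lemma sum_moves_PiE:
  "(\<Sum>\<epsilon>\<in>moves n m. F \<epsilon>) = (\<Sum>g\<in>PiE {..<n} (\<lambda>i. {..capacity n m i}). F (\<lambda>i. if i < n then g i else 0))"
proof (rule sum.reindex_bij_witness[of _ "\<lambda>g i. if i < n then g i else 0" "\<lambda>\<epsilon>. restrict \<epsilon> {..<n}"])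
  fix \<epsilon> assume e: "\<epsilon> \<in> moves n m"
  then show "(\<lambda>i. if i < n then restrict \<epsilon> {..<n} i else 0) = \<epsilon>"
    by (auto simp: moves_def fun_eq_iff)
  then show "F (\<lambda>i. if i < n then restrict \<epsilon> {..<n} i else 0) = F \<epsilon>" by (rule arg_cong)
  show "restrict \<epsilon> {..<n} \<in> PiE {..<n} (\<lambda>i. {..capacity n m i})" using e by (auto simp: moves_def)
next
  fix g assume g: "g \<in> PiE {..<n} (\<lambda>i. {..capacity n m i})"
  then show "restrict (\<lambda>i. if i < n then g i else 0) {..<n} = g"
    by (auto simp: fun_eq_iff PiE_def extensional_def)
  show "(\<lambda>i. if i < n then g i else 0) \<in> moves n m" using g by (auto simp: moves_def)
qed

text \<open>The components of \<open>\<epsilon>\<close> vary independently, so multilinearity puts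
  each sum into its own row. The power of t records the total number of hops, that is, the index r
  of h_r.\<close>

lemma sum_moves_alt_det:
  "(\<Sum>\<epsilon>\<in>moves n m. Polynomial.monom (alt_det n y (\<lambda>i. l i + \<epsilon> i)) (\<Sum>i<n. \<epsilon> i)) =
   det (mat n n (\<lambda>(i, j). \<Sum>e\<le>capacity n m i. Polynomial.monom (y j ^ (l i + e)) e))"
proof -
  let ?G = "PiE {..<n} (\<lambda>i. {..capacity n m i})"
  let ?P = "{p. p permutes {0..<n}}"
  have "det (mat n n (\<lambda>(i, j). \<Sum>e\<le>capacity n m i. Polynomial.monom (y j ^ (l i + e)) e)) =
    (\<Sum>p\<in>?P. of_int (sign p) * (\<Prod>i<n. \<Sum>e\<le>capacity n m i. Polynomial.monom (y (p i) ^ (l i + e)) e))"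
    by (simp add: det_mat_leibniz)
  also have "\<dots> = (\<Sum>p\<in>?P. \<Sum>g\<in>?G. of_int (sign p) * Polynomial.monom (\<Prod>i<n. y (p i) ^ (l i + g i)) (\<Sum>i<n. g i))"
    by (simp add: prod_sum_PiE prod_monom sum_distrib_left)
  also have "\<dots> = (\<Sum>g\<in>?G. \<Sum>p\<in>?P. of_int (sign p) * Polynomial.monom (\<Prod>i<n. y (p i) ^ (l i + g i)) (\<Sum>i<n. g i))"
    by (rule sum.swap)
  also have "\<dots> = (\<Sum>g\<in>?G. Polynomial.monom (alt_det n y (\<lambda>i. l i + g i)) (\<Sum>i<n. g i))"
  proof (rule sum.cong[OF refl])
    fix g assume "g \<in> ?G"
    have "of_int a * Polynomial.monom c s = Polynomial.monom (of_int a * c) s" for a s and c :: complex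
      by (simp add: const_poly_of_int[symmetric] smult_monom)
    then show "(\<Sum>p\<in>?P. of_int (sign p) * Polynomial.monom (\<Prod>i<n. y (p i) ^ (l i + g i)) (\<Sum>i<n. g i)) =
       Polynomial.monom (alt_det n y (\<lambda>i. l i + g i)) (\<Sum>i<n. g i)"
      by (simp add: alt_det_def det_mat_leibniz monom_sum)
  qed
  also have "\<dots> = (\<Sum>g\<in>?G. Polynomial.monom (alt_det n y (\<lambda>i. l i + (if i < n then g i else 0))) (\<Sum>i<n. if i < n then g i else 0))"
    by (intro sum.cong refl arg_cong2[where f = Polynomial.monom] alt_det_cong) auto
  also have "\<dots> = (\<Sum>\<epsilon>\<in>moves n m. Polynomial.monom (alt_det n y (\<lambda>i. l i + \<epsilon> i)) (\<Sum>i<n. \<epsilon> i))"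
    by (rule sum_moves_PiE[symmetric])
  finally show ?thesis by (rule sym)
qed

lemma geometric_monom:
  "[:1, - y:] * (\<Sum>e\<le>d. Polynomial.monom (y ^ (l + e)) e) =
     [:y ^ l:] - Polynomial.monom (y ^ (l + Suc d)) (Suc d)" for y :: "'a :: comm_ring_1"
proof -
  have lin: "[:1, - y:] = 1 - Polynomial.monom y 1" by (simp add: monom_altdef one_pCons)
  show ?thesis
  proof (induction d)
    case 0
    have "(\<Sum>e\<le>0. Polynomial.monom (y ^ (l + e)) e) = Polynomial.monom (y ^ l) 0" by simp
    then show ?case by (simp only: lin left_diff_distrib mult_monom) (simp add: monom_0)
  next
    case (Suc d)
    have "[:1, - y:] * (\<Sum>e\<le>Suc d. Polynomial.monom (y ^ (l + e)) e) =
      [:y ^ l:] - Polynomial.monom (y ^ (l + Suc d)) (Suc d) + [:1, - y:] * Polynomial.monom (y ^ (l + Suc d)) (Suc d)"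
      using Suc by (simp add: distrib_left del: mult_pCons_left)
    also have "[:1, - y:] * Polynomial.monom (y ^ (l + Suc d)) (Suc d) =
      Polynomial.monom (y ^ (l + Suc d)) (Suc d) - Polynomial.monom (y ^ (l + Suc (Suc d))) (Suc (Suc d))"
      unfolding lin by (simp add: left_diff_distrib mult_monom)
    finally show ?case by simp
  qed
qed

lemma sum_capacity:
  assumes "n \<ge> 1" "m \<in> weights n k"
  shows "(\<Sum>i<n. capacity n m i) = k"
proof -
  have "(\<Sum>i<n. capacity n m i) = (\<Sum>j=1..n. capacity n m (j mod n))"
    using assms by (intro sum_rotate[symmetric]) simp
  also have "\<dots> = (\<Sum>j=1..n. m j)"
    by (intro sum.cong) (auto simp: capacity_def le_less)
  finally show ?thesis using assms by (simp add: weights_def)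
qed

text \<open>Cyclic closure: the range of the highest exponent ends just before \<open>n + k\<close>,
  which is the last exponent 0 moved by one period.\<close>

lemma heights_0:
  assumes "n \<ge> 1" "m \<in> weights n k"
  shows "heights n m 0 + capacity n m 0 + 1 = n + k"
proof -
  have "(\<Sum>i<n. capacity n m i) = capacity n m 0 + (\<Sum>t\<in>{Suc 0..<n}. capacity n m t)"
    using assms by (simp add: sum.atLeast_Suc_lessThan lessThan_atLeast0)
  also have "(\<Sum>t\<in>{Suc 0..<n}. capacity n m t) = (\<Sum>t\<in>{Suc 0..<n}. m t)"
    by (intro sum.cong) (auto simp: capacity_def)
  finally show ?thesis using assms sum_capacity[OF assms] by (simp add: heights_def)
qed

text \<open>
  The sum over all hops is a determinant of geometric series; clearing denominators column by
  column leaves the product of a cyclic bidiagonal matrix with the alternant, because each series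
  ends at the exponent where the preceding row starts.
\<close>

lemma sum_moves_root_poly:
  assumes n: "n \<ge> 2" and m: "m \<in> weights n k" and y: "\<And>j. j < n \<Longrightarrow> y j ^ (n + k) = \<zeta>"
  shows "root_poly n y * (\<Sum>\<epsilon>\<in>moves n m. Polynomial.monom (alt_det n y (\<lambda>i. heights n m i + \<epsilon> i)) (\<Sum>i<n. \<epsilon> i))
    = Polynomial.smult (alt_det n y (heights n m)) (1 - Polynomial.monom \<zeta> (n + k))"
proof -
  let ?l = "heights n m" and ?d = "capacity n m"
  \<comment> \<open>The series of row \<open>i\<close> stops where row \<open>i - 1\<close> starts.
    For row 0 this is the exponent \<open>n + k\<close>, where the power of \<open>y j\<close> is
    \<zeta> times the entry 1 of the last row.\<close>
  define w where "w = (\<lambda>i. Polynomial.monom (if i = 0 then \<zeta> else 1) (Suc (?d i)))"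
  define C where "C = cyclic_bidiagonal n w"
  let ?prev = "\<lambda>i. if i = 0 then n - 1 else i - 1"
  let ?Y = "mat n n (\<lambda>(i, j). [:y j ^ ?l i:])"
  have entry: "[:1, - y j:] * (\<Sum>e\<le>?d i. Polynomial.monom (y j ^ (?l i + e)) e) = (C * ?Y) $$ (i, j)"
    if "i < n" "j < n" for i j
  proof -
    have "(C * ?Y) $$ (i, j) =
       (\<Sum>t<n. ((if i = t then 1 else 0) - (if ?prev i = t then w i else 0)) * [:y j ^ ?l t:])"
      using that by (simp add: C_def cyclic_bidiagonal_def scalar_prod_def lessThan_atLeast0)
    also have "\<dots> = (\<Sum>t<n. (if i = t then [:y j ^ ?l t:] else 0) - (if ?prev i = t then w i * [:y j ^ ?l t:] else 0))"
    proof -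
      have "((if a then 1 else 0) - (if b then w else 0)) * c = (if a then c else 0) - (if b then w * c else 0)"
        for a b and w c :: "complex poly" by (simp add: left_diff_distrib)
      then show ?thesis by (simp only:)
    qed
    also have "\<dots> = [:y j ^ ?l i:] - w i * [:y j ^ ?l (?prev i):]"
    proof -
      have "?prev i < n" using that n by (cases "i = 0") auto
      then show ?thesis using that by (simp only: sum_subtractf sum.delta' finite_lessThan lessThan_iff if_True)
    qed
    also have "w i * [:y j ^ ?l (?prev i):] = Polynomial.monom (y j ^ (?l i + Suc (?d i))) (Suc (?d i))"
    proof (cases "i = 0")
      case True
      have "y j ^ (?l 0 + Suc (?d 0)) = \<zeta>" using heights_0[OF _ m] n y[OF \<open>j < n\<close>] by simp
      then show ?thesis using True n by (simp add: w_def heights_last smult_monom)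
    next
      case False
      then have "?l (i - 1) = ?l i + Suc (?d i)"
        using heights_Suc[of "i - 1" n m] \<open>i < n\<close> by (simp add: capacity_def)
      then show ?thesis using False by (simp add: w_def smult_monom)
    qed
    finally show ?thesis by (simp only: geometric_monom)
  qed
  have 1: "root_poly n y * (\<Sum>\<epsilon>\<in>moves n m. Polynomial.monom (alt_det n y (\<lambda>i. ?l i + \<epsilon> i)) (\<Sum>i<n. \<epsilon> i))
    = det (mat n n (\<lambda>(i, j). [:1, - y j:] * (\<Sum>e\<le>?d i. Polynomial.monom (y j ^ (?l i + e)) e)))"
    unfolding sum_moves_alt_det root_poly_def det_scale_cols ..
  have 2: "mat n n (\<lambda>(i, j). [:1, - y j:] * (\<Sum>e\<le>?d i. Polynomial.monom (y j ^ (?l i + e)) e)) = C * ?Y"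
  proof (rule eq_matI)
    fix i j assume "i < dim_row (C * ?Y)" "j < dim_col (C * ?Y)"
    then have ij: "i < n" "j < n" by (simp_all add: C_def cyclic_bidiagonal_def)
    show "mat n n (\<lambda>(i, j). [:1, - y j:] * (\<Sum>e\<le>?d i. Polynomial.monom (y j ^ (?l i + e)) e)) $$ (i, j)
      = (C * ?Y) $$ (i, j)"
      by (simp only: index_mat(1)[OF ij] split entry[OF ij])
  qed (simp_all add: C_def cyclic_bidiagonal_def)
  have 3: "det (C * ?Y) = det C * det ?Y"
    by (rule det_mult[of _ n]) (auto simp: C_def cyclic_bidiagonal_def)
  have 4: "det C = 1 - (\<Prod>i<n. w i)" unfolding C_def by (rule det_cyclic_bidiagonal[OF n])
  have 5: "(\<Prod>i<n. w i) = Polynomial.monom \<zeta> (n + k)"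
  proof -
    have "(\<Sum>i<n. Suc (?d i)) = n + k"
      unfolding Suc_eq_plus1 sum.distrib using sum_capacity[OF _ m] n by simp
    moreover have "(\<Prod>i<n. if i = 0 then \<zeta> else 1) = \<zeta>" using n by (simp add: prod.delta)
    ultimately show ?thesis by (simp only: w_def prod_monom)
  qed
  have 6: "det ?Y = [:alt_det n y ?l:]" by (simp add: det_const_poly alt_det_def)
  show ?thesis unfolding 1 2 3 4 5 6 by simp
qed

lemma bethe_root_nonzero:
  assumes "bethe_roots n k y \<zeta>" "j < n"
  shows "y j \<noteq> 0"
  using assms prod_zero[of "{..<n}" y] by (auto simp: bethe_roots_def)

lemma linear_factor_dvd:
  fixes p :: "'a :: field poly"
  assumes "a \<noteq> 0" "poly p (1 / a) = 0"
  shows "[:1, - a:] dvd p"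
proof -
  have "[:- (1 / a), 1:] dvd p" using assms(2) by (simp add: poly_eq_0_iff_dvd)
  moreover have "[:1, - a:] = Polynomial.smult (- a) [:- (1 / a), 1:]" using assms by simp
  ultimately show ?thesis using assms(1) by (metis neg_equal_0_iff_equal smult_dvd)
qed

lemma prod_linear_factors_dvd:
  fixes p :: "'a :: field poly"
  assumes "finite J" "inj_on y J" "\<And>j. j \<in> J \<Longrightarrow> y j \<noteq> 0" "\<And>j. j \<in> J \<Longrightarrow> poly p (1 / y j) = 0"
  shows "(\<Prod>j\<in>J. [:1, - y j:]) dvd p"
  using assms
proof (induction J rule: finite_induct)
  case (insert a J)
  then obtain q where q: "p = (\<Prod>j\<in>J. [:1, - y j:]) * q" by (auto simp: inj_on_insert)
  have "poly (\<Prod>j\<in>J. [:1, - y j:]) (1 / y a) \<noteq> 0"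
    using insert by (auto simp: poly_prod field_simps)
  then have "poly q (1 / y a) = 0" using insert.prems(3)[of a] q by auto
  then have "[:1, - y a:] dvd q" using insert by (intro linear_factor_dvd) auto
  then show ?case using insert.hyps q by (auto intro: mult_dvd_mono simp: mult.commute simp del: mult_pCons_left mult_pCons_right)
qed auto

section \<open>The polynomial E(t) of a tuple of Bethe roots\<close>

context
  fixes n k y \<zeta>
  assumes n: "n \<ge> 2" and y: "bethe_roots n k y \<zeta>"
begin

lemma bethe_poly_mult: "bethe_poly n k y * root_poly n y = 1 - Polynomial.monom \<zeta> (n + k)"
proof -
  have z: "y 0 ^ (n + k) = \<zeta>" using y n by (simp add: bethe_roots_def)
  have "root_poly n y dvd 1 - Polynomial.monom \<zeta> (n + k)"
    unfolding root_poly_def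
  proof (rule prod_linear_factors_dvd)
    fix j assume j: "j \<in> {..<n}"
    then show "y j \<noteq> 0" using bethe_root_nonzero[OF y] by simp
    moreover have "y j ^ (n + k) = \<zeta>" using y j by (simp add: bethe_roots_def)
    ultimately show "poly (1 - Polynomial.monom \<zeta> (n + k)) (1 / y j) = 0"
      by (auto simp: poly_monom power_divide)
  qed (use y in \<open>auto simp: bethe_roots_def\<close>)
  then show ?thesis by (simp add: bethe_poly_def z)
qed

lemma root_poly_nonzero: "root_poly n y \<noteq> 0"
  by (simp add: root_poly_def)

lemma zeta_nonzero: "\<zeta> \<noteq> 0"
proof -
  have "y 0 ^ (n + k) = \<zeta>" "y 0 \<noteq> 0" using y n bethe_root_nonzero[OF y, of 0] by (auto simp: bethe_roots_def)
  then show ?thesis by auto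
qed

lemma degree_root_poly: "degree (root_poly n y) = n" and lead_coeff_root_poly: "lead_coeff (root_poly n y) = (-1) ^ n"
proof -
  have nz: "y j \<noteq> 0" if "j < n" for j using bethe_root_nonzero[OF y that] .
  have "degree (root_poly n y) = (\<Sum>j<n. degree [:1, - y j:])"
    unfolding root_poly_def by (rule degree_prod_eq_sum_degree) auto
  then show "degree (root_poly n y) = n" using nz by simp
  have "lead_coeff (root_poly n y) = (\<Prod>j<n. lead_coeff [:1, - y j:])"
    unfolding root_poly_def by (rule lead_coeff_prod)
  also have "\<dots> = (\<Prod>j<n. - 1 * y j)" using nz by (intro prod.cong) auto
  also have "\<dots> = (-1) ^ n" using y by (subst prod.distrib) (simp add: bethe_roots_def)
  finally show "lead_coeff (root_poly n y) = (-1) ^ n" .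
qed

lemma degree_one_minus_monom:
  "degree (1 - Polynomial.monom \<zeta> (n + k)) = n + k" "lead_coeff (1 - Polynomial.monom \<zeta> (n + k)) = - \<zeta>"
proof -
  have "degree (1 - Polynomial.monom \<zeta> (n + k)) \<le> n + k"
    by (intro degree_diff_le) (auto simp: degree_monom_le)
  moreover have c: "coeff (1 - Polynomial.monom \<zeta> (n + k)) (n + k) = - \<zeta>"
    using n by simp
  ultimately show "degree (1 - Polynomial.monom \<zeta> (n + k)) = n + k"
    using zeta_nonzero by (intro antisym le_degree) auto
  then show "lead_coeff (1 - Polynomial.monom \<zeta> (n + k)) = - \<zeta>" using c by simp
qed

lemma bethe_poly_nonzero: "bethe_poly n k y \<noteq> 0"
proof
  assume "bethe_poly n k y = 0"
  then have "1 - Polynomial.monom \<zeta> (n + k) = 0" using bethe_poly_mult by simp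
  then show False
    using degree_one_minus_monom(2) zeta_nonzero by (metis leading_coeff_0_iff neg_equal_0_iff_equal)
qed

lemma degree_bethe_poly: "degree (bethe_poly n k y) = k"
  using degree_mult_eq[OF bethe_poly_nonzero root_poly_nonzero]
  by (simp add: bethe_poly_mult degree_one_minus_monom degree_root_poly)

text \<open>Comparison of leading coefficients in the product with \<open>root_poly\<close>, whose
  leading coefficient carries the product of the roots. This is the eigenvalue of h_k, the operator
  that rotates the weights.\<close>

lemma coeff_bethe_poly_top: "coeff (bethe_poly n k y) k = (-1) ^ (n + 1) * \<zeta>"
proof -
  have "lead_coeff (bethe_poly n k y) * (-1) ^ n = - \<zeta>"
    unfolding lead_coeff_root_poly[symmetric] lead_coeff_mult[symmetric] bethe_poly_mult
    by (rule degree_one_minus_monom)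
  then have "lead_coeff (bethe_poly n k y) * (-1) ^ n * (-1) ^ n = - \<zeta> * (-1) ^ n" by simp
  then show ?thesis by (simp add: mult.assoc power_add[symmetric] mult_2[symmetric] degree_bethe_poly)
qed

lemma coeff_bethe_poly_0: "coeff (bethe_poly n k y) 0 = 1"
proof -
  have "coeff (root_poly n y) 0 = 1" by (simp add: root_poly_def poly_0_coeff_0[symmetric] poly_prod)
  then have "coeff (bethe_poly n k y) 0 = coeff (bethe_poly n k y * root_poly n y) 0"
    by (simp add: coeff_mult_0)
  also have "\<dots> = 1" using n by (simp add: bethe_poly_mult)
  finally show ?thesis .
qed

text \<open>The coefficient of t^r in \<open>sum_moves_root_poly\<close>, after cancelling the
  nonzero polynomial \<open>root_poly n y\<close>.\<close>

lemma alt_det_eigen: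
  assumes m: "m \<in> weights n k"
  shows "(\<Sum>\<epsilon> | \<epsilon> \<in> moves n m \<and> (\<Sum>i<n. \<epsilon> i) = r. alt_det n y (heights n (hop n m \<epsilon>))) =
    coeff (bethe_poly n k y) r * alt_det n y (heights n m)"
proof -
  have y1: "(\<Prod>j<n. y j) = 1" using y by (simp add: bethe_roots_def)
  have "root_poly n y * (\<Sum>\<epsilon>\<in>moves n m. Polynomial.monom (alt_det n y (\<lambda>i. heights n m i + \<epsilon> i)) (\<Sum>i<n. \<epsilon> i))
    = root_poly n y * Polynomial.smult (alt_det n y (heights n m)) (bethe_poly n k y)"
    using y by (subst sum_moves_root_poly[OF n m]) (auto simp: bethe_roots_def bethe_poly_mult[symmetric] mult.commute)
  then have "(\<Sum>\<epsilon>\<in>moves n m. Polynomial.monom (alt_det n y (\<lambda>i. heights n m i + \<epsilon> i)) (\<Sum>i<n. \<epsilon> i)) =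
    Polynomial.smult (alt_det n y (heights n m)) (bethe_poly n k y)"
    using root_poly_nonzero by (simp only: mult_cancel_left) simp
  then have "(\<Sum>\<epsilon>\<in>moves n m. Polynomial.monom (alt_det n y (heights n (hop n m \<epsilon>))) (\<Sum>i<n. \<epsilon> i)) =
    Polynomial.smult (alt_det n y (heights n m)) (bethe_poly n k y)"
    using n y1 by (simp add: alt_det_hop)
  from arg_cong[OF this, of "\<lambda>p. coeff p r"]
  have "(\<Sum>\<epsilon>\<in>moves n m. if (\<Sum>i<n. \<epsilon> i) = r then alt_det n y (heights n (hop n m \<epsilon>)) else 0) =
     coeff (bethe_poly n k y) r * alt_det n y (heights n m)"
    by (simp add: coeff_sum mult.commute)
  then show ?thesis by (simp add: sum.inter_filter finite_moves)
qed

text \<open>The bound on \<open>a\<close> keeps the exponent within the polynomial (1 - \<zeta> t^N)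
  / (1 - y_j t), whose coefficients are the powers of \<open>y j\<close> below
  \<open>n + k\<close>.\<close>

lemma power_root_expansion:
  assumes "a < n + k" "j < n"
  shows "y j ^ a = (\<Sum>c<n. icoeff (bethe_poly n k y) (int a - int c) * coeff (\<Prod>l\<in>{..<n} - {j}. [:1, - y l:]) c)"
proof -
  let ?M = "\<Prod>l\<in>{..<n} - {j}. [:1, - y l:]" and ?E = "bethe_poly n k y"
  let ?S = "\<Sum>e\<le>n + k - 1. Polynomial.monom (y j ^ (0 + e)) e"
  have "[:1, - y j:] * ?S = [:y j ^ 0:] - Polynomial.monom (y j ^ (0 + Suc (n + k - 1))) (Suc (n + k - 1))"
    by (rule geometric_monom)
  also have "Suc (n + k - 1) = n + k" using n by simp
  also have "[:y j ^ 0:] - Polynomial.monom (y j ^ (0 + (n + k))) (n + k) = ?E * root_poly n y"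
    using y assms by (simp add: bethe_poly_mult bethe_roots_def one_pCons)
  also have "root_poly n y = [:1, - y j:] * ?M"
    unfolding root_poly_def by (rule prod.remove) (use assms in auto)
  finally have "[:1, - y j:] * ?S = [:1, - y j:] * (?E * ?M)" by (simp only: mult_ac)
  then have S: "?S = ?M * ?E" by (simp only: mult_cancel_left) (simp add: mult.commute)
  have deg: "degree ?M \<le> n - 1"
  proof -
    have "degree ?M = (\<Sum>l\<in>{..<n} - {j}. degree [:1, - y l:])"
      by (rule degree_prod_eq_sum_degree) auto
    also have "\<dots> \<le> (\<Sum>l\<in>{..<n} - {j}. 1)" by (rule sum_mono) simp
    finally show ?thesis using assms by simp
  qed
  have "y j ^ a = coeff ?S a" using assms by (simp add: coeff_sum)
  also have "\<dots> = (\<Sum>c\<le>a. coeff ?M c * coeff ?E (a - c))" unfolding S coeff_mult ..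
  also have "\<dots> = (\<Sum>c\<in>{..a} \<inter> {..<n}. coeff ?M c * coeff ?E (a - c))"
    by (rule sum.mono_neutral_right) (use deg assms(2) le_degree[of ?M] in \<open>fastforce+\<close>)
  \<comment> \<open>The added indices \<open>c > a\<close> contribute 0, since \<open>icoeff\<close>
    vanishes at negative arguments.\<close>
  also have "\<dots> = (\<Sum>c\<in>{..<n}. icoeff ?E (int a - int c) * coeff ?M c)"
    by (rule sum.mono_neutral_cong_left) (auto simp: icoeff_def nat_diff_distrib)
  finally show ?thesis .
qed

text \<open>
  The power \<open>y\<^sub>j\<^sup>a\<close> is a coefficient of \<open>(1 - \<zeta> t\<^sup>N) / (1 - y\<^sub>j t) = E(t) (\<Prod>l\<noteq>j. 1 - y\<^sub>l t)\<close>, so the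
  alternant factors through the matrix of coefficients of \<open>E\<close>.
\<close>

lemma jacobi_trudi:
  assumes lam: "\<And>i. lam i \<le> k" "lam n = 0"
  shows "alt_det n y (\<lambda>i. lam (i + 1) + (n - Suc i)) =
    det (mat (n - 1) (n - 1) (\<lambda>(i, j). icoeff (bethe_poly n k y) (int (lam (i + 1)) - int i + int j))) *
    alt_det n y (\<lambda>i. n - Suc i)"
proof -
  let ?E = "bethe_poly n k y"
  let ?H = "\<lambda>mu. mat n n (\<lambda>(i, j). icoeff ?E (int (mu (i + 1)) - int i + int j))"
  let ?M = "mat n n (\<lambda>(c, j). coeff (\<Prod>l\<in>{..<n} - {j}. [:1, - y l:]) (n - Suc c))"
  have fac: "alt_det n y (\<lambda>i. mu (i + 1) + (n - Suc i)) = det (?H mu) * det ?M"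
    if mu: "\<And>i. mu i \<le> k" for mu :: "nat \<Rightarrow> nat"
  proof -
    have "mat n n (\<lambda>(i, j). y j ^ (mu (i + 1) + (n - Suc i))) = ?H mu * ?M"
    proof (rule eq_matI)
      fix i j assume "i < dim_row (?H mu * ?M)" "j < dim_col (?H mu * ?M)"
      then have ij: "i < n" "j < n" by auto
      let ?a = "mu (i + 1) + (n - Suc i)"
      have "?a < n + k" using ij mu[of "i + 1"] by simp
      then have "y j ^ ?a = (\<Sum>c<n. icoeff ?E (int ?a - int c) * coeff (\<Prod>l\<in>{..<n} - {j}. [:1, - y l:]) c)"
        by (rule power_root_expansion) (rule ij)
      also have "\<dots> = (\<Sum>c<n. icoeff ?E (int (mu (i + 1)) - int i + int c) * coeff (\<Prod>l\<in>{..<n} - {j}. [:1, - y l:]) (n - Suc c))"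
        by (rule sum.reindex_bij_witness[of _ "\<lambda>c. n - Suc c" "\<lambda>c. n - Suc c"])
          (use ij in \<open>auto simp: of_nat_diff algebra_simps\<close>)
      also have "\<dots> = (?H mu * ?M) $$ (i, j)"
        using ij by (simp add: scalar_prod_def lessThan_atLeast0)
      finally show "mat n n (\<lambda>(i, j). y j ^ (mu (i + 1) + (n - Suc i))) $$ (i, j) = (?H mu * ?M) $$ (i, j)"
        using ij by simp
    qed auto
    then show ?thesis unfolding alt_det_def by (subst det_mult[of _ n, symmetric]) auto
  qed
  \<comment> \<open>For the empty partition the coefficient matrix is unitriangular, which
    identifies \<open>det ?M\<close> with the Vandermonde alternant.\<close>
  have "det (?H (\<lambda>_. 0)) = (\<Prod>i<n. icoeff ?E (int 0 - int i + int i))"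
    by (rule det_upper_triangular_mat) (auto simp: icoeff_def)
  then have "det (?H (\<lambda>_. 0)) = 1" by (simp add: icoeff_def coeff_bethe_poly_0)
  then have M: "alt_det n y (\<lambda>i. n - Suc i) = det ?M" using fac[of "\<lambda>_. 0"] by simp
  \<comment> \<open>As \<open>lam n = 0\<close>, the last row is the last unit vector; this reduces
    the size from \<open>n\<close> to \<open>n - 1\<close>.\<close>
  have "det (?H lam) = (\<Sum>j<n. ?H lam $$ (n - 1, j) * cofactor (?H lam) (n - 1) j)"
    using n by (intro laplace_expansion_row[of _ n]) auto
  also have "\<dots> = (\<Sum>j\<in>{n - 1}. ?H lam $$ (n - 1, j) * cofactor (?H lam) (n - 1) j)"
    using n by (intro sum.mono_neutral_right) (auto simp: icoeff_def lam of_nat_diff)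
  also have "\<dots> = cofactor (?H lam) (n - 1) (n - 1)"
    using n by (simp add: lam icoeff_def coeff_bethe_poly_0)
  also have "\<dots> = det (mat_delete (?H lam) (n - 1) (n - 1))"
    by (simp add: cofactor_def mult_2[symmetric])
  also have "mat_delete (?H lam) (n - 1) (n - 1) =
    mat (n - 1) (n - 1) (\<lambda>(i, j). icoeff ?E (int (lam (i + 1)) - int i + int j))"
    by (rule eq_matI) (auto simp: mat_delete_def)
  finally have "det (?H lam) =
    det (mat (n - 1) (n - 1) (\<lambda>(i, j). icoeff ?E (int (lam (i + 1)) - int i + int j)))" .
  then show ?thesis using fac[of lam, OF lam(1)] M by simp
qed

end

text \<open>A kernel vector of the transposed matrix would be a nonzero polynomial of degree below
  \<open>n\<close> with \<open>n\<close> distinct roots.\<close>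

lemma vandermonde_nonzero:
  assumes "inj_on y {..<n}"
  shows "alt_det n y (\<lambda>i. n - Suc i) \<noteq> 0"
proof
  assume z: "alt_det n y (\<lambda>i. n - Suc i) = 0"
  let ?A = "mat n n (\<lambda>(j, i). y j ^ (n - Suc i))"
  have "det ?A = det (?A\<^sup>T)" by (rule det_transpose[of _ n, symmetric]) simp
  also have "?A\<^sup>T = mat n n (\<lambda>(i, j). y j ^ (n - Suc i))" by (rule eq_matI) auto
  finally have "det ?A = 0" using z by (simp add: alt_det_def)
  then obtain v where v: "v \<in> carrier_vec n" "v \<noteq> 0\<^sub>v n" "?A *\<^sub>v v = 0\<^sub>v n"
    using det_0_iff_vec_prod_zero[of ?A n] by auto
  let ?p = "\<Sum>i<n. Polynomial.monom (v $ i) (n - Suc i)"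
  have c: "coeff ?p (n - Suc i) = v $ i" if "i < n" for i
  proof -
    have "coeff ?p (n - Suc i) = (\<Sum>i'<n. if i' = i then v $ i' else 0)"
      unfolding coeff_sum using that by (intro sum.cong) auto
    then show ?thesis using that by simp
  qed
  obtain i where "i < n" "v $ i \<noteq> 0" using v(1,2) by (metis carrier_vecD eq_vecI index_zero_vec(1) index_zero_vec(2))
  then have p0: "?p \<noteq> 0" using c by (metis coeff_0)
  have root: "poly ?p (y j) = 0" if "j < n" for j
  proof -
    have "poly ?p (y j) = (\<Sum>i<n. y j ^ (n - Suc i) * v $ i)"
      by (simp add: poly_sum poly_monom mult.commute)
    also have "\<dots> = (?A *\<^sub>v v) $ j" using that v(1) by (simp add: scalar_prod_def lessThan_atLeast0)
    finally show ?thesis using v(3) that by simp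
  qed
  have "n = card (y ` {..<n})" using assms by (simp add: card_image)
  also have "\<dots> \<le> card {x. poly ?p x = 0}"
    using root poly_roots_finite[OF p0] by (intro card_mono) auto
  also have "\<dots> \<le> degree ?p" by (rule card_poly_roots_bound[OF p0])
  also have "degree ?p \<le> n - 1"
    by (rule degree_sum_le) (auto intro: order_trans[OF degree_monom_le])
  finally show False using \<open>i < n\<close> by simp
qed

section \<open>The dual Jacobi--Trudi formula\<close>

text \<open>Over any commutative ring, so that it serves both for the variables \<open>Var\<close>
  and for complex numbers.\<close>

definition esym :: "nat \<Rightarrow> (nat \<Rightarrow> 'a :: comm_ring_1) \<Rightarrow> nat \<Rightarrow> 'a" where
  "esym k x r = (\<Sum>S | S \<subseteq> {1..k} \<and> card S = r. \<Prod>i\<in>S. x i)"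

definition iesym :: "nat \<Rightarrow> (nat \<Rightarrow> 'a :: comm_ring_1) \<Rightarrow> int \<Rightarrow> 'a" where
  "iesym k x r = (if r < 0 then 0 else esym k x (nat r))"

lemma esym_eq_0:
  assumes "r > k"
  shows "esym k x r = 0"
proof -
  have "card S \<le> k" if "S \<subseteq> {1..k}" for S using card_mono[OF _ that] by simp
  then have "{S. S \<subseteq> {1..k} \<and> card S = r} = {}" using assms leD by blast
  then show ?thesis unfolding esym_def by (simp only: sum.empty)
qed

lemma esym_0: "esym k x 0 = 1"
proof -
  have "{S. S \<subseteq> {1..k} \<and> card S = 0} = {{}}" by (auto simp: card_eq_0_iff dest: finite_subset)
  then show ?thesis unfolding esym_def by (simp only: sum.insert) simp
qed

lemma coeff_prod_add:
  assumes "finite A"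
  shows "coeff (\<Prod>i\<in>A. Polynomial.monom (a i) 1 + [:b i:]) r =
    (\<Sum>S | S \<subseteq> A \<and> card S = r. (\<Prod>i\<in>S. a i) * (\<Prod>i\<in>A - S. b i :: 'a :: comm_ring_1))"
proof -
  have "(\<Prod>i\<in>A. Polynomial.monom (a i) 1 + [:b i:]) =
     (\<Sum>S\<in>Pow A. (\<Prod>i\<in>S. Polynomial.monom (a i) 1) * (\<Prod>i\<in>A - S. [:b i:]))"
    by (rule prod_add) (rule assms)
  also have "\<dots> = (\<Sum>S\<in>Pow A. Polynomial.monom ((\<Prod>i\<in>S. a i) * (\<Prod>i\<in>A - S. b i)) (card S))"
  proof (rule sum.cong[OF refl])
    fix S
    have m: "(\<Prod>i\<in>S. Polynomial.monom (a i) 1) = Polynomial.monom (\<Prod>i\<in>S. a i) (card S)"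
      by (induction S rule: infinite_finite_induct) (auto simp: mult_monom)
    have c: "(\<Prod>i\<in>T. [:b i:]) = [:\<Prod>i\<in>T. b i:]" for T
      by (induction T rule: infinite_finite_induct) (auto simp: one_pCons)
    show "(\<Prod>i\<in>S. Polynomial.monom (a i) 1) * (\<Prod>i\<in>A - S. [:b i:]) =
      Polynomial.monom ((\<Prod>i\<in>S. a i) * (\<Prod>i\<in>A - S. b i)) (card S)"
      unfolding m c by (simp add: smult_monom mult.commute)
  qed
  finally have "coeff (\<Prod>i\<in>A. Polynomial.monom (a i) 1 + [:b i:]) r =
     (\<Sum>S\<in>Pow A. if card S = r then (\<Prod>i\<in>S. a i) * (\<Prod>i\<in>A - S. b i) else 0)"
    by (simp add: coeff_sum)
  also have "\<dots> = (\<Sum>S | S \<subseteq> A \<and> card S = r. (\<Prod>i\<in>S. a i) * (\<Prod>i\<in>A - S. b i))"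
    using assms by (subst sum.inter_filter[symmetric]) auto
  finally show ?thesis .
qed

lemma coeff_prod_one_plus: "coeff (\<Prod>i=1..k. [:1, x i:]) r = esym k x r"
proof -
  have "[:1, x i:] = Polynomial.monom (x i) 1 + [:1:]" for i by (simp add: monom_altdef)
  then show ?thesis by (simp only: coeff_prod_add finite_atLeastAtMost esym_def) simp
qed

lemma coeff_prod_monic:
  "coeff (\<Prod>i=1..k. [:- x i, 1:]) c = (if c \<le> k then (-1) ^ (k - c) * esym k x (k - c) else 0)"
proof -
  have "[:- x i, 1:] = Polynomial.monom 1 1 + [:- x i:]" for i by (simp add: monom_altdef)
  then have "coeff (\<Prod>i=1..k. [:- x i, 1:]) c = (\<Sum>S | S \<subseteq> {1..k} \<and> card S = c. \<Prod>i\<in>{1..k} - S. - x i)"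
    by (simp only: coeff_prod_add finite_atLeastAtMost) simp
  also have "\<dots> = (\<Sum>S | S \<subseteq> {1..k} \<and> card S = c. (-1) ^ (k - c) * (\<Prod>i\<in>{1..k} - S. x i))"
  proof (rule sum.cong[OF refl])
    fix S assume S: "S \<in> {S. S \<subseteq> {1..k} \<and> card S = c}"
    have "(\<Prod>i\<in>{1..k} - S. - x i) = (\<Prod>i\<in>{1..k} - S. - 1 * x i)" by simp
    also have "\<dots> = (-1) ^ card ({1..k} - S) * (\<Prod>i\<in>{1..k} - S. x i)" by (subst prod.distrib) simp
    also have "card ({1..k} - S) = k - c" using S by (subst card_Diff_subset) (auto intro: finite_subset)
    finally show "(\<Prod>i\<in>{1..k} - S. - x i) = (-1) ^ (k - c) * (\<Prod>i\<in>{1..k} - S. x i)" .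
  qed
  also have "\<dots> = (-1) ^ (k - c) * (\<Sum>S | S \<subseteq> {1..k} \<and> card S = c. \<Prod>i\<in>{1..k} - S. x i)"
    by (simp add: sum_distrib_left)
  also have "(\<Sum>S | S \<subseteq> {1..k} \<and> card S = c. \<Prod>i\<in>{1..k} - S. x i) = (if c \<le> k then esym k x (k - c) else 0)"
  proof (cases "c \<le> k")
    case True
    have card: "card ({1..k} - S) = k - card S" if "S \<subseteq> {1..k}" for S
      using that by (subst card_Diff_subset) (auto intro: finite_subset)
    have "(\<Sum>S | S \<subseteq> {1..k} \<and> card S = c. \<Prod>i\<in>{1..k} - S. x i) = esym k x (k - c)"
      unfolding esym_def
      by (rule sum.reindex_bij_witness[of _ "\<lambda>S. {1..k} - S" "\<lambda>S. {1..k} - S"])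
        (use True in \<open>auto simp: card[unfolded One_nat_def] double_diff simp del: atLeastAtMost_iff\<close>)
    then show ?thesis using True by simp
  next
    case False
    have "card S \<le> k" if "S \<subseteq> {1..k}" for S using card_mono[OF _ that] by simp
    then have "{S. S \<subseteq> {1..k} \<and> card S = c} = {}" using False by blast
    then show ?thesis using False by (simp only: sum.empty if_False)
  qed
  finally show ?thesis by simp
qed

text \<open>The removed box lies in row \<open>i\<close> and column \<open>lam i\<close>. Since all
  rows below are empty, it is the bottom box of its column, and only this column changes, from
  length \<open>i\<close> to \<open>i - 1\<close>.\<close>

lemma transpose_part_last_box:
  assumes dec: "\<And>i j. 1 \<le> i \<Longrightarrow> i \<le> j \<Longrightarrow> lam j \<le> lam i"
    and i: "1 \<le> i" "lam i > 0" "\<And>j. j > i \<Longrightarrow> lam j = 0"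
  shows "transpose_part lam (lam i) = i"
    and "transpose_part (lam(i := lam i - 1)) j = (if j = lam i then i - 1 else transpose_part lam j)"
proof -
  have "{l. 1 \<le> l \<and> lam i \<le> lam l} = {1..i}"
  proof (intro equalityI subsetI)
    fix l assume l: "l \<in> {l. 1 \<le> l \<and> lam i \<le> lam l}"
    then have "\<not> l > i" using i(2) i(3)[of l] by auto
    then show "l \<in> {1..i}" using l by auto
  next
    fix l assume "l \<in> {1..i}"
    then show "l \<in> {l. 1 \<le> l \<and> lam i \<le> lam l}" using dec[of l i] by auto
  qed
  then show "transpose_part lam (lam i) = i" using i by (simp add: transpose_part_def)
  show "transpose_part (lam(i := lam i - 1)) j = (if j = lam i then i - 1 else transpose_part lam j)"
  proof (cases "j = lam i")
    case True
    have "{l. 1 \<le> l \<and> lam i \<le> (lam(i := lam i - 1)) l} = {1..i - 1}"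
    proof (intro equalityI subsetI)
      fix l assume l: "l \<in> {l. 1 \<le> l \<and> lam i \<le> (lam(i := lam i - 1)) l}"
      then have "l \<noteq> i" using i by auto
      moreover have "\<not> l > i" using l i(2) i(3)[of l] by auto
      ultimately show "l \<in> {1..i - 1}" using l by auto
    next
      fix l assume "l \<in> {1..i - 1}"
      then show "l \<in> {l. 1 \<le> l \<and> lam i \<le> (lam(i := lam i - 1)) l}" using dec[of l i] i by auto
    qed
    then show ?thesis using True i by (simp add: transpose_part_def)
  next
    case False
    then have "{l. 1 \<le> l \<and> j \<le> (lam(i := lam i - 1)) l} = {l. 1 \<le> l \<and> j \<le> lam l}" by auto
    then show ?thesis using False by (simp only: transpose_part_def if_False)
  qed
qed

text \<open>
  The exponents \<open>\<lambda>\<^sup>t\<^sub>j + k - j\<close> occupy the first \<open>k\<close> places and the complementary exponents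
  \<open>k - 1 + i - \<lambda>\<^sub>i\<close> the last \<open>m\<close>; adding a box to the partition exchanges two adjacent exponents.
\<close>

definition frobenius_perm :: "nat \<Rightarrow> nat \<Rightarrow> (nat \<Rightarrow> nat) \<Rightarrow> nat \<Rightarrow> nat" where
  "frobenius_perm k m lam c =
     (if c < k then transpose_part lam (c + 1) + (k - Suc c)
      else if c < k + m then c - lam (c - k + 1) else c)"

text \<open>Induction on the number of boxes, removing the last box of the lowest nonempty row. The
  sign is determined relative to the empty partition only; the remaining constant is absorbed by a
  determinant in the dual formula.\<close>

lemma frobenius_perm_permutes_sign:
  assumes "\<And>i j. 1 \<le> i \<Longrightarrow> i \<le> j \<Longrightarrow> lam j \<le> lam i" "\<And>i. lam i \<le> k" "\<And>i. i > m \<Longrightarrow> lam i = 0"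
  shows "frobenius_perm k m lam permutes {0..<k + m} \<and>
    sign (frobenius_perm k m lam) = (-1) ^ (\<Sum>i=1..m. lam i) * sign (frobenius_perm k m (\<lambda>_. 0))"
  using assms
proof (induction "\<Sum>i=1..m. lam i" arbitrary: lam)
  case 0
  have "frobenius_perm k m lam c = frobenius_perm k m (\<lambda>_. 0) c" for c
  proof -
    have "lam i = 0" if "1 \<le> i" for i
      using 0(1) 0(4)[of i] that by (cases "i \<le> m") auto
    then have "transpose_part lam (Suc j) = transpose_part (\<lambda>_. 0) (Suc j)" and "lam (Suc j) = 0" for j
    proof -
      have "{i. 1 \<le> i \<and> Suc j \<le> lam i} = {}" using \<open>\<And>i. 1 \<le> i \<Longrightarrow> lam i = 0\<close> by auto
      then show "transpose_part lam (Suc j) = transpose_part (\<lambda>_. 0) (Suc j)"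
        by (simp only: transpose_part_def) simp
    qed (use \<open>\<And>i. 1 \<le> i \<Longrightarrow> lam i = 0\<close> in simp)
    then show ?thesis by (simp add: frobenius_perm_def)
  qed
  then have eq: "frobenius_perm k m lam = frobenius_perm k m (\<lambda>_. 0)" by auto
  have zero: "frobenius_perm k m (\<lambda>_. 0) c = (if c < k then k - Suc c else c)" for c
    by (simp add: frobenius_perm_def transpose_part_def)
  \<comment> \<open>The empty partition reverses the first \<open>k\<close> places and fixes the
    rest, an involution.\<close>
  have "frobenius_perm k m (\<lambda>_. 0) (frobenius_perm k m (\<lambda>_. 0) c) = c" for c
    by (simp add: zero)
  then have "bij (frobenius_perm k m (\<lambda>_. 0))" by (metis involuntory_imp_bij)
  then have "frobenius_perm k m (\<lambda>_. 0) permutes {0..<k + m}"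
    unfolding permutes_def bij_iff by (simp add: zero)
  then show ?case using 0(1) eq by simp
next
  case (Suc s)
  let ?P = "\<lambda>i. 1 \<le> i \<and> lam i > 0"
  have "\<exists>i. ?P i"
  proof (rule ccontr)
    assume "\<not> (\<exists>i. ?P i)"
    then have "(\<Sum>i=1..m. lam i) = 0" by (intro sum.neutral) auto
    then show False using Suc.hyps(2) by simp
  qed
  moreover have bound: "\<And>i. ?P i \<Longrightarrow> i \<le> m" using Suc.prems(3) by (metis not_le not_gr_zero)
  ultimately have "?P (GREATEST i. ?P i)" by (rule GreatestI_ex_nat[where b = m and P = ?P])
  then obtain i where i: "1 \<le> i" "lam i > 0" and gr: "i = (GREATEST i. ?P i)" by blast
  have last: "lam j = 0" if "j > i" for j
  proof (rule ccontr)
    assume "lam j \<noteq> 0"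
    then have "?P j" using that by simp
    then have "j \<le> i" unfolding gr using bound by (rule Greatest_le_nat)
    then show False using that by simp
  qed
  have im: "i \<le> m" using bound i by simp
  let ?a = "lam i" and ?lam = "lam(i := lam i - 1)"
  have ak: "?a \<le> k" using Suc.prems(2) .
  have dec: "?lam l \<le> ?lam j" if "1 \<le> j" "j \<le> l" for j l
    using Suc.prems(1)[OF that] last[of l] that by (cases "l = i"; cases "j = i"; force)
  have sum: "(\<Sum>j=1..m. lam j) = Suc (\<Sum>j=1..m. ?lam j)"
  proof -
    have "(\<Sum>j=1..m. lam j) = lam i + (\<Sum>j\<in>{1..m} - {i}. lam j)" using i im by (intro sum.remove) auto
    moreover have "(\<Sum>j=1..m. ?lam j) = ?lam i + (\<Sum>j\<in>{1..m} - {i}. ?lam j)"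
      using i im by (intro sum.remove) auto
    ultimately show ?thesis using i by simp
  qed
  have IH: "frobenius_perm k m ?lam permutes {0..<k + m}"
    "sign (frobenius_perm k m ?lam) = (-1) ^ (\<Sum>i=1..m. ?lam i) * sign (frobenius_perm k m (\<lambda>_. 0))"
    using Suc.hyps(1)[of ?lam] Suc.hyps(2) sum dec Suc.prems(2,3)
    by (auto simp: le_diff_conv le_SucI simp del: fun_upd_apply simp: fun_upd_apply[of lam])
  \<comment> \<open>Column \<open>?a\<close> of the diagram sits at place \<open>?a - 1\<close> and
    row \<open>i\<close> at place \<open>k + i - 1\<close>. Adding the box raises the exponent of
    the column and lowers that of the row by one, so the two places swap the values
    \<open>?u\<close> and \<open>?v\<close>.\<close>
  let ?u = "k + i - ?a - 1" and ?v = "k + i - ?a"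
  have tr: "transpose_part lam ?a = i"
    "transpose_part ?lam j = (if j = ?a then i - 1 else transpose_part lam j)" for j
    using transpose_part_last_box[of lam i, OF Suc.prems(1) i last] by blast+
  have c1: "frobenius_perm k m ?lam (?a - 1) = ?u" "frobenius_perm k m lam (?a - 1) = ?v"
    using i ak by (auto simp: frobenius_perm_def tr[unfolded One_nat_def])
  have c2: "frobenius_perm k m ?lam (k + i - 1) = ?v" "frobenius_perm k m lam (k + i - 1) = ?u"
  proof -
    have h: "k + i - 1 < k + m" "\<not> k + i - 1 < k" "k + i - 1 - k + 1 = i" using i im by auto
    show "frobenius_perm k m ?lam (k + i - 1) = ?v" "frobenius_perm k m lam (k + i - 1) = ?u"
      unfolding frobenius_perm_def using i ak by (simp_all only: h if_True if_False) auto
  qed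
  have other: "frobenius_perm k m lam c = frobenius_perm k m ?lam c" if "c \<noteq> ?a - 1" "c \<noteq> k + i - 1" for c
    using that i by (auto simp: frobenius_perm_def tr[unfolded One_nat_def])
  have comp: "frobenius_perm k m lam = Transposition.transpose ?u ?v \<circ> frobenius_perm k m ?lam"
  proof
    fix c
    have inj: "inj (frobenius_perm k m ?lam)" using IH(1) by (rule permutes_inj)
    consider "c = ?a - 1" | "c = k + i - 1" | "c \<noteq> ?a - 1" "c \<noteq> k + i - 1" by blast
    then show "frobenius_perm k m lam c = (Transposition.transpose ?u ?v \<circ> frobenius_perm k m ?lam) c"
    proof cases
      case 3
      have "frobenius_perm k m ?lam c \<noteq> ?u"
      proof
        assume "frobenius_perm k m ?lam c = ?u"
        then have "frobenius_perm k m ?lam c = frobenius_perm k m ?lam (?a - 1)" by (simp only: c1)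
        then show False using inj 3 by (simp add: inj_eq)
      qed
      moreover have "frobenius_perm k m ?lam c \<noteq> ?v"
      proof
        assume "frobenius_perm k m ?lam c = ?v"
        then have "frobenius_perm k m ?lam c = frobenius_perm k m ?lam (k + i - 1)" by (simp only: c2)
        then show False using inj 3 by (simp add: inj_eq)
      qed
      ultimately have "Transposition.transpose ?u ?v (frobenius_perm k m ?lam c) = frobenius_perm k m ?lam c"
        by (rule transpose_apply_other)
      then show ?thesis by (simp only: o_def other[OF 3])
    qed (simp_all only: c1 c2 o_def transpose_apply_first transpose_apply_second)
  qed
  have uv: "?u \<noteq> ?v" "?u < k + m" "?v < k + m" using i ak im by auto
  have tp: "Transposition.transpose ?u ?v permutes {0..<k + m}"
    using uv by (intro permutes_swap_id) auto
  have "frobenius_perm k m lam permutes {0..<k + m}"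
    unfolding comp using IH(1) tp by (rule permutes_compose)
  moreover have "sign (frobenius_perm k m lam) = - sign (frobenius_perm k m ?lam)"
  proof -
    have "permutation (Transposition.transpose ?u ?v)" "permutation (frobenius_perm k m ?lam)"
      using tp IH(1) by (auto intro: permutation_permutes[THEN iffD2] exI[of _ "{0..<k + m}"])
    then show ?thesis unfolding comp using uv(1) by (simp add: sign_compose sign_swap_id)
  qed
  ultimately show ?case using IH(2) sum by simp
qed

lemma index_mat_mult_mat:
  "i < nr \<Longrightarrow> j < nc \<Longrightarrow> (mat nr n f * mat n nc g) $$ (i, j) = (\<Sum>c<n. f (i, c) * g (c, j))"
  by (simp add: scalar_prod_def lessThan_atLeast0)

text \<open>
  The rows \<open>(x\<^sub>i\<^sup>c)\<^sub>c\<close> annihilate the coefficient vectors of \<open>t\<^sup>j (\<Prod>i. t - x\<^sub>i)\<close>. Hence the minors of the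
  former are proportional to the complementary minors of the latter, with the sign of the
  permutation above.
\<close>

lemma dual_jacobi_trudi:
  fixes x :: "nat \<Rightarrow> 'a :: idom"
  assumes lam: "\<And>i j. 1 \<le> i \<Longrightarrow> i \<le> j \<Longrightarrow> lam j \<le> lam i" "\<And>i. lam i \<le> k" "\<And>i. i > m \<Longrightarrow> lam i = 0"
  shows "det (mat k k (\<lambda>(i, j). x (i + 1) ^ (transpose_part lam (j + 1) + (k - (j + 1))))) =
    det (mat m m (\<lambda>(i, j). iesym k x (int (lam (i + 1)) - int i + int j))) *
    det (mat k k (\<lambda>(i, j). x (i + 1) ^ (k - (j + 1))))"
proof -
  let ?N = "k + m" and ?P = "\<Prod>i=1..k. [:- x i, 1:]"
  let ?p = "frobenius_perm k m lam" and ?pe = "frobenius_perm k m (\<lambda>_. 0)"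
  \<comment> \<open>The coefficient vectors of t^j P, at the columns from \<open>k\<close> on, are
    completed to a square matrix by unit vectors in reversed order, on which the powers of
    \<open>x\<close> give the Vandermonde matrix.\<close>
  let ?B = "\<lambda>r j. if j < k then (if r = k - Suc j then 1 else 0) else coeff (Polynomial.monom 1 (j - k) * ?P) r"
  let ?X = "\<lambda>p. mat k k (\<lambda>(r, c). x (r + 1) ^ p c)"
  let ?V = "mat k k (\<lambda>(r, j). x (r + 1) ^ (k - (j + 1)))"
  let ?F = "\<lambda>p. mat m m (\<lambda>(i, j). ?B (p (k + i)) (k + j))"
  let ?B1 = "mat ?N ?N (\<lambda>(r, j). ?B r j)"
  have p: "?p permutes {0..<?N}" "sign ?p = (-1) ^ (\<Sum>i=1..m. lam i) * sign ?pe"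
    using frobenius_perm_permutes_sign[of lam k m] lam by blast+
  have p0: "?pe permutes {0..<?N}" using frobenius_perm_permutes_sign[of "\<lambda>_. 0" k m] by simp
  have degP: "degree ?P \<le> k"
  proof -
    have "degree ?P \<le> sum (degree \<circ> (\<lambda>i. [:- x i, 1:])) {1..k}" by (rule degree_prod_sum_le) simp
    then show ?thesis by simp
  qed
  have poly_sum: "(\<Sum>c<?N. x (r + 1) ^ c * ?B c j) = (if j < k then x (r + 1) ^ (k - Suc j) else 0)"
    if "r < k" "j < ?N" for r j
  proof (cases "j < k")
    case True
    then have "(\<Sum>c<?N. x (r + 1) ^ c * ?B c j) = (\<Sum>c<?N. if c = k - Suc j then x (r + 1) ^ c else 0)"
      by (intro sum.cong) auto
    then show ?thesis using True by simp
  next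
    case False
    let ?q = "Polynomial.monom 1 (j - k) * ?P"
    have "degree ?q \<le> (j - k) + k"
      by (rule order_trans[OF degree_mult_le]) (intro add_mono degree_monom_le degP)
    then have deg: "degree ?q < ?N" using False that by simp
    have "(\<Sum>c<?N. x (r + 1) ^ c * ?B c j) = (\<Sum>c<?N. coeff ?q c * x (r + 1) ^ c)"
      using False by (intro sum.cong) (auto simp: mult.commute)
    also have "\<dots> = (\<Sum>c\<le>degree ?q. coeff ?q c * x (r + 1) ^ c)"
      by (rule sum.mono_neutral_right) (use deg in \<open>auto simp: coeff_eq_0\<close>)
    also have "\<dots> = poly ?q (x (r + 1))" by (simp only: poly_altdef)
    also have "\<dots> = 0"
    proof -
      have "r + 1 \<in> {1..k}" using that by simp
      then have "poly ?P (x (r + 1)) = 0" by (force simp: poly_prod intro: prod_zero)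
      then show ?thesis by simp
    qed
    finally show ?thesis using False by simp
  qed
  have main: "det (?X p) * (of_int (sign p) * det ?B1) = det ?V * det (?F p)"
    if p: "p permutes {0..<?N}" for p
  proof -
    \<comment> \<open>The first \<open>k\<close> rows carry the wanted powers, the others are unit
      rows. Multiplication by the permuted \<open>?B\<close> gives a block lower triangular matrix
      with diagonal blocks \<open>?V\<close> and \<open>?F p\<close>, because the powers of
      \<open>x\<close> annihilate the multiples of P.\<close>
    let ?A = "mat ?N ?N (\<lambda>(r, c). if r < k then x (r + 1) ^ p c else if r = c then 1 else 0)"
    let ?Bp = "mat ?N ?N (\<lambda>(c, j). ?B (p c) j)"
    have "?A * ?Bp = four_block_mat ?V (0\<^sub>m k m) (mat m k (\<lambda>(i, j). ?B (p (k + i)) j)) (?F p)"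
      (is "_ = ?R")
    proof (rule eq_matI)
      fix r j assume "r < dim_row ?R" "j < dim_col ?R"
      then have rj: "r < ?N" "j < ?N" by auto
      then have "(?A * ?Bp) $$ (r, j) =
        (\<Sum>c<?N. (if r < k then x (r + 1) ^ p c else if r = c then 1 else 0) * ?B (p c) j)"
        by (simp only: index_mat_mult_mat split)
      also have "\<dots> = (if r < k then (if j < k then x (r + 1) ^ (k - Suc j) else 0) else ?B (p r) j)"
      proof (cases "r < k")
        case True
        have "(\<Sum>c<?N. x (r + 1) ^ p c * ?B (p c) j) = (\<Sum>c<?N. x (r + 1) ^ c * ?B c j)"
          using sum.permute[OF p, of "\<lambda>c. x (r + 1) ^ c * ?B c j"] by (simp only: lessThan_atLeast0 o_def)
        then show ?thesis using True poly_sum[OF True rj(2)] by (simp only: if_True)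
      next
        case False
        have "(\<Sum>c<?N. (if r = c then 1 else 0) * ?B (p c) j) = (\<Sum>c<?N. if r = c then ?B (p c) j else 0)"
          by (intro sum.cong) auto
        also have "\<dots> = ?B (p r) j" using rj by (subst sum.delta') simp_all
        finally show ?thesis using False by (simp only: if_False)
      qed
      also have "\<dots> = ?R $$ (r, j)" using rj by (subst index_mat_four_block) auto
      finally show "(?A * ?Bp) $$ (r, j) = ?R $$ (r, j)" .
    qed auto
    then have "det (?A * ?Bp) = det ?V * det (?F p)"
      by (simp only:) (rule det_four_block_mat_upper_right_zero[of _ k _ m], auto)
    moreover have "det (?A * ?Bp) = det ?A * det ?Bp" by (rule det_mult[of _ ?N]) auto
    moreover have "det ?Bp = of_int (sign p) * det ?B1"
    proof -
      have "?Bp = mat ?N ?N (\<lambda>(c, j). ?B1 $$ (p c, j))"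
        using permutes_in_image[OF p] by (intro eq_matI) auto
      then show ?thesis using det_permute_rows[of ?B1 ?N p] p by simp
    qed
    moreover have "det ?A = det (?X p)"
    proof -
      have "?A = four_block_mat (?X p) (mat k m (\<lambda>(r, c). x (r + 1) ^ p (k + c))) (0\<^sub>m m k) (1\<^sub>m m)"
        by (rule eq_matI) (auto simp: index_mat_four_block)
      then have "det ?A = det (?X p) * det (1\<^sub>m m :: 'a mat)"
        by (simp only:) (rule det_four_block_mat_lower_left_zero[of _ k _ m], auto)
      then show ?thesis by simp
    qed
    ultimately show ?thesis by simp
  qed
  \<comment> \<open>Ordering the rows by the permutation of the empty partition makes
    \<open>?B\<close> upper unitriangular; this fixes the constant in \<open>main\<close>.\<close>
  have B1: "of_int (sign ?pe) * det ?B1 = 1"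
  proof -
    have "of_int (sign ?pe) * det ?B1 = det (mat ?N ?N (\<lambda>(c, j). ?B1 $$ (?pe c, j)))"
      using det_permute_rows[of ?B1 ?N ?pe] p0 by simp
    also have "mat ?N ?N (\<lambda>(c, j). ?B1 $$ (?pe c, j)) = mat ?N ?N (\<lambda>(c, j). ?B (if c < k then k - Suc c else c) j)"
      by (rule eq_matI) (auto simp: frobenius_perm_def transpose_part_def)
    also have "det \<dots> = (\<Prod>c<?N. ?B (if c < k then k - Suc c else c) c)"
    proof (subst det_upper_triangular_mat)
      fix i j assume ij: "j < i" "i < ?N"
      show "?B (if i < k then k - Suc i else i) j = 0"
      proof (cases "j < k")
        case False
        have "degree (Polynomial.monom 1 (j - k) * ?P) \<le> (j - k) + k"
          by (rule order_trans[OF degree_mult_le]) (intro add_mono degree_monom_le degP)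
        then show ?thesis using ij False by (auto intro: coeff_eq_0)
      qed (use ij in auto)
    qed simp
    also have "\<dots> = 1"
    proof (intro prod.neutral ballI)
      fix c assume "c \<in> {..<?N}"
      show "?B (if c < k then k - Suc c else c) c = 1"
        by (cases "c < k") (auto simp: coeff_monom_mult coeff_prod_monic[unfolded One_nat_def] esym_0)
    qed
    finally show ?thesis .
  qed
  let ?s = "(-1) ^ (\<Sum>i=1..m. lam i) :: 'a"
  let ?J = "mat m m (\<lambda>(i, j). iesym k x (int (lam (i + 1)) - int i + int j))"
  \<comment> \<open>The coefficient of t^(k + i - l) in t^j P is the elementary symmetric function
    of degree l - i + j with sign (-1)^(l - i + j). The sign splits into a row and a column factor,
    so the determinant acquires only \<open>?s\<close>.\<close>
  have "?F ?p = mat m m (\<lambda>(i, j). (-1) ^ (lam (i + 1) + i) * (-1) ^ j * iesym k x (int (lam (i + 1)) - int i + int j))"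
  proof (rule cong_mat)
    fix i j assume ij: "i < m" "j < m"
    let ?l = "lam (i + 1)"
    have l: "?l \<le> k" by (rule lam)
    have pi: "?p (k + i) = k + i - ?l" using ij by (simp add: frobenius_perm_def)
    have "coeff (Polynomial.monom 1 j * ?P) (k + i - ?l) =
      (-1) ^ (?l + i) * (-1) ^ j * iesym k x (int ?l - int i + int j)"
    proof (cases "j \<le> k + i - ?l \<and> k + i - ?l - j \<le> k")
      case True
      let ?e = "k - (k + i - ?l - j)"
      have e: "?e + i = ?l + j" using True l by arith
      have "int ?l - int i + int j = int ?e" using e by linarith
      then have "iesym k x (int ?l - int i + int j) = esym k x ?e"
        by (simp only: iesym_def of_nat_less_0_iff if_False nat_int)
      moreover have "(-1 :: 'a) ^ (?l + i) * (-1) ^ j = (-1) ^ ?e"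
      proof -
        have "(-1 :: 'a) ^ (?l + i) * (-1) ^ j = (-1) ^ (?e + i + i)"
          unfolding e by (simp add: power_add[symmetric] ac_simps)
        then show ?thesis by (simp add: add.assoc power_add mult_2[symmetric] power_mult)
      qed
      ultimately show ?thesis using True by (simp add: coeff_monom_mult coeff_prod_monic[unfolded One_nat_def])
    next
      case False
      then consider "j > k + i - ?l" | "j \<le> k + i - ?l" "k + i - ?l - j > k" by linarith
      then show ?thesis
      proof cases
        case 1
        then have "int ?l - int i + int j > int k" using l by linarith
        then have "nat (int ?l - int i + int j) > k" "\<not> int ?l - int i + int j < 0" by linarith+
        then have "iesym k x (int ?l - int i + int j) = 0" by (simp add: iesym_def esym_eq_0)
        then show ?thesis using 1 by (simp add: coeff_monom_mult)
      next
        case 2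
        then have "int ?l - int i + int j < 0" using l by linarith
        then have "iesym k x (int ?l - int i + int j) = 0" by (simp add: iesym_def)
        then show ?thesis using 2 by (simp add: coeff_monom_mult coeff_prod_monic[unfolded One_nat_def])
      qed
    qed
    then show "(case (i, j) of (i, j) \<Rightarrow> ?B (?p (k + i)) (k + j)) =
      (case (i, j) of (i, j) \<Rightarrow> (-1) ^ (lam (i + 1) + i) * (-1) ^ j * iesym k x (int (lam (i + 1)) - int i + int j))"
      by (simp add: pi)
  qed simp_all
  then have "det (?F ?p) = (\<Prod>i<m. (-1) ^ (lam (i + 1) + i)) * (\<Prod>j<m. (-1) ^ j) * det ?J"
    by (simp only: det_scale_rows_cols)
  also have "(\<Prod>i<m. (-1) ^ (lam (i + 1) + i)) * (\<Prod>j<m. (-1) ^ j) = ?s"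
  proof -
    have "(\<Prod>i<m. (-1 :: 'a) ^ (lam (i + 1) + i)) * (\<Prod>j<m. (-1) ^ j) = (\<Prod>i<m. (-1) ^ lam (i + 1))"
      unfolding prod.distrib[symmetric] by (intro prod.cong refl)
        (simp add: power_add mult.assoc power_mult_distrib[symmetric])
    also have "\<dots> = (-1) ^ (\<Sum>i<m. lam (i + 1))" by (simp add: power_sum)
    also have "(\<Sum>i<m. lam (i + 1)) = (\<Sum>i=1..m. lam i)"
      by (rule sum.reindex_bij_witness[of _ "\<lambda>i. i - 1" Suc]) auto
    finally show ?thesis .
  qed
  finally have F: "det (?F ?p) = ?s * det ?J" .
  have "det (?X ?p) * ?s = det (?X ?p) * (of_int (sign ?p) * det ?B1)"
    using B1 by (simp add: p(2) mult.assoc)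
  also have "\<dots> = det ?V * (?s * det ?J)" using main[OF p(1)] F by simp
  finally have "?s * det (?X ?p) = ?s * (det ?J * det ?V)" by (simp add: mult_ac)
  then have "det (?X ?p) = det ?J * det ?V" by simp
  moreover have "?X ?p = mat k k (\<lambda>(i, j). x (i + 1) ^ (transpose_part lam (j + 1) + (k - (j + 1))))"
    by (rule eq_matI) (auto simp: frobenius_perm_def)
  ultimately show ?thesis by simp
qed

section \<open>The S-matrix as an alternant\<close>

definition part_heights :: "nat \<Rightarrow> (nat \<Rightarrow> nat) \<Rightarrow> nat \<Rightarrow> nat" where
  "part_heights n lam i = lam (i + 1) + (n - Suc i)"

definition shifted_weight :: "nat \<Rightarrow> (nat \<Rightarrow> nat) \<Rightarrow> nat \<Rightarrow> real" where
  "shifted_weight n lam j = finite_weight n lam (j + 1) + rho n (j + 1)"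

text \<open>The amount by which the vector of heights is moved to reach the hyperplane of coordinate
  sum 0, where the shifted weights live.\<close>

definition weight_shift :: "nat \<Rightarrow> (nat \<Rightarrow> nat) \<Rightarrow> real" where
  "weight_shift n lam = (real n - 1) / 2 + real (\<Sum>j=1..n. lam j) / real n"

definition bethe_point :: "nat \<Rightarrow> nat \<Rightarrow> (nat \<Rightarrow> nat) \<Rightarrow> nat \<Rightarrow> complex" where
  "bethe_point n k sig j = cis (- (2 * pi / real (k + n)) * shifted_weight n sig j)"

definition S_const :: "nat \<Rightarrow> nat \<Rightarrow> complex" where
  "S_const n k = exp (\<i> * of_real (pi * real n * (real n - 1) / 4)) /
       of_real (sqrt (real n * real (k + n) ^ (n - 1)))"

lemma shifted_weight_eq:
  assumes "j < n"
  shows "shifted_weight n lam j = real (part_heights n lam j) - weight_shift n lam"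
  using assms by (simp add: shifted_weight_def part_heights_def weight_shift_def finite_weight_def rho_def
      of_nat_diff field_simps)

lemma sum_shifted_weight:
  assumes "n \<ge> 1"
  shows "(\<Sum>j<n. shifted_weight n lam j) = 0"
proof -
  have "(\<Sum>j<n. real (lam (j + 1))) = real (\<Sum>j=1..n. lam j)"
    unfolding of_nat_sum by (rule sum.reindex_bij_witness[of _ "\<lambda>j. j - 1" Suc]) auto
  moreover have "(\<Sum>j<n. rho n (j + 1)) = 0"
  proof -
    have "(\<Sum>j<p. (real n + 1) / 2 - real (j + 1)) = real p * (real n - real p) / 2" for p
      by (induction p) (simp_all add: field_simps)
    from this[of n] show ?thesis by (simp add: rho_def)
  qed
  ultimately show ?thesis
    using assms by (simp add: shifted_weight_def finite_weight_def sum.distrib sum_subtractf)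
qed

lemma cis_minus_eq_iff:
  assumes "N > 0"
  shows "cis (- (2 * pi / N) * s) = cis (- (2 * pi / N) * t) \<longleftrightarrow> (\<exists>c::int. s - t = N * of_int c)"
proof -
  have "cis (- (2 * pi / N) * s) = cis (- (2 * pi / N) * t) \<longleftrightarrow> cis (2 * pi / N * (s - t)) = 1"
  proof -
    have "cis (2 * pi / N * (s - t)) = cis (- (2 * pi / N) * t) / cis (- (2 * pi / N) * s)"
      unfolding cis_divide by (rule arg_cong[where f = cis]) (simp add: right_diff_distrib)
    then show ?thesis by (auto simp: field_simps)
  qed
  also have "\<dots> \<longleftrightarrow> (\<exists>c::int. s - t = N * of_int c)"
  proof
    assume "cis (2 * pi / N * (s - t)) = 1"
    then have "cos (2 * pi / N * (s - t)) = 1" by (metis cis.simps(1) one_complex.simps(1))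
    then obtain c :: int where "2 * pi / N * (s - t) = of_int c * 2 * pi"
      by (auto simp: cos_one_2pi_int)
    then have "2 * pi * (s - t) = 2 * pi * (N * of_int c)" using assms by (simp add: field_simps)
    then have "s - t = N * of_int c" by (simp only: mult_cancel_left) simp
    then show "\<exists>c::int. s - t = N * of_int c" ..
  next
    assume "\<exists>c::int. s - t = N * of_int c"
    then obtain c :: int where c: "s - t = N * of_int c" ..
    have "2 * pi / N * (s - t) = 2 * pi * of_int c" using assms by (simp add: c)
    then show "cis (2 * pi / N * (s - t)) = 1" by (simp add: cis_multiple_2pi)
  qed
  finally show ?thesis .
qed

lemma part_heights_less:
  assumes "lam \<in> partitions n k" "i < j" "j < n"
  shows "part_heights n lam j < part_heights n lam i" "part_heights n lam i < n + k"
proof -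
  have "lam (j + 1) \<le> lam (i + 1)" "lam (i + 1) \<le> lam 1" "lam 1 \<le> k"
    using assms unfolding partitions_def by (simp, force+)
  then show "part_heights n lam j < part_heights n lam i" "part_heights n lam i < n + k"
    using assms by (auto simp: part_heights_def)
qed

lemma part_heights_bound:
  assumes "lam \<in> partitions n k" "i < n"
  shows "part_heights n lam i < n + k"
proof -
  have "lam (i + 1) \<le> lam 1" "lam 1 \<le> k" using assms by (auto simp: partitions_def)
  then show ?thesis using assms(2) by (simp add: part_heights_def)
qed

lemma part_heights_last:
  assumes "lam \<in> partitions n k" "n \<ge> 1"
  shows "part_heights n lam (n - Suc 0) = 0"
  using assms by (simp add: part_heights_def partitions_def)

lemma part_heights_inject:
  assumes "lam \<in> partitions n k" "mu \<in> partitions n k"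
    "\<And>i. i < n - 1 \<Longrightarrow> part_heights n lam i = part_heights n mu i"
  shows "lam = mu"
proof
  fix i
  show "lam i = mu i"
  proof (cases "i \<in> {1..n - 1}")
    case True
    then have "part_heights n lam (i - 1) = part_heights n mu (i - 1)" by (intro assms(3)) auto
    then show ?thesis using True by (simp add: part_heights_def)
  qed (use assms(1,2) in \<open>auto simp: partitions_def\<close>)
qed

lemma shifted_weight_diff:
  assumes "lam \<in> partitions n k" "i < n" "j < n"
  shows "shifted_weight n lam i - shifted_weight n lam j < real (k + n)"
  using part_heights_bound[OF assms(1,2)] assms by (simp add: shifted_weight_eq)

text \<open>The common power y_j^N: the heights are integers and disappear from the exponential, and
  the shift, which does not depend on j, remains.\<close>

definition zeta :: "nat \<Rightarrow> (nat \<Rightarrow> nat) \<Rightarrow> complex" where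
  "zeta n lam = cis (2 * pi * weight_shift n lam)"

text \<open>The points are distinct because the heights are distinct and spread over less than one
  period \<open>n + k\<close>. Their product is 1 because a shifted weight has coordinate sum
  0.\<close>

lemma bethe_roots_bethe_point:
  assumes "n \<ge> 2" "sig \<in> partitions n k"
  shows "bethe_roots n k (bethe_point n k sig) (zeta n sig)"
  unfolding bethe_roots_def
proof (intro conjI allI impI)
  let ?b = "shifted_weight n sig"
  have N: "real (k + n) > 0" using assms by simp
  show "inj_on (bethe_point n k sig) {..<n}"
  proof (rule inj_onI)
    fix i j assume ij: "i \<in> {..<n}" "j \<in> {..<n}" and "bethe_point n k sig i = bethe_point n k sig j"
    then obtain c :: int where "?b i - ?b j = real (k + n) * of_int c"
      unfolding bethe_point_def cis_minus_eq_iff[OF N] by blast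
    then have "real_of_int (int (part_heights n sig i) - int (part_heights n sig j)) = of_int (int (k + n) * c)"
      using ij by (simp add: shifted_weight_eq)
    then have eq: "int (part_heights n sig i) - int (part_heights n sig j) = int (k + n) * c"
      by (simp only: of_int_eq_iff)
    have "part_heights n sig i < n + k" "part_heights n sig j < n + k"
      using part_heights_bound[OF assms(2)] ij by auto
    then have "\<bar>int (part_heights n sig i) - int (part_heights n sig j)\<bar> < int (k + n)" by linarith
    then have "\<bar>int (k + n) * c\<bar> < int (k + n) * 1" unfolding eq by simp
    then have "\<bar>c\<bar> < 1" unfolding abs_mult by (simp only: abs_of_nat) (metis mult_less_cancel_left of_nat_0_le_iff not_le)
    then have "part_heights n sig i = part_heights n sig j" using eq by simp
    then show "i = j" using part_heights_less(1)[OF assms(2)] ij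
      by (metis lessThan_iff linorder_neqE_nat less_irrefl)
  qed
  fix j assume j: "j < n"
  have "bethe_point n k sig j ^ (n + k) = cis (real (n + k) * (- (2 * pi / real (k + n)) * ?b j))"
    unfolding bethe_point_def by (simp only: DeMoivre)
  also have "real (n + k) * (- (2 * pi / real (k + n)) * ?b j) = - (2 * pi * ?b j)"
    using N by (simp add: field_simps)
  also have "\<dots> = 2 * pi * weight_shift n sig - 2 * pi * real (part_heights n sig j)"
    using j by (simp add: shifted_weight_eq algebra_simps)
  also have "cis \<dots> = cis (2 * pi * weight_shift n sig) / cis (2 * pi * real (part_heights n sig j))"
    by (simp only: cis_divide)
  also have "cis (2 * pi * real (part_heights n sig j)) = 1"
    by (rule cis_multiple_2pi) simp
  finally show "bethe_point n k sig j ^ (n + k) = zeta n sig" by (simp add: zeta_def)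
next
  have "(\<Prod>j<p. bethe_point n k sig j) = cis (- (2 * pi / real (k + n)) * (\<Sum>j<p. shifted_weight n sig j))" for p
    by (induction p) (simp_all add: bethe_point_def cis_mult algebra_simps add_divide_distrib)
  from this[of n] show "(\<Prod>j<n. bethe_point n k sig j) = 1"
    using assms sum_shifted_weight[of n sig] by simp
qed

lemma sign_inv_into:
  assumes "w permutes {1..n :: nat}"
  shows "sign (inv_into UNIV w) = sign w"
proof (rule sign_inverse)
  show "permutation w"
    unfolding permutation_permutes using assms by (intro exI[of _ "{1..n}"] conjI) auto
qed

text \<open>Each exponential is a product of powers of the points of \<open>sig\<close>. The
  constant shift between the weight and the heights of \<open>lam\<close> drops out, because the
  coordinates of the shifted weight of \<open>sig\<close> sum to 0.\<close>

lemma S_matrix_alt_det: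
  assumes "n \<ge> 1"
  shows "S_matrix n k lam sig = S_const n k * alt_det n (bethe_point n k sig) (part_heights n lam)"
proof -
  let ?s = "\<lambda>i. finite_weight n sig i + rho n i" and ?l = "\<lambda>i. finite_weight n lam i + rho n i"
  let ?y = "\<lambda>i. bethe_point n k sig (i - 1)" and ?h = "\<lambda>i. part_heights n lam (i - 1)"
  let ?c = "weight_shift n lam"
  have trm: "exp (- (2 * of_real pi * \<i> / of_nat (k + n)) * of_real (\<Sum>i=1..n. ?s i * ?l (inv_into UNIV w i))) =
     (\<Prod>i=1..n. ?y i ^ ?h (inv_into UNIV w i))" if w: "w permutes {1..n}" for w
  proof -
    have inv: "inv_into UNIV w i \<in> {1..n}" if "i \<in> {1..n}" for i
      using permutes_in_image[OF permutes_inv[OF w]] that by blast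
    have s0: "(\<Sum>i=1..n. ?s i) = 0"
    proof -
      have "(\<Sum>i=1..n. ?s i) = (\<Sum>j<n. shifted_weight n sig j)"
        by (rule sum.reindex_bij_witness[of _ Suc "\<lambda>i. i - 1"]) (auto simp: shifted_weight_def)
      then show ?thesis using sum_shifted_weight assms by simp
    qed
    have l: "?l i = real (?h i) - ?c" if "i \<in> {1..n}" for i
      using shifted_weight_eq[of "i - 1" n lam] that by (auto simp: shifted_weight_def)
    have y: "?y i = cis (- (2 * pi / real (k + n)) * ?s i)" if "i \<in> {1..n}" for i
      using that by (simp add: bethe_point_def shifted_weight_def)
    have "(\<Sum>i=1..n. ?s i * ?l (inv_into UNIV w i)) = (\<Sum>i=1..n. ?s i * real (?h (inv_into UNIV w i)) - ?s i * ?c)"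
      by (intro sum.cong refl) (simp only: l[OF inv] right_diff_distrib)
    also have "\<dots> = (\<Sum>i=1..n. ?s i * real (?h (inv_into UNIV w i)))"
      by (simp only: sum_subtractf sum_distrib_right[symmetric] s0 mult_zero_left diff_zero)
    finally have sum: "(\<Sum>i=1..n. ?s i * ?l (inv_into UNIV w i)) = (\<Sum>i=1..n. ?s i * real (?h (inv_into UNIV w i)))" .
    have "exp (- (2 * of_real pi * \<i> / of_nat (k + n)) * of_real (\<Sum>i=1..n. ?s i * ?l (inv_into UNIV w i))) =
      cis (- (2 * pi / real (k + n)) * (\<Sum>i=1..n. ?s i * real (?h (inv_into UNIV w i))))"
      unfolding sum cis_conv_exp by (rule arg_cong[where f = exp]) simp
    also have "\<dots> = (\<Prod>i=1..n. cis (- (2 * pi / real (k + n)) * (?s i * real (?h (inv_into UNIV w i)))))"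
    proof -
      have "cis (c * (\<Sum>i\<in>I. f i)) = (\<Prod>i\<in>I. cis (c * f i))" for c f and I :: "nat set"
        by (induction I rule: infinite_finite_induct) (simp_all add: distrib_left cis_mult[symmetric])
      then show ?thesis .
    qed
    also have "\<dots> = (\<Prod>i=1..n. ?y i ^ ?h (inv_into UNIV w i))"
      by (intro prod.cong refl) (simp only: y DeMoivre, simp add: algebra_simps add_divide_distrib)
    finally show ?thesis .
  qed
  have "(\<Sum>w | w permutes {1..n}. of_int (sign w) *
      exp (- (2 * of_real pi * \<i> / of_nat (k + n)) * of_real (\<Sum>i=1..n. ?s i * ?l (inv_into UNIV w i)))) =
    (\<Sum>w | w permutes {1..n}. of_int (sign w) * (\<Prod>i=1..n. ?y i ^ ?h (inv_into UNIV w i)))"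
    by (intro sum.cong refl) (simp only: trm mem_Collect_eq)
  also have "\<dots> = (\<Sum>w | w permutes {1..n}. of_int (sign (inv_into UNIV w)) * (\<Prod>i=1..n. ?y i ^ ?h (w i)))"
    by (subst sum_permutations_inverse, intro sum.cong refl) (simp add: permutes_inv_inv)
  also have "\<dots> = (\<Sum>w | w permutes {1..n}. of_int (sign w) * (\<Prod>i=1..n. ?y i ^ ?h (w i)))"
    by (intro sum.cong refl) (simp only: sign_inv_into mem_Collect_eq)
  also have "\<dots> = det (mat n n (\<lambda>(i, j). ?y (i + 1) ^ ?h (j + 1)))"
    by (rule sum_permutes_shift)
  also have "\<dots> = det ((mat n n (\<lambda>(i, j). ?y (i + 1) ^ ?h (j + 1)))\<^sup>T)"
    by (rule det_transpose[of _ n, symmetric]) simp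
  also have "(mat n n (\<lambda>(i, j). ?y (i + 1) ^ ?h (j + 1)))\<^sup>T = mat n n (\<lambda>(i, j). bethe_point n k sig j ^ part_heights n lam i)"
    by (rule eq_matI) auto
  finally show ?thesis unfolding S_matrix_def S_const_def alt_det_def by simp
qed

text \<open>The inner product is invariant under permutations and inversion preserves signs.
  Symmetry turns orthogonality of the columns of S into that of the rows.\<close>

lemma S_matrix_symmetric: "S_matrix n k lam sig = S_matrix n k sig lam"
proof -
  let ?s = "\<lambda>i. finite_weight n sig i + rho n i" and ?l = "\<lambda>i. finite_weight n lam i + rho n i"
  let ?e = "\<lambda>x. exp (- (2 * of_real pi * \<i> / of_nat (k + n)) * of_real x)"
  have "(\<Sum>w | w permutes {1..n}. of_int (sign w) * ?e (\<Sum>i=1..n. ?s i * ?l (inv_into UNIV w i))) =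
    (\<Sum>w | w permutes {1..n}. of_int (sign (inv_into UNIV w)) * ?e (\<Sum>i=1..n. ?s i * ?l (inv_into UNIV (inv_into UNIV w) i)))"
    by (rule sum_permutations_inverse)
  also have "\<dots> = (\<Sum>w | w permutes {1..n}. of_int (sign w) * ?e (\<Sum>i=1..n. ?l i * ?s (inv_into UNIV w i)))"
  proof (rule sum.cong[OF refl])
    fix w assume "w \<in> {w. w permutes {1..n}}"
    then have w: "w permutes {1..n}" by simp
    have "(\<Sum>i=1..n. ?l i * ?s (inv_into UNIV w i)) = (\<Sum>i=1..n. ?l (w i) * ?s (inv_into UNIV w (w i)))"
      using sum.permute[OF w, of "\<lambda>i. ?l i * ?s (inv_into UNIV w i)"] by (simp only: o_def)
    also have "\<dots> = (\<Sum>i=1..n. ?s i * ?l (inv_into UNIV (inv_into UNIV w) i))"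
      using w by (simp add: permutes_inv_inv permutes_inverses mult.commute)
    finally have "(\<Sum>i=1..n. ?l i * ?s (inv_into UNIV w i)) = (\<Sum>i=1..n. ?s i * ?l (inv_into UNIV (inv_into UNIV w) i))" .
    moreover have "sign (inv_into UNIV w) = sign w"
      using w by (rule sign_inv_into)
    ultimately show "of_int (sign (inv_into UNIV w)) * ?e (\<Sum>i=1..n. ?s i * ?l (inv_into UNIV (inv_into UNIV w) i)) =
      of_int (sign w) * ?e (\<Sum>i=1..n. ?l i * ?s (inv_into UNIV w i))" by simp
  qed
  finally show ?thesis unfolding S_matrix_def by simp
qed

text \<open>
  Equality of the points up to order means that the shifted weights differ by \<open>(n + k) c\<close> with \<open>c\<close>
  integral of sum zero, up to order. If \<open>c \<noteq> 0\<close>, it has entries \<open>\<ge> 1\<close> and \<open>\<le> -1\<close>, but the entries of a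
  shifted weight differ by less than \<open>n + k\<close>.
\<close>

lemma bethe_point_inject:
  assumes n: "n \<ge> 2" and P: "sig \<in> partitions n k" "tau \<in> partitions n k"
    and w: "w permutes {0..<n}" "w' permutes {0..<n}"
    and eq: "\<And>i. i < n \<Longrightarrow> bethe_point n k sig (w i) = bethe_point n k tau (w' i)"
  shows "sig = tau"
proof -
  let ?s = "shifted_weight n sig" and ?t = "shifted_weight n tau"
  have N: "real (k + n) > 0" using n by simp
  have wi: "w i < n" "w' i < n" if "i < n" for i
    using permutes_in_image[OF w(1), of i] permutes_in_image[OF w(2), of i] that by auto
  have "\<forall>i. \<exists>c::int. i < n \<longrightarrow> ?s (w i) - ?t (w' i) = real (k + n) * of_int c"
    using eq cis_minus_eq_iff[OF N] unfolding bethe_point_def by blast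
  then obtain c :: "nat \<Rightarrow> int" where c: "\<And>i. i < n \<Longrightarrow> ?s (w i) - ?t (w' i) = real (k + n) * of_int (c i)"
    by metis
  have perm: "(\<Sum>i<n. f (p i)) = (\<Sum>i<n. f i)" if "p permutes {0..<n}" for f :: "nat \<Rightarrow> real" and p
    using sum.permute[OF that, of f] by (simp add: o_def lessThan_atLeast0)
  have "real (k + n) * (\<Sum>i<n. of_int (c i)) = (\<Sum>i<n. ?s (w i)) - (\<Sum>i<n. ?t (w' i))"
    unfolding sum_distrib_left sum_subtractf[symmetric] by (intro sum.cong) (auto simp: c)
  also have "\<dots> = 0" using n by (simp add: perm w sum_shifted_weight)
  finally have "(\<Sum>i<n. real_of_int (c i)) = 0" using N by simp
  then have c0: "(\<Sum>i<n. c i) = 0" by (metis of_int_eq_0_iff of_int_sum)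
  have czero: "c i = 0" if "i < n" for i
  proof (rule ccontr)
    assume "c i \<noteq> 0"
    have "\<exists>j<n. c j \<ge> 1"
    proof (rule ccontr)
      assume "\<not> ?thesis"
      then have "\<forall>j\<in>{..<n}. 0 \<le> - c j" by (auto simp: not_le)
      moreover have "(\<Sum>j<n. - c j) = 0" using c0 by (simp add: sum_negf)
      ultimately have "\<forall>j\<in>{..<n}. - c j = 0" using sum_nonneg_eq_0_iff[of "{..<n}" "\<lambda>j. - c j"] by blast
      then show False using \<open>c i \<noteq> 0\<close> that by simp
    qed
    then obtain a where a: "a < n" "c a \<ge> 1" by blast
    have "\<exists>j<n. c j \<le> - 1"
    proof (rule ccontr)
      assume "\<not> ?thesis"
      then have "\<forall>j\<in>{..<n}. 0 \<le> c j" by (auto simp: not_le)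
      then have "\<forall>j\<in>{..<n}. c j = 0" using c0 sum_nonneg_eq_0_iff[of "{..<n}" c] by blast
      then show False using \<open>c i \<noteq> 0\<close> that by simp
    qed
    then obtain b where b: "b < n" "c b \<le> - 1" by blast
    have contr: False if "M * 1 \<le> x" "y \<le> M * - 1" "p - q < M" "s - r < M" "p - r = x" "q - s = y"
      for M x y p q r s :: real using that by linarith
    have 1: "real (k + n) * of_int (c a) \<ge> real (k + n) * 1" using a by (intro mult_left_mono) auto
    have 2: "real (k + n) * of_int (c b) \<le> real (k + n) * (- 1)"
      using b by (intro mult_left_mono) auto
    have 3: "?s (w a) - ?s (w b) < real (k + n)" "?t (w' b) - ?t (w' a) < real (k + n)"
      using shifted_weight_diff[OF P(1) wi(1)[OF a(1)] wi(1)[OF b(1)]]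
        shifted_weight_diff[OF P(2) wi(2)[OF b(1)] wi(2)[OF a(1)]] by auto
    show False by (rule contr[OF 1 2 3 c[OF a(1)] c[OF b(1)]])
  qed
  have eqst: "?s (w i) = ?t (w' i)" if "i < n" for i using c[OF that] czero[OF that] by simp
  have img: "f ` {..<n} = (\<lambda>i. f (p i)) ` {..<n}" if "p permutes {0..<n}" for f :: "nat \<Rightarrow> real" and p
  proof -
    have "(\<lambda>i. f (p i)) ` {..<n} = f ` (p ` {..<n})" by (simp add: image_image)
    then show ?thesis using permutes_image[OF that] by (simp add: lessThan_atLeast0)
  qed
  \<comment> \<open>Without the order only the sets of coordinates agree; as shifted weights are
    strictly decreasing, the sets determine the sequences.\<close>
  have "?s ` {..<n} = ?t ` {..<n}"
    unfolding img[OF w(1), of ?s] img[OF w(2), of ?t] by (intro image_cong) (auto simp: eqst)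
  moreover have srt: "sorted_wrt (<) (map (\<lambda>i. - shifted_weight n lam i) [0..<n])"
    if "lam \<in> partitions n k" for lam
    using part_heights_less(1)[OF that] by (simp add: sorted_wrt_iff_nth_less shifted_weight_eq)
  ultimately have "map (\<lambda>i. - ?s i) [0..<n] = map (\<lambda>i. - ?t i) [0..<n]"
    using P by (intro strict_sorted_equal[OF srt srt])
      (auto simp: lessThan_atLeast0 image_iff, (metis atLeastLessThan_iff image_iff zero_le)+)
  then have st: "?s i = ?t i" if "i < n" for i using that by (simp add: map_eq_conv)
  \<comment> \<open>The last height is 0, so the last coordinate reveals the shift.\<close>
  have "weight_shift n sig = weight_shift n tau"
    using st[of "n - 1"] n part_heights_last[OF P(1)] part_heights_last[OF P(2)] by (simp add: shifted_weight_eq)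
  then have "part_heights n sig i = part_heights n tau i" if "i < n" for i
    using st[OF that] that by (simp add: shifted_weight_eq)
  then show ?thesis using P by (intro part_heights_inject[of _ n k]) auto
qed

section \<open>Unitarity of the S-matrix\<close>

definition part_of :: "nat \<Rightarrow> (nat \<Rightarrow> nat) \<Rightarrow> nat \<Rightarrow> nat" where
  "part_of n m i = (if i = 0 then 0 else \<Sum>t\<in>{i..<n}. m t)"

definition weight_of :: "nat \<Rightarrow> nat \<Rightarrow> (nat \<Rightarrow> nat) \<Rightarrow> nat \<Rightarrow> nat" where
  "weight_of n k lam i = (if i \<in> {1..<n} then lam i - lam (i + 1) else if i = n then k - lam 1 else 0)"

lemma part_of_weight_of:
  assumes "n \<ge> 2" "lam \<in> partitions n k"
  shows "part_of n (weight_of n k lam) = lam"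
proof
  fix i
  have dec: "lam (Suc i) \<le> lam i" if "1 \<le> i" for i using assms that by (auto simp: partitions_def)
  have "(\<Sum>t\<in>{i..<n}. weight_of n k lam t) = lam i" if "1 \<le> i" "i \<le> n"
    using that(2,1)
  proof (induction i rule: inc_induct)
    case base
    then show ?case using assms by (simp add: partitions_def)
  next
    case (step i)
    then have "(\<Sum>t\<in>{i..<n}. weight_of n k lam t) = weight_of n k lam i + lam (Suc i)"
      by (simp add: sum.atLeast_Suc_lessThan)
    then show ?case using step dec[of i] by (simp add: weight_of_def)
  qed
  then show "part_of n (weight_of n k lam) i = lam i"
    using assms by (cases "1 \<le> i \<and> i \<le> n") (auto simp: part_of_def partitions_def not_le)
qed

lemma bij_betw_part_of:
  assumes n: "n \<ge> 2"
  shows "bij_betw (part_of n) (weights n k) (partitions n k)"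
proof (rule bij_betw_byWitness[where f' = "weight_of n k"])
  show "\<forall>m\<in>weights n k. weight_of n k (part_of n m) = m"
  proof (intro ballI ext)
    fix m i assume m: "m \<in> weights n k"
    have "(\<Sum>t\<in>{1..n}. m t) = (\<Sum>t\<in>{1..<n}. m t) + m n"
      using n by (simp add: sum.last_plus)
    then have k: "k = (\<Sum>t\<in>{1..<n}. m t) + m n" using m by (simp add: weights_def)
    show "weight_of n k (part_of n m) i = m i"
      using m n by (auto simp: weight_of_def part_of_def weights_def sum.atLeast_Suc_lessThan k)
  qed
  show "\<forall>lam\<in>partitions n k. part_of n (weight_of n k lam) = lam"
    using part_of_weight_of[OF n] by blast
  show "part_of n ` weights n k \<subseteq> partitions n k"
  proof safe
    fix m assume m: "m \<in> weights n k"
    have "(\<Sum>t\<in>{1..<n}. m t) \<le> (\<Sum>t\<in>{1..n}. m t)" by (rule sum_mono2) auto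
    then have "part_of n m 1 \<le> k" using m by (simp add: part_of_def weights_def)
    moreover have "part_of n m j \<le> part_of n m i" if "1 \<le> i" "i \<le> j" for i j
      using that by (auto simp: part_of_def intro!: sum_mono2)
    moreover have "part_of n m i = 0" if "i \<notin> {1..n - 1}" for i
      using that n by (auto simp: part_of_def)
    ultimately show "part_of n m \<in> partitions n k" unfolding partitions_def by blast
  qed
  show "weight_of n k ` partitions n k \<subseteq> weights n k"
  proof safe
    fix lam assume lam: "lam \<in> partitions n k"
    have "(\<Sum>t\<in>{1..<n}. weight_of n k lam t) = lam 1"
      using fun_cong[OF part_of_weight_of[OF n lam], of 1] by (simp add: part_of_def)
    moreover have "weight_of n k lam n = k - lam 1" by (simp add: weight_of_def)
    moreover have "(\<Sum>t\<in>{1..n}. weight_of n k lam t) = (\<Sum>t\<in>{1..<n}. weight_of n k lam t) + weight_of n k lam n"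
      using n by (simp add: sum.last_plus)
    ultimately have "(\<Sum>t\<in>{1..n}. weight_of n k lam t) = k" using lam by (simp add: partitions_def)
    then show "weight_of n k lam \<in> weights n k" using n by (simp add: weights_def weight_of_def)
  qed
qed

lemma part_heights_part_of: "i < n \<Longrightarrow> part_heights n (part_of n m) i = heights n m i"
  by (simp add: part_heights_def part_of_def heights_def)

lemma alt_det_part_of: "alt_det n y (part_heights n (part_of n m)) = alt_det n y (heights n m)"
  by (intro alt_det_cong part_heights_part_of)

section \<open>Orthogonality for different values of \<zeta>\<close>

text \<open>The hop in which every node emits all its particles, the only one that contributes to
  h_k at level \<open>k\<close>.\<close>

definition rotate_weight :: "nat \<Rightarrow> (nat \<Rightarrow> nat) \<Rightarrow> nat \<Rightarrow> nat" where
  "rotate_weight n m = hop n m (\<lambda>i. if i < n then capacity n m i else 0)"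

lemma moves_top:
  assumes "n \<ge> 2" "m \<in> weights n k"
  shows "{\<epsilon>. \<epsilon> \<in> moves n m \<and> (\<Sum>i<n. \<epsilon> i) = k} = {\<lambda>i. if i < n then capacity n m i else 0}"
proof (intro equalityI subsetI)
  fix \<epsilon> assume e: "\<epsilon> \<in> {\<epsilon>. \<epsilon> \<in> moves n m \<and> (\<Sum>i<n. \<epsilon> i) = k}"
  have "\<epsilon> i = capacity n m i" if "i < n" for i
  proof (rule ccontr)
    assume "\<epsilon> i \<noteq> capacity n m i"
    then have "\<epsilon> i < capacity n m i" using e that by (auto simp: moves_def le_neq_implies_less)
    then have "(\<Sum>i<n. \<epsilon> i) < (\<Sum>i<n. capacity n m i)"
      using e that by (intro sum_strict_mono_ex1) (auto simp: moves_def)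
    then show False using e sum_capacity[of n m k] assms by simp
  qed
  then show "\<epsilon> \<in> {\<lambda>i. if i < n then capacity n m i else 0}"
    using e by (auto simp: moves_def fun_eq_iff)
next
  fix \<epsilon> assume e: "\<epsilon> \<in> {\<lambda>i. if i < n then capacity n m i else 0}"
  then show "\<epsilon> \<in> {\<epsilon>. \<epsilon> \<in> moves n m \<and> (\<Sum>i<n. \<epsilon> i) = k}"
    using sum_capacity[of n m k] assms by (auto simp: moves_def)
qed

lemma rotate_weight_apply:
  assumes "n \<ge> 2"
  shows "rotate_weight n m j = (if j \<in> {1..n} then capacity n m (j - 1) else m j)"
proof -
  have "m j = capacity n m (j mod n)" if "j \<in> {1..n}"
    using that assms by (cases "j = n") (auto simp: capacity_def)
  then show ?thesis using assms by (auto simp: rotate_weight_def hop_def)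
qed

lemma bij_betw_rotate_weight:
  assumes n: "n \<ge> 2"
  shows "bij_betw (rotate_weight n) (weights n k) (weights n k)"
proof -
  have sub: "rotate_weight n ` weights n k \<subseteq> weights n k"
    unfolding rotate_weight_def using n by (auto intro!: hop_weights simp: moves_def)
  have "inj_on (rotate_weight n) (weights n k)"
  proof (intro inj_onI ext)
    fix m m' j assume m: "m \<in> weights n k" "m' \<in> weights n k" and eq: "rotate_weight n m = rotate_weight n m'"
    have cap: "capacity n m i = capacity n m' i" if "i < n" for i
      using fun_cong[OF eq, of "i + 1"] that by (simp add: rotate_weight_apply[OF n])
    show "m j = m' j"
    proof (cases "j \<in> {1..n}")
      case True
      then show ?thesis using cap[of 0] cap[of j] n by (cases "j = n") (auto simp: capacity_def)
    next
      case False
      then show ?thesis using m by (simp add: weights_def)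
    qed
  qed
  then show ?thesis
    using endo_inj_surj[OF finite_weights sub] by (simp add: bij_betw_def)
qed

text \<open>
  The operator \<open>h\<^sub>k\<close> permutes the weights by rotation, and has eigenvalues \<open>\<plusminus>\<zeta>\<close> and \<open>\<plusminus>\<zeta>'\<close> on the two
  functionals.
\<close>

lemma sum_alt_det_zero:
  assumes n: "n \<ge> 2" and y: "bethe_roots n k y \<zeta>" and y': "bethe_roots n k y' \<zeta>'"
    and ne: "\<zeta> * cnj \<zeta>' \<noteq> 1"
  shows "(\<Sum>m\<in>weights n k. alt_det n y (heights n m) * cnj (alt_det n y' (heights n m))) = 0"
    (is "sum ?f _ = 0")
proof -
  have top: "alt_det n y (heights n (rotate_weight n m)) = (-1) ^ (n + 1) * \<zeta> * alt_det n y (heights n m)"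
    if "bethe_roots n k y \<zeta>" "m \<in> weights n k" for y \<zeta> m
    using alt_det_eigen[OF n that, of k]
    by (simp only: moves_top[OF n that(2)] coeff_bethe_poly_top[OF n that(1)] rotate_weight_def) simp
  have "(\<Sum>m\<in>weights n k. ?f m) = (\<Sum>m\<in>weights n k. ?f (rotate_weight n m))"
    by (rule sum.reindex_bij_betw[OF bij_betw_rotate_weight[OF n], symmetric])
  also have "\<dots> = (\<Sum>m\<in>weights n k. \<zeta> * cnj \<zeta>' * ?f m)"
  proof (rule sum.cong[OF refl])
    fix m assume m: "m \<in> weights n k"
    have "((-1) ^ (n + 1) * ((-1) ^ (n + 1)) :: complex) = 1"
      by (simp only: power_add[symmetric] mult_2[symmetric]) simp
    then show "?f (rotate_weight n m) = \<zeta> * cnj \<zeta>' * ?f m"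
      by (simp add: top[OF y m] top[OF y' m])
  qed
  also have "\<dots> = \<zeta> * cnj \<zeta>' * (\<Sum>m\<in>weights n k. ?f m)" by (simp only: sum_distrib_left)
  finally have "(1 - \<zeta> * cnj \<zeta>') * (\<Sum>m\<in>weights n k. ?f m) = 0" by (simp add: left_diff_distrib)
  then show ?thesis using ne by simp
qed

section \<open>Orthogonality for equal values of \<zeta>: unsorted exponents\<close>

lemma alt_det_permute:
  assumes "p permutes {0..<n}"
  shows "alt_det n y (\<lambda>i. l (p i)) = of_int (sign p) * alt_det n y l"
proof -
  let ?A = "mat n n (\<lambda>(i, j). y j ^ l i)"
  have "mat n n (\<lambda>(i, j). y j ^ l (p i)) = mat n n (\<lambda>(i, j). ?A $$ (p i, j))"
    using permutes_in_image[OF assms] by (intro eq_matI) auto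
  then show ?thesis
    unfolding alt_det_def using det_permute_rows[of ?A n p] assms by simp
qed

lemma alt_det_repeated:
  assumes "i < n" "j < n" "i \<noteq> j" "l i = l j"
  shows "alt_det n y l = 0"
  unfolding alt_det_def
  by (rule det_identical_rows[of _ n i j]) (use assms in \<open>auto intro!: eq_vecI\<close>)

text \<open>The exponents 0, ..., n - 2 are free; the last is 0, as it is for the heights of a
  partition.\<close>

definition extend_zero :: "nat \<Rightarrow> (nat \<Rightarrow> nat) \<Rightarrow> nat \<Rightarrow> nat" where
  "extend_zero n l i = (if i < n - 1 then l i else 0)"

text \<open>A permutation of a strictly decreasing sequence is recovered from the ranks of its
  values. This gives uniqueness of sorting.\<close>

lemma rank_of_permuted:
  fixes h :: "nat \<Rightarrow> nat"
  assumes "p permutes {0..<m}" "\<And>a b. a < b \<Longrightarrow> b < m \<Longrightarrow> h b < h a" "i < m"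
  shows "card {j. j < m \<and> h (p j) > h (p i)} = p i"
proof -
  have pm: "p j < m" if "j < m" for j using permutes_in_image[OF assms(1), of j] that by simp
  have "{j. j < m \<and> h (p j) > h (p i)} = {j. j < m \<and> p j < p i}"
    using assms(2) pm assms(3) by (auto, metis linorder_neqE_nat not_less_iff_gr_or_eq)
  moreover have "p ` {j. j < m \<and> p j < p i} = {..<p i}"
  proof (intro equalityI subsetI)
    fix c assume "c \<in> {..<p i}"
    then have "c \<in> {0..<m}" using pm[OF assms(3)] by simp
    then have "c \<in> p ` {0..<m}" using permutes_image[OF assms(1)] by simp
    then show "c \<in> p ` {j. j < m \<and> p j < p i}" using \<open>c \<in> {..<p i}\<close> by auto
  qed auto
  moreover have "inj_on p {j. j < m \<and> p j < p i}"
    using permutes_inj[OF assms(1)] by (rule inj_on_subset) simp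
  ultimately show ?thesis by (metis card_image card_lessThan)
qed

lemma ex_sorting_permutation:
  fixes l :: "nat \<Rightarrow> nat"
  assumes inj: "inj_on l {..<m}"
  obtains p where "p permutes {0..<m}"
    "\<forall>a b. a < b \<longrightarrow> b < m \<longrightarrow> l (inv_into UNIV p b) < l (inv_into UNIV p a)"
proof -
  \<comment> \<open>The rank of an entry is the number of larger ones.\<close>
  define p where "p i = (if i < m then card {j. j < m \<and> l j > l i} else i)" for i
  have less: "p i < p j" if "i < m" "j < m" "l j < l i" for i j
  proof -
    have "{a. a < m \<and> l a > l i} \<subset> {a. a < m \<and> l a > l j}" using that by auto
    then show ?thesis using that by (simp add: p_def psubset_card_mono)
  qed
  have lt: "p i < m" if "i < m" for i
  proof -
    have "{j. j < m \<and> l j > l i} \<subset> {..<m}" using that by auto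
    from psubset_card_mono[OF _ this] show ?thesis using that by (simp add: p_def)
  qed
  have "inj_on p {0..<m}"
  proof (rule inj_onI, rule ccontr)
    fix i j assume ij: "i \<in> {0..<m}" "j \<in> {0..<m}" "p i = p j" "i \<noteq> j"
    then have "l i \<noteq> l j" using inj by (auto dest: inj_onD)
    then show False using less[of i j] less[of j i] ij by (auto simp: neq_iff)
  qed
  moreover have "p ` {0..<m} \<subseteq> {0..<m}" using lt by auto
  ultimately have "bij_betw p {0..<m} {0..<m}"
    using endo_inj_surj[of "{0..<m}" p] by (simp add: bij_betw_def)
  then have p: "p permutes {0..<m}" by (rule bij_imp_permutes) (simp add: p_def)
  show thesis
  proof (rule that[OF p], intro allI impI)
    fix a b assume ab: "a < b" "b < m"
    let ?i = "inv_into UNIV p a" and ?j = "inv_into UNIV p b"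
    have pi: "p ?i = a" "p ?j = b" using p by (simp_all add: permutes_inverses)
    have ij: "?i < m" "?j < m"
      using permutes_in_image[OF permutes_inv[OF p], of a] permutes_in_image[OF permutes_inv[OF p], of b] ab by simp_all
    have "?i \<noteq> ?j" using pi ab by auto
    then have "l ?i \<noteq> l ?j" using inj ij by (auto dest: inj_onD)
    moreover have "\<not> l ?i < l ?j" using less[OF ij(2,1)] pi ab by auto
    ultimately show "l ?j < l ?i" by simp
  qed
qed

text \<open>Subtraction of the staircase. Positive, strictly decreasing values dominate it, so the
  truncated differences are exact.\<close>

lemma sorted_heights_partition:
  assumes n: "n \<ge> 2" and dec: "\<And>a b. a < b \<Longrightarrow> b < n - 1 \<Longrightarrow> h b < h a"
    and bd: "\<And>a. a < n - 1 \<Longrightarrow> 0 < h a \<and> h a < n + k"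
  obtains lam where "lam \<in> partitions n k" "\<And>a. a < n - 1 \<Longrightarrow> part_heights n lam a = h a"
proof -
  define lam where "lam t = (if t \<in> {1..n - 1} then h (t - 1) - (n - t) else 0)" for t
  have diff: "h b + (b - a) \<le> h a" if "a \<le> b" "b < n - 1" for a b
    using that
  proof (induction b rule: dec_induct)
    case (step b)
    then show ?case using dec[of b "Suc b"] by (simp add: Suc_diff_le)
  qed simp
  have low: "n - Suc a \<le> h a" if "a < n - 1" for a
  proof -
    have "a \<le> n - 2" "n - 2 < n - 1" using that n by arith+
    then show ?thesis using diff[of a "n - 2"] bd[of "n - 2"] by arith
  qed
  have "part_heights n lam a = h a" if "a < n - 1" for a
    using low[OF that] that by (simp add: part_heights_def lam_def)
  moreover have "lam \<in> partitions n k"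
    unfolding partitions_def
  proof (intro CollectI conjI allI impI)
    fix t u :: nat assume tu: "1 \<le> t \<and> t \<le> u"
    show "lam u \<le> lam t"
    proof (cases "u \<le> n - 1")
      case True
      then have "t - 1 \<le> u - 1" "u - 1 < n - 1" using tu n by arith+
      then have "h (u - 1) + ((u - 1) - (t - 1)) \<le> h (t - 1)" by (rule diff)
      moreover have "lam u = h (u - 1) - (n - u)" "lam t = h (t - 1) - (n - t)"
        using tu True by (auto simp: lam_def)
      ultimately show ?thesis using tu True by arith
    qed (use tu in \<open>auto simp: lam_def\<close>)
  next
    show "lam 1 \<le> k" using bd[of 0] n by (auto simp: lam_def)
  qed (auto simp: lam_def)
  ultimately show thesis using that by blast
qed

lemma finite_partitions: "n \<ge> 2 \<Longrightarrow> finite (partitions n k)"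
  using bij_betw_finite[OF bij_betw_part_of] finite_weights by blast

text \<open>
  Dropping the order of the exponents costs a factor \<open>(n - 1)!\<close> and turns the sum into products of
  geometric sums.
\<close>

lemma sum_functions_partitions:
  assumes n: "n \<ge> 2"
  shows "(\<Sum>l\<in>PiE {..<n - 1} (\<lambda>_. {..<n + k}). alt_det n y (extend_zero n l) * alt_det n z (extend_zero n l)) =
    fact (n - 1) * (\<Sum>lam\<in>partitions n k. alt_det n y (part_heights n lam) * alt_det n z (part_heights n lam))"
proof -
  let ?G = "\<lambda>l. alt_det n y l * alt_det n z l"
  let ?L = "PiE {..<n - 1} (\<lambda>_. {..<n + k})"
  let ?D = "{l \<in> ?L. inj_on l {..<n - 1} \<and> (\<forall>i<n - 1. l i \<noteq> 0)}"
  let ?Q = "{p. p permutes {0..<n - 1}}"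
  let ?F = "\<lambda>(lam, p). restrict (\<lambda>i. part_heights n lam (p i)) {..<n - 1}"
  \<comment> \<open>A repeated exponent, or a 0 that repeats the appended last exponent, makes two
    rows equal.\<close>
  have "(\<Sum>l\<in>?L. ?G (extend_zero n l)) = (\<Sum>l\<in>?D. ?G (extend_zero n l))"
  proof (rule sum.mono_neutral_right)
    show "\<forall>l\<in>?L - ?D. ?G (extend_zero n l) = 0"
    proof
      fix l assume "l \<in> ?L - ?D"
      then consider i j where "i < n - 1" "j < n - 1" "i \<noteq> j" "l i = l j" | i where "i < n - 1" "l i = 0"
        by (auto simp: inj_on_def)
      then have "alt_det n y (extend_zero n l) = 0"
      proof cases
        case 1
        then show ?thesis by (intro alt_det_repeated[of i n j]) (auto simp: extend_zero_def)
      next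
        case 2
        then show ?thesis by (intro alt_det_repeated[of i n "n - 1"]) (auto simp: extend_zero_def)
      qed
      then show "?G (extend_zero n l) = 0" by simp
    qed
  qed (auto intro: finite_PiE)
  \<comment> \<open>Every remaining tuple is in exactly one way a permutation of the heights of a
    partition.\<close>
  also have "\<dots> = (\<Sum>x\<in>partitions n k \<times> ?Q. ?G (extend_zero n (?F x)))"
  proof (rule sum.reindex_bij_betw[symmetric], unfold bij_betw_def, intro conjI)
    show "inj_on ?F (partitions n k \<times> ?Q)"
    proof (rule inj_onI, clarify)
      fix lam p mu q
      assume P: "lam \<in> partitions n k" "mu \<in> partitions n k"
        and pq: "p permutes {0..<n - 1}" "q permutes {0..<n - 1}"
        and "restrict (\<lambda>i. part_heights n lam (p i)) {..<n - 1} = restrict (\<lambda>i. part_heights n mu (q i)) {..<n - 1}"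
      then have eq: "part_heights n lam (p i) = part_heights n mu (q i)" if "i < n - 1" for i
        using that by (metis lessThan_iff restrict_apply)
      have "p i = q i" if i: "i < n - 1" for i
      proof -
        have "p i = card {j. j < n - 1 \<and> part_heights n lam (p j) > part_heights n lam (p i)}"
          using part_heights_less(1)[OF P(1)] by (intro rank_of_permuted[OF pq(1) _ i, symmetric]) auto
        also have "{j. j < n - 1 \<and> part_heights n lam (p j) > part_heights n lam (p i)} =
            {j. j < n - 1 \<and> part_heights n mu (q j) > part_heights n mu (q i)}"
          using eq i by auto
        also have "card \<dots> = q i"
          using part_heights_less(1)[OF P(2)] by (intro rank_of_permuted[OF pq(2) _ i]) auto
        finally show ?thesis .
      qed
      then have pq': "p = q"
        using pq by (intro ext) (metis atLeastLessThan_iff permutes_not_in zero_le)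
      have "part_heights n lam a = part_heights n mu a" if "a < n - 1" for a
      proof -
        have "a \<in> p ` {0..<n - 1}" using permutes_image[OF pq(1)] that by simp
        then show ?thesis using eq pq' by auto
      qed
      then have "lam = mu" using P by (intro part_heights_inject)
      then show "lam = mu \<and> p = q" using pq' by simp
    qed
    show "?F ` (partitions n k \<times> ?Q) = ?D"
    proof (intro equalityI subsetI)
      fix l assume "l \<in> ?F ` (partitions n k \<times> ?Q)"
      then obtain lam p where lp: "lam \<in> partitions n k" "p permutes {0..<n - 1}"
        and l: "l = restrict (\<lambda>i. part_heights n lam (p i)) {..<n - 1}" by auto
      have pm: "p i < n - 1" if "i < n - 1" for i using permutes_in_image[OF lp(2), of i] that by simp
      have h: "part_heights n lam (p i) < n + k" "part_heights n lam (p i) \<noteq> 0" if "i < n - 1" for i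
        using part_heights_bound[OF lp(1), of "p i"] part_heights_less(1)[OF lp(1), of "p i" "n - 1"] pm[OF that] by auto
      have "inj_on l {..<n - 1}"
      proof (rule inj_onI)
        fix i j assume ij: "i \<in> {..<n - 1}" "j \<in> {..<n - 1}" "l i = l j"
        then have "part_heights n lam (p i) = part_heights n lam (p j)" by (simp add: l)
        then have "p i = p j"
          using part_heights_less(1)[OF lp(1)] pm[of i] pm[of j] ij
          by (metis diff_le_self lessThan_iff less_irrefl linorder_neqE_nat order_less_le_trans)
        then show "i = j" using permutes_inj[OF lp(2)] by (simp add: inj_eq)
      qed
      then show "l \<in> ?D" using h by (auto simp: l)
    next
      fix l assume l: "l \<in> ?D"
      then have "inj_on l {..<n - 1}" by simp
      then obtain p where p: "p permutes {0..<n - 1}"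
        "\<forall>a b. a < b \<longrightarrow> b < n - 1 \<longrightarrow> l (inv_into UNIV p b) < l (inv_into UNIV p a)"
        by (rule ex_sorting_permutation)
      let ?h = "\<lambda>a. l (inv_into UNIV p a)"
      have im: "inv_into UNIV p a < n - 1" if "a < n - 1" for a
        using permutes_in_image[OF permutes_inv[OF p(1)], of a] that by simp
      have "0 < ?h a \<and> ?h a < n + k" if "a < n - 1" for a
        using l im[OF that] by (auto simp: PiE_iff)
      with p(2) obtain lam where lam: "lam \<in> partitions n k" "\<And>a. a < n - 1 \<Longrightarrow> part_heights n lam a = ?h a"
        using sorted_heights_partition[OF n, of ?h k] by blast
      have "l = ?F (lam, p)"
      proof
        fix i
        show "l i = ?F (lam, p) i"
        proof (cases "i < n - 1")
          case True
          then have "p i < n - 1" using permutes_in_image[OF p(1), of i] by simp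
          then show ?thesis using True lam(2)[of "p i"] p(1) by (simp add: permutes_inverses)
        next
          case False
          then show ?thesis using l by (auto simp: PiE_iff extensional_def)
        qed
      qed
      then show "l \<in> ?F ` (partitions n k \<times> ?Q)" using lam(1) p(1) by blast
    qed
  qed
  \<comment> \<open>Sorting costs the same sign in both alternants, so their product is
    unchanged.\<close>
  also have "\<dots> = (\<Sum>x\<in>partitions n k \<times> ?Q. ?G (part_heights n (fst x)))"
  proof (rule sum.cong[OF refl])
    fix x assume "x \<in> partitions n k \<times> ?Q"
    then obtain lam p where x: "x = (lam, p)" and lam: "lam \<in> partitions n k" and p: "p permutes {0..<n - 1}"
      by blast
    have pn: "p permutes {0..<n}" using p by (rule permutes_subset) auto
    have ext: "extend_zero n (?F (lam, p)) i = part_heights n lam (p i)" if "i < n" for i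
    proof (cases "i < n - 1")
      case False
      then have "i = n - 1" using that by simp
      moreover have "p (n - 1) = n - 1" using permutes_not_in[OF p] by simp
      ultimately show ?thesis using part_heights_last[OF lam] n by (simp add: extend_zero_def)
    qed (simp add: extend_zero_def)
    have "alt_det n y (extend_zero n (?F (lam, p))) = of_int (sign p) * alt_det n y (part_heights n lam)" for y
      unfolding alt_det_permute[OF pn, symmetric] by (rule alt_det_cong) (rule ext)
    moreover have "of_int (sign p) * of_int (sign p) = (1 :: complex)"
      by (simp add: sign_def)
    ultimately show "?G (extend_zero n (?F x)) = ?G (part_heights n (fst x))"
      unfolding x
      by (simp add: mult_ac)
  qed
  also have "\<dots> = (\<Sum>lam\<in>partitions n k. \<Sum>p\<in>?Q. ?G (part_heights n lam))"
    by (simp only: sum.cartesian_product case_prod_unfold)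
  also have "\<dots> = fact (n - 1) * (\<Sum>lam\<in>partitions n k. ?G (part_heights n lam))"
  proof -
    have "card ?Q = fact (n - 1)" by (rule card_permutations) auto
    then show ?thesis by (simp only: sum_constant sum_distrib_left of_nat_fact)
  qed
  finally show ?thesis .
qed

lemma sum_powers_root_of_unity:
  fixes q :: complex
  assumes "q ^ N = 1"
  shows "(\<Sum>a<N. q ^ a) = (if q = 1 then of_nat N else 0)"
  using assms geometric_sum[of q N] by auto

text \<open>After expansion of both determinants the sum over independent exponents factors into n -
  1 geometric sums over a full period, each of which is N or 0.\<close>

lemma sum_functions_eval:
  assumes n: "n \<ge> 2" and q: "\<And>i j. i < n \<Longrightarrow> j < n \<Longrightarrow> (y i * z j) ^ (n + k) = 1"
  shows "(\<Sum>l\<in>PiE {..<n - 1} (\<lambda>_. {..<n + k}). alt_det n y (extend_zero n l) * alt_det n z (extend_zero n l)) =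
    (\<Sum>w | w permutes {0..<n}. \<Sum>w' | w' permutes {0..<n}. of_int (sign w * sign w') *
       (if \<forall>i<n - 1. y (w i) * z (w' i) = 1 then of_nat (n + k) ^ (n - 1) else 0))"
proof -
  let ?L = "PiE {..<n - 1} (\<lambda>_. {..<n + k})"
  let ?P = "{w. w permutes {0..<n}}"
  have expand: "alt_det n y (extend_zero n l) * alt_det n z (extend_zero n l) =
     (\<Sum>w\<in>?P. \<Sum>w'\<in>?P. of_int (sign w * sign w') * (\<Prod>i<n - 1. (y (w i) * z (w' i)) ^ l i))" for l
  proof -
    have cut: "(\<Prod>i<n. f i ^ extend_zero n l i) = (\<Prod>i<n - 1. f i ^ l i)" for f :: "nat \<Rightarrow> complex"
    proof -
      have "(\<Prod>i<Suc (n - 1). f i ^ extend_zero n l i) = (\<Prod>i<n - 1. f i ^ l i)"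
        by (simp add: extend_zero_def)
      then show ?thesis using n by simp
    qed
    show ?thesis
      unfolding alt_det_def det_mat_leibniz split cut sum_product
      by (intro sum.cong refl) (simp add: power_mult_distrib prod.distrib mult_ac)
  qed
  have prod: "(\<Sum>l\<in>?L. \<Prod>i<n - 1. (y (w i) * z (w' i)) ^ l i) =
     (if \<forall>i<n - 1. y (w i) * z (w' i) = 1 then of_nat (n + k) ^ (n - 1) else 0)"
    if "w \<in> ?P" "w' \<in> ?P" for w w'
  proof -
    have wi: "w i < n" "w' i < n" if "i < n - 1" for i
      using \<open>w \<in> ?P\<close> \<open>w' \<in> ?P\<close> permutes_in_image[of w "{0..<n}" i] permutes_in_image[of w' "{0..<n}" i] that by auto
    have "(\<Sum>l\<in>?L. \<Prod>i<n - 1. (y (w i) * z (w' i)) ^ l i) = (\<Prod>i<n - 1. \<Sum>a<n + k. (y (w i) * z (w' i)) ^ a)"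
      by (rule prod_sum_PiE[symmetric]) auto
    also have "\<dots> = (\<Prod>i<n - 1. if y (w i) * z (w' i) = 1 then of_nat (n + k) else 0)"
      using wi q by (intro prod.cong refl sum_powers_root_of_unity) auto
    also have "\<dots> = (if \<forall>i<n - 1. y (w i) * z (w' i) = 1 then of_nat (n + k) ^ (n - 1) else 0)"
    proof (cases "\<forall>i<n - 1. y (w i) * z (w' i) = 1")
      case False
      then have "\<exists>i\<in>{..<n - 1}. (if y (w i) * z (w' i) = 1 then of_nat (n + k) else 0) = (0 :: complex)" by auto
      then show ?thesis using False by (subst prod_zero) auto
    qed simp
    finally show ?thesis .
  qed
  have "(\<Sum>l\<in>?L. alt_det n y (extend_zero n l) * alt_det n z (extend_zero n l)) =
    (\<Sum>w\<in>?P. \<Sum>w'\<in>?P. \<Sum>l\<in>?L. of_int (sign w * sign w') * (\<Prod>i<n - 1. (y (w i) * z (w' i)) ^ l i))"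
  proof -
    have swap: "(\<Sum>l\<in>?L. \<Sum>w\<in>?P. \<Sum>w'\<in>?P. f l w w') = (\<Sum>w\<in>?P. \<Sum>w'\<in>?P. \<Sum>l\<in>?L. f l w w')"
      for f :: "(nat \<Rightarrow> nat) \<Rightarrow> (nat \<Rightarrow> nat) \<Rightarrow> (nat \<Rightarrow> nat) \<Rightarrow> complex"
    proof -
      have "(\<Sum>l\<in>?L. \<Sum>w\<in>?P. \<Sum>w'\<in>?P. f l w w') = (\<Sum>w\<in>?P. \<Sum>l\<in>?L. \<Sum>w'\<in>?P. f l w w')" by (rule sum.swap)
      also have "\<dots> = (\<Sum>w\<in>?P. \<Sum>w'\<in>?P. \<Sum>l\<in>?L. f l w w')" by (rule sum.cong[OF refl]) (rule sum.swap)
      finally show ?thesis .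
    qed
    show ?thesis unfolding expand by (rule swap)
  qed
  also have "\<dots> = (\<Sum>w\<in>?P. \<Sum>w'\<in>?P. of_int (sign w * sign w') *
       (if \<forall>i<n - 1. y (w i) * z (w' i) = 1 then of_nat (n + k) ^ (n - 1) else 0))"
    unfolding sum_distrib_left[symmetric] by (intro sum.cong refl) (simp only: prod)
  finally show ?thesis .
qed

lemma cnj_alt_det: "cnj (alt_det n y l) = alt_det n (\<lambda>j. cnj (y j)) l"
  by (simp add: alt_det_def det_mat_leibniz)

lemma bethe_point_cnj: "bethe_point n k sig j * cnj (bethe_point n k sig j) = 1"
  by (simp add: bethe_point_def cis_cnj cis_mult)

lemma zeta_cnj: "zeta n sig * cnj (zeta n sig) = 1"
  by (simp add: zeta_def cis_cnj cis_mult)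

theorem sum_alt_det_partitions:
  assumes n: "n \<ge> 2" and P: "sig \<in> partitions n k" "tau \<in> partitions n k"
  shows "(\<Sum>lam\<in>partitions n k. alt_det n (bethe_point n k sig) (part_heights n lam) *
      cnj (alt_det n (bethe_point n k tau) (part_heights n lam))) =
    (if sig = tau then of_nat n * of_nat (n + k) ^ (n - 1) else 0)"
proof (cases "zeta n sig * cnj (zeta n tau) = 1")
  case False
  then have "sig \<noteq> tau" using zeta_cnj by auto
  moreover have "(\<Sum>lam\<in>partitions n k. alt_det n (bethe_point n k sig) (part_heights n lam) *
      cnj (alt_det n (bethe_point n k tau) (part_heights n lam))) = 
     (\<Sum>m\<in>weights n k. alt_det n (bethe_point n k sig) (heights n m) *
      cnj (alt_det n (bethe_point n k tau) (heights n m)))"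
    by (subst sum.reindex_bij_betw[OF bij_betw_part_of[OF n], symmetric]) (simp only: alt_det_part_of)
  moreover have "\<dots> = 0"
    by (rule sum_alt_det_zero[OF n bethe_roots_bethe_point[OF n P(1)] bethe_roots_bethe_point[OF n P(2)] False])
  ultimately show ?thesis by simp
next
  case True
  define y where "y = bethe_point n k sig"
  define t where "t = bethe_point n k tau"
  define z where "z j = cnj (t j)" for j
  let ?P = "{w. w permutes {0..<n}}"
  have y: "bethe_roots n k y (zeta n sig)" and t: "bethe_roots n k t (zeta n tau)"
    unfolding y_def t_def using bethe_roots_bethe_point n P by auto
  have q: "(y i * z j) ^ (n + k) = 1" if "i < n" "j < n" for i j
  proof -
    have "y i ^ (n + k) = zeta n sig" "t j ^ (n + k) = zeta n tau"
      using y t that by (auto simp: bethe_roots_def)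
    then show ?thesis using True by (simp add: z_def power_mult_distrib flip: complex_cnj_power)
  qed
  have one: "y i * z j = 1 \<longleftrightarrow> y i = t j" for i j
    using bethe_point_cnj[of n k tau j] unfolding z_def t_def by (metis mult_cancel_right mult_zero_right zero_neq_one)
  \<comment> \<open>The geometric sums see only n - 1 of the coordinates; both products being 1
    forces equality in the last.\<close>
  have last: "y (w (n - 1)) = t (w' (n - 1))"
    if w: "w \<in> ?P" "w' \<in> ?P" and eq: "\<forall>i<n - 1. y (w i) = t (w' i)" for w w'
  proof -
    have "(\<Prod>i<n. y (w i)) = (\<Prod>i<n. y i)" "(\<Prod>i<n. t (w' i)) = (\<Prod>i<n. t i)"
      using w prod.permute[of w "{0..<n}" y] prod.permute[of w' "{0..<n}" t]
      by (simp_all add: o_def lessThan_atLeast0)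
    then have "(\<Prod>i<Suc (n - 1). y (w i)) = 1" "(\<Prod>i<Suc (n - 1). t (w' i)) = 1"
      using y t n by (simp_all add: bethe_roots_def)
    moreover have "(\<Prod>i<n - 1. y (w i)) = (\<Prod>i<n - 1. t (w' i))"
      using eq by (intro prod.cong) auto
    ultimately show ?thesis
      by (simp only: prod.lessThan_Suc) (metis mult_cancel_left mult_zero_left zero_neq_one)
  qed
  \<comment> \<open>For different weights no term survives; for equal ones the points are distinct,
    so exactly the n! diagonal pairs of permutations survive.\<close>
  have cond: "(\<forall>i<n - 1. y (w i) * z (w' i) = 1) \<longleftrightarrow> sig = tau \<and> w = w'"
    if w: "w \<in> ?P" "w' \<in> ?P" for w w'
  proof
    assume "\<forall>i<n - 1. y (w i) * z (w' i) = 1"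
    then have eq: "\<forall>i<n - 1. y (w i) = t (w' i)" using one by simp
    have all: "y (w i) = t (w' i)" if "i < n" for i
    proof (cases "i < n - 1")
      case False
      then have "i = n - 1" using that by simp
      then show ?thesis using last[OF w eq] by simp
    qed (use eq in simp)
    then have st: "sig = tau" using bethe_point_inject[OF n P] w unfolding y_def t_def by blast
    have "w i = w' i" for i
    proof (cases "i < n")
      case True
      then have "w i < n" "w' i < n"
        using w permutes_in_image[of w "{0..<n}" i] permutes_in_image[of w' "{0..<n}" i] by auto
      then show ?thesis using all[OF True] y st by (auto simp: bethe_roots_def y_def t_def dest: inj_onD)
    next
      case False
      then show ?thesis using w by (simp add: permutes_not_in)
    qed
    then show "sig = tau \<and> w = w'" using st by auto
  next
    assume "sig = tau \<and> w = w'"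
    then show "\<forall>i<n - 1. y (w i) * z (w' i) = 1" by (simp add: bethe_point_cnj y_def z_def t_def)
  qed
  have "fact (n - 1) * (\<Sum>lam\<in>partitions n k. alt_det n y (part_heights n lam) * alt_det n z (part_heights n lam)) =
    (\<Sum>w\<in>?P. \<Sum>w'\<in>?P. of_int (sign w * sign w') *
       (if \<forall>i<n - 1. y (w i) * z (w' i) = 1 then of_nat (n + k) ^ (n - 1) else 0))"
    unfolding sum_functions_partitions[OF n, symmetric] by (rule sum_functions_eval[of n y z k, OF n q])
  also have "\<dots> = (\<Sum>w\<in>?P. \<Sum>w'\<in>?P. if w = w' then (if sig = tau then of_nat (n + k) ^ (n - 1) else 0) else 0)"
  proof (rule sum.cong[OF refl], rule sum.cong[OF refl])
    fix w w' assume w: "w \<in> ?P" "w' \<in> ?P"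
    show "of_int (sign w * sign w') *
       (if \<forall>i<n - 1. y (w i) * z (w' i) = 1 then of_nat (n + k) ^ (n - 1) else 0) =
      (if w = w' then (if sig = tau then of_nat (n + k) ^ (n - 1) else 0) else (0 :: complex))"
      unfolding cond[OF w] by (auto simp: sign_def)
  qed
  also have "\<dots> = (\<Sum>w\<in>?P. if sig = tau then of_nat (n + k) ^ (n - 1) else 0)"
    by (intro sum.cong refl, subst sum.delta') (auto simp: finite_permutations)
  also have "\<dots> = fact n * (if sig = tau then of_nat (n + k) ^ (n - 1) else 0)"
  proof -
    have "card ?P = fact n" by (rule card_permutations) auto
    then show ?thesis by (simp only: sum_constant of_nat_fact)
  qed
  \<comment> \<open>Of the n! diagonal pairs, the factor (n - 1)! belongs to the ordering of the
    exponents; the remaining n is the one in the normalisation of S.\<close>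
  also have "fact n = (of_nat n * fact (n - 1) :: complex)"
    using n by (simp add: fact_reduce)
  finally have "fact (n - 1) * (\<Sum>lam\<in>partitions n k. alt_det n y (part_heights n lam) * alt_det n z (part_heights n lam))
     = fact (n - 1) * (of_nat n * (if sig = tau then of_nat (n + k) ^ (n - 1) else 0) :: complex)" 
    by (simp only: mult_ac)
  then have "(\<Sum>lam\<in>partitions n k. alt_det n y (part_heights n lam) * alt_det n z (part_heights n lam))
     = of_nat n * (if sig = tau then of_nat (n + k) ^ (n - 1) else 0)"
    by (simp only: mult_cancel_left fact_nonzero) simp
  then show ?thesis by (simp add: cnj_alt_det y_def z_def[abs_def] t_def)
qed

lemma S_const_cnj:
  assumes "n \<ge> 1"
  shows "S_const n k * cnj (S_const n k) = 1 / (of_nat n * of_nat (n + k) ^ (n - 1))"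
proof -
  let ?r = "real n * real (k + n) ^ (n - 1)"
  let ?x = "pi * real n * (real n - 1) / 4"
  have e: "exp (\<i> * of_real ?x) * cnj (exp (\<i> * of_real ?x)) = 1"
    by (simp only: cis_conv_exp[symmetric] cis_cnj cis_mult) simp
  have "S_const n k * cnj (S_const n k) =
    (exp (\<i> * of_real ?x) * cnj (exp (\<i> * of_real ?x))) / (of_real (sqrt ?r) * of_real (sqrt ?r))"
    unfolding S_const_def by (simp only: complex_cnj_divide complex_cnj_complex_of_real) (simp only: times_divide_times_eq)
  also have "\<dots> = 1 / of_real (sqrt ?r * sqrt ?r)" by (simp only: e of_real_mult)
  also have "sqrt ?r * sqrt ?r = ?r" by simp
  finally show ?thesis by (simp add: add.commute)
qed

theorem S_matrix_unitary:
  assumes n: "n \<ge> 2" and P: "sig \<in> partitions n k" "tau \<in> partitions n k"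
  shows "(\<Sum>lam\<in>partitions n k. S_matrix n k lam sig * cnj (S_matrix n k lam tau)) = (if sig = tau then 1 else 0)"
proof -
  have n1: "n \<ge> 1" using n by simp
  have "(\<Sum>lam\<in>partitions n k. S_matrix n k lam sig * cnj (S_matrix n k lam tau)) =
    (S_const n k * cnj (S_const n k)) * (\<Sum>lam\<in>partitions n k. alt_det n (bethe_point n k sig) (part_heights n lam) *
      cnj (alt_det n (bethe_point n k tau) (part_heights n lam)))"
    unfolding sum_distrib_left S_matrix_alt_det[OF n1] by (intro sum.cong refl) (simp add: mult_ac)
  also have "\<dots> = (if sig = tau then 1 else 0)"
    unfolding sum_alt_det_partitions[OF assms] S_const_cnj[OF n1] using n by (simp del: of_nat_add)
  finally show ?thesis .
qed

section \<open>The joint spectrum\<close>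

definition S_functional :: "nat \<Rightarrow> nat \<Rightarrow> (nat \<Rightarrow> nat) \<Rightarrow> (nat \<Rightarrow> nat) \<Rightarrow> complex" where
  "S_functional n k sig m = S_matrix n k (part_of n m) sig"

text \<open>By unitarity these vectors form the basis dual to the functionals
  \<open>S_functional\<close>, and are therefore joint eigenvectors.\<close>

definition S_vector :: "nat \<Rightarrow> nat \<Rightarrow> (nat \<Rightarrow> nat) \<Rightarrow> cvec" where
  "S_vector n k sig = (\<Sum>m\<in>weights n k. scale (cnj (S_functional n k sig m)) (basis_vec m))"

definition eigenvalue :: "nat \<Rightarrow> nat \<Rightarrow> (nat \<Rightarrow> nat) \<Rightarrow> nat \<Rightarrow> complex" where
  "eigenvalue n k sig r = coeff (bethe_poly n k (bethe_point n k sig)) r"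

lemma S_vector_CP: "S_vector n k sig \<in> CP n k"
  unfolding S_vector_def by (intro CP_sum CP_scale CP_basis)

lemma S_functional_alt_det:
  "n \<ge> 2 \<Longrightarrow> S_functional n k sig m = S_const n k * alt_det n (bethe_point n k sig) (heights n m)"
  by (simp add: S_functional_def S_matrix_alt_det alt_det_part_of)

lemma sum_S_functional:
  assumes n: "n \<ge> 2" and "sig \<in> partitions n k" "tau \<in> partitions n k"
  shows "(\<Sum>m\<in>weights n k. S_functional n k sig m * cnj (S_functional n k tau m)) = (if sig = tau then 1 else 0)"
  unfolding S_functional_def
  using sum.reindex_bij_betw[OF bij_betw_part_of[OF n], of "\<lambda>lam. S_matrix n k lam sig * cnj (S_matrix n k lam tau)" k]
    S_matrix_unitary[OF assms] by simp

text \<open>Orthogonality of the rows of S, obtained from that of the columns by symmetry.\<close>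

lemma sum_S_functional_completeness:
  assumes n: "n \<ge> 2" and m: "m \<in> weights n k" "m' \<in> weights n k"
  shows "(\<Sum>sig\<in>partitions n k. S_functional n k sig m * cnj (S_functional n k sig m')) = (if m = m' then 1 else 0)"
proof -
  have P: "part_of n m \<in> partitions n k" "part_of n m' \<in> partitions n k"
    and inj: "part_of n m = part_of n m' \<longleftrightarrow> m = m'"
    using bij_betw_part_of[OF n, of k] m by (auto simp: bij_betw_def inj_on_def)
  have "(\<Sum>sig\<in>partitions n k. S_functional n k sig m * cnj (S_functional n k sig m')) =
    (\<Sum>sig\<in>partitions n k. S_matrix n k sig (part_of n m) * cnj (S_matrix n k sig (part_of n m')))"
    unfolding S_functional_def
    by (simp only: S_matrix_symmetric[of n k "part_of n m"] S_matrix_symmetric[of n k "part_of n m'"])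
  also have "\<dots> = (if m = m' then 1 else 0)"
    unfolding S_matrix_unitary[OF n P] inj ..
  finally show ?thesis .
qed

lemma pairing_CP:
  assumes "v \<in> CP n k"
  shows "pairing \<psi> v = (\<Sum>m\<in>weights n k. Poly_Mapping.lookup v m * \<psi> m)"
  using assms by (intro pairing_superset finite_weights) (simp add: CP_def)

text \<open>Completeness recovers the coefficients of a vector from its pairings, so the functionals
  separate vectors. Operator identities are verified through this.\<close>

lemma CP_eqI:
  assumes n: "n \<ge> 2" and uv: "u \<in> CP n k" "v \<in> CP n k"
    and eq: "\<And>sig. sig \<in> partitions n k \<Longrightarrow> pairing (S_functional n k sig) u = pairing (S_functional n k sig) v"
  shows "u = v"
proof (rule poly_mapping_eqI)
  fix m'
  have lookup: "Poly_Mapping.lookup w m' =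
     (\<Sum>sig\<in>partitions n k. pairing (S_functional n k sig) w * cnj (S_functional n k sig m'))"
    if w: "w \<in> CP n k" and m': "m' \<in> weights n k" for w
  proof -
    have "(\<Sum>sig\<in>partitions n k. pairing (S_functional n k sig) w * cnj (S_functional n k sig m')) =
      (\<Sum>sig\<in>partitions n k. \<Sum>m\<in>weights n k.
         Poly_Mapping.lookup w m * (S_functional n k sig m * cnj (S_functional n k sig m')))"
      unfolding pairing_CP[OF w] sum_distrib_right by (simp only: mult.assoc)
    also have "\<dots> = (\<Sum>m\<in>weights n k. \<Sum>sig\<in>partitions n k.
         Poly_Mapping.lookup w m * (S_functional n k sig m * cnj (S_functional n k sig m')))"
      by (rule sum.swap)
    also have "\<dots> = (\<Sum>m\<in>weights n k. Poly_Mapping.lookup w m * (if m = m' then 1 else 0))"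
      unfolding sum_distrib_left[symmetric]
      by (intro sum.cong refl) (simp only: sum_S_functional_completeness[OF n _ m'])
    also have "\<dots> = Poly_Mapping.lookup w m'"
      using m' by (simp add: if_distrib[of "\<lambda>x. _ * x"] finite_weights cong: if_cong)
    finally show ?thesis ..
  qed
  show "Poly_Mapping.lookup u m' = Poly_Mapping.lookup v m'"
  proof (cases "m' \<in> weights n k")
    case True
    then show ?thesis using lookup[OF uv(1)] lookup[OF uv(2)] eq by simp
  next
    case False
    then show ?thesis using uv by (metis (no_types, lifting) CP_def in_keys_iff mem_Collect_eq subsetD)
  qed
qed

lemma pairing_S_vector: "pairing \<psi> (S_vector n k sig) = (\<Sum>m\<in>weights n k. \<psi> m * cnj (S_functional n k sig m))"
  by (simp add: S_vector_def pairing_sum pairing_scale mult.commute)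

lemma pairing_S_functional_h:
  assumes "n \<ge> 2" "sig \<in> partitions n k" "v \<in> CP n k"
  shows "pairing (S_functional n k sig) (plactic_h n r v) =
    icoeff (bethe_poly n k (bethe_point n k sig)) r * pairing (S_functional n k sig) v"
proof (cases "r < 0")
  case True
  then show ?thesis by (simp add: plactic_h_def icoeff_def)
next
  case False
  then obtain s where s: "r = int s" by (metis nonneg_int_cases not_less)
  have y: "bethe_roots n k (bethe_point n k sig) (zeta n sig)" using assms by (intro bethe_roots_bethe_point)
  show ?thesis
    unfolding s icoeff_def
  proof (simp, rule pairing_plactic_h[OF assms(1,3)])
    fix m assume m: "m \<in> weights n k"
    show "(\<Sum>\<epsilon> | \<epsilon> \<in> moves n m \<and> sum \<epsilon> {..<n} = s. S_functional n k sig (hop n m \<epsilon>)) =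
      coeff (bethe_poly n k (bethe_point n k sig)) s * S_functional n k sig m"
      using alt_det_eigen[OF assms(1) y m, of s]
      by (simp add: S_functional_alt_det assms(1) sum_distrib_left[symmetric])
  qed
qed

text \<open>The alternant of \<open>y\<close> is a joint eigenfunctional and nonzero, since its
  value at the weight of the empty partition is a Vandermonde determinant. So it pairs nontrivially
  with some joint eigenvector, and evaluating the pairing with h_r in two ways equates the
  eigenvalues.\<close>

lemma bethe_poly_spectrum:
  assumes n: "n \<ge> 2" and y: "bethe_roots n k y \<zeta>"
  obtains sig where "sig \<in> partitions n k" "\<And>r. coeff (bethe_poly n k y) r = eigenvalue n k sig r"
proof -
  let ?\<psi> = "\<lambda>m. alt_det n y (heights n m)"
  have "\<exists>sig\<in>partitions n k. pairing ?\<psi> (S_vector n k sig) \<noteq> 0"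
  proof (rule ccontr)
    assume no: "\<not> ?thesis"
    let ?m = "weight_of n k (\<lambda>_. 0)"
    have z: "(\<lambda>_. 0) \<in> partitions n k" by (simp add: partitions_def)
    have part: "part_of n ?m = (\<lambda>_. 0)" using part_of_weight_of[OF n z] .
    have m: "?m \<in> weights n k"
      using bij_betw_part_of[OF n, of k] z part_of_weight_of[OF n z] n
      by (force simp: weights_def weight_of_def sum.last_plus)
    \<comment> \<open>Completeness writes this value as a combination of the pairings with the
      vectors \<open>S_vector\<close>, all of which are assumed to vanish.\<close>
    have "?\<psi> ?m = (\<Sum>m\<in>weights n k. ?\<psi> m * (if ?m = m then 1 else 0))"
      using m by (simp add: if_distrib[of "\<lambda>x. _ * x"] finite_weights cong: if_cong)
    also have "\<dots> = (\<Sum>m\<in>weights n k. \<Sum>sig\<in>partitions n k. ?\<psi> m * (S_functional n k sig ?m * cnj (S_functional n k sig m)))"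
      unfolding sum_distrib_left[symmetric]
      by (intro sum.cong refl) (simp only: sum_S_functional_completeness[OF n m])
    also have "\<dots> = (\<Sum>sig\<in>partitions n k. \<Sum>m\<in>weights n k. ?\<psi> m * (S_functional n k sig ?m * cnj (S_functional n k sig m)))"
      by (rule sum.swap)
    also have "\<dots> = (\<Sum>sig\<in>partitions n k. S_functional n k sig ?m * pairing ?\<psi> (S_vector n k sig))"
      unfolding pairing_S_vector sum_distrib_left by (simp only: mult_ac)
    also have "\<dots> = 0" using no by (intro sum.neutral) auto
    finally have "alt_det n y (part_heights n (part_of n ?m)) = 0"
      by (simp only: alt_det_part_of)
    then have "alt_det n y (part_heights n (\<lambda>_. 0)) = 0" by (simp only: part)
    then have "alt_det n y (\<lambda>i. n - Suc i) = 0" by (simp add: part_heights_def[abs_def])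
    then show False using vandermonde_nonzero y by (auto simp: bethe_roots_def)
  qed
  then obtain sig where sig: "sig \<in> partitions n k" "pairing ?\<psi> (S_vector n k sig) \<noteq> 0" by blast
  have "coeff (bethe_poly n k y) r = eigenvalue n k sig r" for r
  proof -
    have "plactic_h n (int r) (S_vector n k sig) = scale (eigenvalue n k sig r) (S_vector n k sig)"
    proof (rule CP_eqI[OF n])
      fix tau assume tau: "tau \<in> partitions n k"
      show "pairing (S_functional n k tau) (plactic_h n (int r) (S_vector n k sig)) =
        pairing (S_functional n k tau) (scale (eigenvalue n k sig r) (S_vector n k sig))"
        unfolding pairing_S_functional_h[OF n tau S_vector_CP] pairing_scale pairing_S_vector
          sum_S_functional[OF n tau sig(1)]
        by (simp add: icoeff_def eigenvalue_def)
    qed (intro plactic_h_CP n S_vector_CP CP_scale)+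
    moreover have "pairing ?\<psi> (plactic_h n (int r) (S_vector n k sig)) =
      coeff (bethe_poly n k y) r * pairing ?\<psi> (S_vector n k sig)"
      by (rule pairing_plactic_h[OF n S_vector_CP]) (rule alt_det_eigen[OF n y])
    ultimately have "coeff (bethe_poly n k y) r * pairing ?\<psi> (S_vector n k sig) =
      eigenvalue n k sig r * pairing ?\<psi> (S_vector n k sig)"
      by (simp only: pairing_scale)
    then show ?thesis using sig(2) by simp
  qed
  then show thesis using that sig(1) by blast
qed

section \<open>Bethe roots from a factorisation of 1 - \<zeta> t^N\<close>

lemma poly_factor_reciprocal_roots:
  fixes p :: "complex poly"
  assumes "coeff p 0 = 1" "degree p = d"
  obtains y where "p = (\<Prod>j<d. [:1, - y j:])" "\<And>j. j < d \<Longrightarrow> y j \<noteq> 0"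
  using assms
proof (induction d arbitrary: p thesis)
  case 0
  then have "p = 1" by (metis degree_0_id lead_coeff_pCons(1) one_pCons)
  then show ?case using 0(1)[of "\<lambda>_. 1"] by simp
next
  case (Suc d)
  obtain x where x: "poly p x = 0" using alg_closed_imp_poly_has_root[of p] Suc.prems by auto
  then have x0: "x \<noteq> 0" using Suc.prems by (auto simp: poly_0_coeff_0)
  then have "[:1, - (1 / x):] dvd p" using x by (intro linear_factor_dvd) auto
  then obtain q where q: "p = [:1, - (1 / x):] * q" by (rule dvdE)
  have "q \<noteq> 0" using q Suc.prems by auto
  then have "degree p = degree [:1, - (1 / x):] + degree q"
    unfolding q using x0 by (intro degree_mult_eq) auto
  then have "degree q = d" using Suc.prems x0 by simp
  moreover have "coeff q 0 = 1" using Suc.prems(2) unfolding q by (simp add: coeff_mult_0)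
  ultimately obtain y where y: "q = (\<Prod>j<d. [:1, - y j:])" "\<And>j. j < d \<Longrightarrow> y j \<noteq> 0"
    using Suc.IH by blast
  let ?y = "y(d := 1 / x)"
  have "(\<Prod>j<Suc d. [:1, - ?y j:]) = (\<Prod>j<d. [:1, - ?y j:]) * [:1, - (1 / x):]" by simp
  also have "(\<Prod>j<d. [:1, - ?y j:]) = (\<Prod>j<d. [:1, - y j:])" by (intro prod.cong) auto
  finally have "p = (\<Prod>j<Suc d. [:1, - ?y j:])" using q y(1) by (simp only: mult.commute)
  moreover have "?y j \<noteq> 0" if "j < Suc d" for j using y(2) x0 that by auto
  ultimately show ?case by (rule Suc.prems(1))
qed

text \<open>
  The roots are distinct because \<open>1 - \<zeta> t\<^sup>N\<close> is coprime to its derivative.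
\<close>

lemma bethe_rootsI:
  assumes n: "n \<ge> 2" and E: "E * root_poly n y = 1 - Polynomial.monom \<zeta> (n + k)"
    and y: "\<And>j. j < n \<Longrightarrow> y j \<noteq> 0" and lead: "coeff (root_poly n y) n = (-1) ^ n"
  shows "bethe_roots n k y \<zeta>" "E = bethe_poly n k y"
proof -
  let ?R = "root_poly n y" and ?M = "1 - Polynomial.monom \<zeta> (n + k)"
  have pow: "y j ^ (n + k) = \<zeta>" if "j < n" for j
  proof -
    have "poly ?R (1 / y j) = 0"
      unfolding root_poly_def poly_prod using that y by (intro prod_zero bexI[of _ j]) auto
    then have "poly ?M (1 / y j) = 0" unfolding E[symmetric] by simp
    then show ?thesis using y[OF that] by (simp add: poly_monom power_divide field_simps)
  qed
  have "inj_on y {..<n}"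
  proof (rule inj_onI, rule ccontr)
    fix i j assume ij: "i \<in> {..<n}" "j \<in> {..<n}" "y i = y j" "i \<noteq> j"
    let ?L = "[:1, - y i:]"
    have "?R = ?L * (\<Prod>l\<in>{..<n} - {i}. [:1, - y l:])"
      unfolding root_poly_def using ij by (intro prod.remove) auto
    also have "(\<Prod>l\<in>{..<n} - {i}. [:1, - y l:]) = [:1, - y j:] * (\<Prod>l\<in>{..<n} - {i} - {j}. [:1, - y l:])"
      using ij by (intro prod.remove) auto
    finally obtain Q where "?R = ?L * (?L * Q)" using ij(3) by metis
    then have M: "?M = ?L * (?L * (Q * E))" using E by (metis mult.assoc mult.commute)
    have "pderiv ?M = ?L * (pderiv (?L * (Q * E))) + ?L * (Q * E) * pderiv ?L"
      unfolding M by (rule pderiv_mult)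
    then have "poly (pderiv ?M) (1 / y i) = 0" using y[of i] ij by (simp del: mult_pCons_left)
    moreover have "poly (pderiv ?M) (1 / y i) = - (of_nat (n + k) * \<zeta> * (1 / y i) ^ (n + k - 1))"
      by (simp add: pderiv_diff pderiv_monom poly_monom del: of_nat_add)
    moreover have "\<zeta> \<noteq> 0" using pow[of i] y[of i] ij by auto
    ultimately show False using y[of i] ij n by (simp del: of_nat_add)
  qed
  \<comment> \<open>The hypothesis on the top coefficient is the product condition; on the variety
    it comes from the equation h_n = 1.\<close>
  moreover have "(\<Prod>j<n. y j) = 1"
  proof -
    have deg: "degree [:1, - y j:] = 1" if "j < n" for j using y[OF that] by simp
    have "degree ?R = (\<Sum>j<n. degree [:1, - y j:])"
      unfolding root_poly_def by (rule degree_prod_eq_sum_degree) auto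
    then have "degree ?R = n" using deg by simp
    then have "(-1) ^ n = lead_coeff ?R" using lead by simp
    also have "\<dots> = (\<Prod>j<n. lead_coeff [:1, - y j:])" unfolding root_poly_def by (rule lead_coeff_prod)
    also have "\<dots> = (\<Prod>j<n. - 1 * y j)" using y by (intro prod.cong) auto
    also have "\<dots> = (-1) ^ n * (\<Prod>j<n. y j)" by (subst prod.distrib) simp
    finally show ?thesis by simp
  qed
  ultimately show b: "bethe_roots n k y \<zeta>" using pow by (simp add: bethe_roots_def)
  show "E = bethe_poly n k y"
    using bethe_poly_mult[OF n b] E root_poly_nonzero[OF n b] by (metis mult_cancel_right)
qed

section \<open>Schur polynomials on the variety\<close>

definition mono_eval :: "(nat \<Rightarrow> 'r :: comm_ring_1) \<Rightarrow> (nat \<Rightarrow>\<^sub>0 nat) \<Rightarrow> 'r" where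
  "mono_eval f m = (\<Prod>i\<in>Poly_Mapping.keys m. f i ^ Poly_Mapping.lookup m i)"

lemma mono_eval_superset:
  assumes "finite A" "Poly_Mapping.keys m \<subseteq> A"
  shows "mono_eval f m = (\<Prod>i\<in>A. f i ^ Poly_Mapping.lookup m i)"
  unfolding mono_eval_def
  by (rule prod.mono_neutral_left) (use assms in \<open>auto simp: in_keys_iff\<close>)

lemma mono_eval_add: "mono_eval f (a + b) = mono_eval f a * mono_eval f b"
proof -
  let ?A = "Poly_Mapping.keys a \<union> Poly_Mapping.keys b"
  have "Poly_Mapping.keys (a + b) \<subseteq> ?A" by (rule Poly_Mapping.keys_add)
  then show ?thesis
    by (simp add: mono_eval_superset[of ?A] lookup_add power_add prod.distrib)
qed

lemma sum_singles: "(\<Sum>m\<in>Poly_Mapping.keys p. Poly_Mapping.single m (Poly_Mapping.lookup p m)) = p"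
  by (rule poly_mapping_eqI) (auto simp: lookup_sum lookup_single when_def in_keys_iff)

lemma Const_hom: "Const 0 = 0" "Const 1 = 1" "Const (a + b) = Const a + Const b" "Const (a * b) = Const a * Const b"
  by (simp_all add: Const_def single_add mult_single)

context
  fixes emb :: "complex \<Rightarrow> 'r :: comm_ring_1"
  assumes emb: "emb 0 = 0" "emb 1 = 1" "\<And>a b. emb (a + b) = emb a + emb b" "\<And>a b. emb (a * b) = emb a * emb b"
begin

lemma subst_poly_superset:
  assumes "finite A" "Poly_Mapping.keys p \<subseteq> A"
  shows "subst_poly emb f p = (\<Sum>m\<in>A. emb (Poly_Mapping.lookup p m) * mono_eval f m)"
  unfolding subst_poly_def mono_eval_def[symmetric]
  by (rule sum.mono_neutral_left) (use assms emb in \<open>auto simp: in_keys_iff\<close>)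

lemma subst_poly_add: "subst_poly emb f (p + q) = subst_poly emb f p + subst_poly emb f q"
proof -
  let ?A = "Poly_Mapping.keys p \<union> Poly_Mapping.keys q"
  have "Poly_Mapping.keys (p + q) \<subseteq> ?A" by (rule Poly_Mapping.keys_add)
  then show ?thesis
    by (simp add: subst_poly_superset[of ?A] lookup_add emb distrib_right sum.distrib)
qed

lemma subst_poly_zero: "subst_poly emb f 0 = 0"
  by (simp add: subst_poly_def)

lemma subst_poly_single: "subst_poly emb f (Poly_Mapping.single m c) = emb c * mono_eval f m"
  by (subst subst_poly_superset[of "{m}"]) auto

lemma subst_poly_one: "subst_poly emb f 1 = 1"
  using subst_poly_single[of f 0 1] by (simp add: emb mono_eval_def)

lemma subst_poly_sum: "subst_poly emb f (\<Sum>i\<in>I. g i) = (\<Sum>i\<in>I. subst_poly emb f (g i))"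
  by (induction I rule: infinite_finite_induct) (simp_all add: subst_poly_zero subst_poly_add)

lemma subst_poly_mult: "subst_poly emb f (p * q) = subst_poly emb f p * subst_poly emb f q"
proof -
  have expand: "p = (\<Sum>a\<in>Poly_Mapping.keys p. Poly_Mapping.single a (Poly_Mapping.lookup p a))" for p :: cpoly
    by (rule sum_singles[symmetric])
  have "p * q = (\<Sum>a\<in>Poly_Mapping.keys p. \<Sum>b\<in>Poly_Mapping.keys q.
      Poly_Mapping.single (a + b) (Poly_Mapping.lookup p a * Poly_Mapping.lookup q b))"
    by (subst expand[of p], subst expand[of q]) (simp only: sum_product mult_single)
  then have "subst_poly emb f (p * q) = (\<Sum>a\<in>Poly_Mapping.keys p. \<Sum>b\<in>Poly_Mapping.keys q.
      (emb (Poly_Mapping.lookup p a) * mono_eval f a) * (emb (Poly_Mapping.lookup q b) * mono_eval f b))"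
    by (simp add: subst_poly_sum subst_poly_single emb mono_eval_add mult_ac)
  then show ?thesis by (simp add: sum_product subst_poly_def mono_eval_def)
qed

lemma subst_poly_prod: "subst_poly emb f (\<Prod>i\<in>I. g i) = (\<Prod>i\<in>I. subst_poly emb f (g i))"
  by (induction I rule: infinite_finite_induct) (simp_all add: subst_poly_one subst_poly_mult)

lemma subst_poly_power: "subst_poly emb f (p ^ r) = subst_poly emb f p ^ r"
  by (induction r) (simp_all add: subst_poly_one subst_poly_mult)

lemma subst_poly_minus: "subst_poly emb f (- p) = - subst_poly emb f p"
  using subst_poly_add[of f p "- p"] by (simp add: subst_poly_zero eq_neg_iff_add_eq_0 add.commute)

lemma subst_poly_diff: "subst_poly emb f (p - q) = subst_poly emb f p - subst_poly emb f q"
  using subst_poly_add[of f p "- q"] by (simp add: subst_poly_minus)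

lemma subst_poly_Const: "subst_poly emb f (Const c) = emb c"
  by (simp add: Const_def subst_poly_single mono_eval_def)

lemma subst_poly_Var: "subst_poly emb f (Var i) = f i"
  by (simp add: Var_def subst_poly_single emb mono_eval_def)

lemma subst_poly_det: "subst_poly emb f (det (mat r r (\<lambda>(i, j). g i j))) = det (mat r r (\<lambda>(i, j). subst_poly emb f (g i j)))"
proof -
  have "subst_poly emb f (of_int (sign p)) = of_int (sign p)" for p :: "nat \<Rightarrow> nat"
    by (simp add: sign_def subst_poly_one subst_poly_minus)
  then show ?thesis by (simp add: det_mat_leibniz subst_poly_sum subst_poly_mult subst_poly_prod)
qed

end

lemmas eval_poly_simps =
  subst_poly_zero[of "\<lambda>c. c"] subst_poly_one[of "\<lambda>c. c"] subst_poly_add[of "\<lambda>c. c"] subst_poly_mult[of "\<lambda>c. c"]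
  subst_poly_diff[of "\<lambda>c. c"] subst_poly_Const[of "\<lambda>c. c"] subst_poly_Var[of "\<lambda>c. c"]
  subst_poly_det[of "\<lambda>c. c"] subst_poly_sum[of "\<lambda>c. c"] subst_poly_prod[of "\<lambda>c. c"] subst_poly_power[of "\<lambda>c. c"]

lemmas from_e_simps =
  subst_poly_zero[OF Const_hom] subst_poly_one[OF Const_hom] subst_poly_Var[OF Const_hom] subst_poly_det[OF Const_hom]

lemma eval_poly_from_e: "eval_poly x (from_e k F) = eval_poly (\<lambda>i. eval_poly x (elem_x k i)) F"
proof -
  have "eval_poly x (from_e k F) = (\<Sum>m\<in>Poly_Mapping.keys F. Poly_Mapping.lookup F m *
    (\<Prod>i\<in>Poly_Mapping.keys m. eval_poly x (elem_x k i) ^ Poly_Mapping.lookup m i))"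
    unfolding from_e_def subst_poly_def[of Const] by (simp add: eval_poly_simps)
  then show ?thesis by (simp add: subst_poly_def[of "\<lambda>c. c" _ F])
qed

lemma eval_poly_cong:
  assumes "F \<in> polys k" "\<And>i. i \<in> {1..k} \<Longrightarrow> v i = w i"
  shows "eval_poly v F = eval_poly w F"
  unfolding subst_poly_def
proof (intro sum.cong refl arg_cong2[where f = "(*)"] prod.cong arg_cong2[where f = "(^)"])
  fix m i assume "m \<in> Poly_Mapping.keys F" "i \<in> Poly_Mapping.keys m"
  then have "i \<in> {1..k}" using assms(1) unfolding polys_def by blast
  then show "v i = w i" by (rule assms(2))
qed

lemma polys_closed:
  "0 \<in> polys k" "1 \<in> polys k" "Const c \<in> polys k" "i \<in> {1..k} \<Longrightarrow> Var i \<in> polys k"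
  "p \<in> polys k \<Longrightarrow> - p \<in> polys k"
  by (auto simp: polys_def Const_def Var_def split: if_splits)

lemma polys_add: "p \<in> polys k \<Longrightarrow> q \<in> polys k \<Longrightarrow> p + q \<in> polys k"
  using Poly_Mapping.keys_add[of p q] by (auto simp: polys_def)

lemma polys_mult:
  assumes "p \<in> polys k" "q \<in> polys k"
  shows "p * q \<in> polys k"
  unfolding polys_def
proof (intro CollectI ballI)
  fix m assume "m \<in> Poly_Mapping.keys (p * q)"
  then obtain a b where "m = a + b" "a \<in> Poly_Mapping.keys p" "b \<in> Poly_Mapping.keys q"
    using keys_mult[of p q] by blast
  then show "Poly_Mapping.keys m \<subseteq> {1..k}"
    using assms Poly_Mapping.keys_add[of a b] unfolding polys_def by blast
qed

lemma polys_sum: "(\<And>i. i \<in> I \<Longrightarrow> f i \<in> polys k) \<Longrightarrow> (\<Sum>i\<in>I. f i) \<in> polys k"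
  by (induction I rule: infinite_finite_induct) (auto simp: polys_closed polys_add)

lemma polys_prod: "(\<And>i. i \<in> I \<Longrightarrow> f i \<in> polys k) \<Longrightarrow> (\<Prod>i\<in>I. f i) \<in> polys k"
  by (induction I rule: infinite_finite_induct) (auto simp: polys_closed polys_mult)

lemma polys_det:
  assumes "\<And>i j. i < r \<Longrightarrow> j < r \<Longrightarrow> g i j \<in> polys k"
  shows "det (mat r r (\<lambda>(i, j). g i j)) \<in> polys k"
  unfolding det_mat_leibniz split
proof (intro polys_sum polys_mult polys_prod)
  fix p :: "nat \<Rightarrow> nat"
  show "of_int (sign p) \<in> polys k" by (simp add: sign_def polys_closed)
  fix i assume "p \<in> {p. p permutes {0..<r}}" "i \<in> {..<r}"
  then show "g i (p i) \<in> polys k" using permutes_in_image[of p "{0..<r}" i] by (intro assms) auto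
qed

lemma polys_elem_e: "elem_e k r \<in> polys k"
  unfolding elem_e_def by (auto intro!: polys_closed)

lemma from_e_elem_e: "from_e k (elem_e k r) = iesym k Var r"
proof -
  have x: "elem_x k s = esym k Var s" for s by (simp add: elem_x_def esym_def)
  consider "r < 0" | "r = 0" | "1 \<le> r" "r \<le> int k" | "r > int k" by linarith
  then show ?thesis
    by cases (auto simp: elem_e_def from_e_def from_e_simps iesym_def esym_0 esym_eq_0 x)
qed

section \<open>Schur polynomials in the coordinates e\<close>

text \<open>The dual Jacobi-Trudi expression for the Schur polynomial of the transposed partition,
  an explicit polynomial in the e_i that stands in for \<open>schur_e\<close>.\<close>

definition dual_jt_poly :: "nat \<Rightarrow> nat \<Rightarrow> (nat \<Rightarrow> nat) \<Rightarrow> cpoly" where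
  "dual_jt_poly n k lam = det (mat (n - 1) (n - 1) (\<lambda>(i, j). elem_e k (int (lam (i + 1)) - int i + int j)))"

lemma polys_dual_jt_poly: "dual_jt_poly n k lam \<in> polys k"
  unfolding dual_jt_poly_def by (intro polys_det polys_elem_e)

lemma from_e_dual_jt_poly:
  "from_e k (dual_jt_poly n k lam) = det (mat (n - 1) (n - 1) (\<lambda>(i, j). iesym k Var (int (lam (i + 1)) - int i + int j)))"
  unfolding dual_jt_poly_def from_e_elem_e[symmetric] unfolding from_e_def by (rule from_e_simps)

lemma alternant_transpose_part:
  assumes "lam \<in> partitions n k"
  shows "from_e k (dual_jt_poly n k lam) * alternant k (\<lambda>_. 0) = alternant k (transpose_part lam)"
proof -
  have "lam i \<le> k" for i
    using assms by (cases "i = 0") (auto simp: partitions_def intro: order_trans[of "lam i" "lam 1" k])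
  then show ?thesis
    unfolding from_e_dual_jt_poly alternant_def
    by (subst dual_jacobi_trudi[of lam k "n - 1" Var]) (use assms in \<open>auto simp: partitions_def\<close>)
qed

lemma alternant_zero_nonzero: "alternant k (\<lambda>_. 0) \<noteq> 0"
proof
  \<comment> \<open>Any distinct numbers would do: evaluation at 1, ..., k gives a numerical
    Vandermonde determinant.\<close>
  let ?x = "\<lambda>i. of_nat i :: complex"
  let ?A = "mat k k (\<lambda>(i, j). ?x (i + 1) ^ (k - (j + 1)))"
  assume "alternant k (\<lambda>_. 0) = 0"
  then have "eval_poly ?x (alternant k (\<lambda>_. 0)) = 0" by (simp add: eval_poly_simps)
  moreover have "eval_poly ?x (alternant k (\<lambda>_. 0)) = det ?A"
    unfolding alternant_def by (simp add: eval_poly_simps)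
  moreover have "det ?A = det (?A\<^sup>T)" by (rule det_transpose[of _ k, symmetric]) simp
  moreover have "?A\<^sup>T = mat k k (\<lambda>(i, j). ?x (j + 1) ^ (k - Suc i))" by (rule eq_matI) auto
  ultimately have "alt_det k (\<lambda>j. ?x (j + 1)) (\<lambda>i. k - Suc i) = 0" by (simp add: alt_det_def)
  then show False
    using vandermonde_nonzero[of "\<lambda>j. ?x (j + 1)" k] by (simp add: inj_on_def del: of_nat_Suc of_nat_add)
qed

text \<open>The description in \<open>schur_x\<close> is met by the dual Jacobi-Trudi formula, and
  uniquely so because the denominator is nonzero in an integral domain.\<close>

lemma schur_x_transpose_part:
  assumes "lam \<in> partitions n k"
  shows "schur_x k (transpose_part lam) = from_e k (dual_jt_poly n k lam)"
  unfolding schur_x_def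
proof (rule the_equality)
  show "from_e k (dual_jt_poly n k lam) * alternant k (\<lambda>_. 0) = alternant k (transpose_part lam)"
    by (rule alternant_transpose_part[OF assms])
  fix s assume "s * alternant k (\<lambda>_. 0) = alternant k (transpose_part lam)"
  then have "s * alternant k (\<lambda>_. 0) = from_e k (dual_jt_poly n k lam) * alternant k (\<lambda>_. 0)"
    by (simp only: alternant_transpose_part[OF assms])
  then show "s = from_e k (dual_jt_poly n k lam)"
    using alternant_zero_nonzero by (metis mult_right_cancel)
qed

text \<open>\<open>inv_into\<close> selects some preimage under \<open>from_e\<close>; it is used
  only through its image, which is that of \<open>dual_jt_poly\<close>.\<close>

lemma schur_e_transpose_part:
  assumes "lam \<in> partitions n k"
  shows "schur_e k (transpose_part lam) \<in> polys k"
    and "from_e k (schur_e k (transpose_part lam)) = from_e k (dual_jt_poly n k lam)"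
proof -
  have "schur_x k (transpose_part lam) \<in> from_e k ` polys k"
    using schur_x_transpose_part[OF assms] polys_dual_jt_poly by blast
  then show "schur_e k (transpose_part lam) \<in> polys k"
    "from_e k (schur_e k (transpose_part lam)) = from_e k (dual_jt_poly n k lam)"
    unfolding schur_e_def schur_x_transpose_part[OF assms, symmetric]
    by (rule inv_into_into, rule f_inv_into_f)
qed

text \<open>The polynomial 1 + v_1 t + ... + v_k t^k splits into factors 1 + x_i t over the complex
  numbers.\<close>

lemma ex_esym_eq:
  fixes v :: "nat \<Rightarrow> complex"
  obtains x where "\<And>i. i \<in> {1..k} \<Longrightarrow> esym k x i = v i"
proof -
  let ?p = "1 + (\<Sum>i=1..k. Polynomial.monom (v i) i)"
  have coeff: "coeff ?p i = (if i = 0 then 1 else if i \<le> k then v i else 0)" for i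
    by (simp add: coeff_sum)
  have deg: "degree ?p \<le> k" by (rule degree_le) (simp only: coeff, simp)
  obtain y where y: "?p = (\<Prod>j<degree ?p. [:1, - y j:])"
    using poly_factor_reciprocal_roots[of ?p "degree ?p"] coeff[of 0] by auto
  \<comment> \<open>If the degree is below \<open>k\<close>, the missing coordinates are 0 and
    contribute factors 1.\<close>
  let ?x = "\<lambda>i. if i \<le> degree ?p then - y (i - 1) else 0"
  have "(\<Prod>i=1..k. [:1, ?x i:]) = (\<Prod>i=1..degree ?p. [:1, ?x i:])"
    by (rule prod.mono_neutral_right) (use deg in \<open>auto simp: one_pCons\<close>)
  also have "\<dots> = (\<Prod>j<degree ?p. [:1, - y j:])"
    by (rule prod.reindex_bij_witness[of _ Suc "\<lambda>i. i - 1"]) auto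
  finally have "(\<Prod>i=1..k. [:1, ?x i:]) = ?p" using y by simp
  then have "esym k ?x i = v i" if "i \<in> {1..k}" for i
    using coeff[of i] that coeff_prod_one_plus[of ?x k i] by auto
  then show thesis by (rule that)
qed

lemma eval_elem_x: "eval_poly x (elem_x k r) = esym k x r"
  by (simp add: elem_x_def esym_def eval_poly_simps)

text \<open>
  Every point of \<open>\<complex>\<^sup>k\<close> is the vector of elementary symmetric functions of some \<open>x\<close>, so polynomials
  with the same image under \<open>from_e\<close> have the same values.
\<close>

lemma eval_schur_e_transpose_part:
  assumes "lam \<in> partitions n k"
  shows "eval_poly v (schur_e k (transpose_part lam)) = eval_poly v (dual_jt_poly n k lam)"
proof -
  obtain x where x: "\<And>i. i \<in> {1..k} \<Longrightarrow> esym k x i = v i" using ex_esym_eq by blast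
  have "eval_poly v F = eval_poly x (from_e k F)" if "F \<in> polys k" for F
    unfolding eval_poly_from_e eval_elem_x using that x by (intro eval_poly_cong[of _ k]) auto
  then show ?thesis using schur_e_transpose_part[OF assms] polys_dual_jt_poly by simp
qed

section \<open>The points of the variety\<close>

text \<open>The coordinate e_i takes the eigenvalue of h_i(A). This exchange of complete and
  elementary functions is the origin of the transposition in the isomorphism.\<close>

definition variety_point :: "nat \<Rightarrow> nat \<Rightarrow> (nat \<Rightarrow> nat) \<Rightarrow> nat \<Rightarrow> complex" where
  "variety_point n k sig i = (if i \<in> {1..k} then eigenvalue n k sig i else 0)"

lemma eval_elem_e:
  "eval_poly v (elem_e k r) = (if r = 0 then 1 else if 1 \<le> r \<and> r \<le> int k then v (nat r) else 0)"
  by (simp add: elem_e_def eval_poly_simps)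

lemma eval_elem_e_variety_point:
  assumes "n \<ge> 2" "sig \<in> partitions n k"
  shows "eval_poly (variety_point n k sig) (elem_e k r) = icoeff (bethe_poly n k (bethe_point n k sig)) r"
proof -
  note y = bethe_roots_bethe_point[OF assms]
  have "coeff (bethe_poly n k (bethe_point n k sig)) s = 0" if "s > k" for s
    using that degree_bethe_poly[OF assms(1) y] by (simp add: coeff_eq_0)
  moreover have "coeff (bethe_poly n k (bethe_point n k sig)) 0 = 1"
    by (rule coeff_bethe_poly_0[OF assms(1) y])
  ultimately show ?thesis
    by (auto simp: eval_elem_e icoeff_def variety_point_def eigenvalue_def nat_le_iff not_le)
qed

lemma eval_dual_jt_poly_variety_point:
  assumes "n \<ge> 2" "sig \<in> partitions n k"
  shows "eval_poly (variety_point n k sig) (dual_jt_poly n k lam) =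
    det (mat (n - 1) (n - 1) (\<lambda>(i, j). icoeff (bethe_poly n k (bethe_point n k sig)) (int (lam (i + 1)) - int i + int j)))"
  unfolding dual_jt_poly_def by (simp add: eval_poly_simps eval_elem_e_variety_point[OF assms])

text \<open>The relation E(t) H(-t) = 1 is required only up to degree \<open>r\<close>, so
  \<open>h\<close> may be any sequence satisfying it that far, such as the signed coefficients of
  \<open>root_poly\<close>.\<close>

lemma eval_complete_e:
  fixes v :: "nat \<Rightarrow> complex" and k :: nat
  defines "e \<equiv> \<lambda>i. if i = 0 then 1 else if i \<le> k then v i else 0"
  assumes "\<And>s. s \<le> r \<Longrightarrow> (\<Sum>i\<le>s. e i * ((-1) ^ (s - i) * h (s - i))) = (if s = 0 then 1 else 0)"
  shows "eval_poly v (complete_e k r) = h r"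
proof -
  have "eval_poly v (complete_e k r) = det (mat r r (\<lambda>(i, j). eval_poly v (elem_e k (1 - int i + int j))))"
    unfolding complete_e_def by (simp add: eval_poly_simps)
  also have "mat r r (\<lambda>(i, j). eval_poly v (elem_e k (1 - int i + int j))) =
    mat r r (\<lambda>(i, j). if i \<le> Suc j then e (Suc j - i) else 0)"
  proof (rule eq_matI)
    fix i j assume "i < dim_row (mat r r (\<lambda>(i, j). if i \<le> Suc j then e (Suc j - i) else 0))"
      "j < dim_col (mat r r (\<lambda>(i, j). if i \<le> Suc j then e (Suc j - i) else 0))"
    then have ij: "i < r" "j < r" by auto
    have "eval_poly v (elem_e k (1 - int i + int j)) = (if i \<le> Suc j then e (Suc j - i) else 0)"
    proof (cases "i \<le> Suc j")
      case True
      define d where "d = Suc j - i"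
      have "1 - int i + int j = int d" using True by (simp add: d_def)
      moreover have "eval_poly v (elem_e k (int d)) = e d" by (simp add: eval_elem_e e_def)
      ultimately show ?thesis using True by (simp only: d_def if_True)
    qed (auto simp: eval_elem_e)
    then show "mat r r (\<lambda>(i, j). eval_poly v (elem_e k (1 - int i + int j))) $$ (i, j) =
      mat r r (\<lambda>(i, j). if i \<le> Suc j then e (Suc j - i) else 0) $$ (i, j)"
      using ij by simp
  qed auto
  also have "det \<dots> = h r"
    by (rule det_hessenberg_toeplitz) (use assms in auto)
  finally show ?thesis .
qed

lemma ex_complete:
  fixes e :: "nat \<Rightarrow> complex"
  assumes "e 0 = 1"
  obtains h where "\<And>s. s \<le> r \<Longrightarrow> (\<Sum>i\<le>s. e i * ((-1) ^ (s - i) * h (s - i))) = (if s = 0 then 1 else 0)"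
proof -
  have "\<exists>h. \<forall>s\<le>r. (\<Sum>i\<le>s. e i * ((-1) ^ (s - i) * h (s - i))) = (if s = 0 then 1 else 0)"
  proof (induction r)
    case 0
    then show ?case using assms by (intro exI[of _ "\<lambda>_. 1"]) simp
  next
    case (Suc r)
    then obtain h where h: "\<forall>s\<le>r. (\<Sum>i\<le>s. e i * ((-1) ^ (s - i) * h (s - i))) = (if s = 0 then 1 else 0)" by blast
    let ?S = "\<Sum>i=1..Suc r. e i * ((-1) ^ (Suc r - i) * h (Suc r - i))"
    let ?h = "h(Suc r := - ((-1) ^ Suc r * ?S))"
    have "(\<Sum>i\<le>s. e i * ((-1) ^ (s - i) * ?h (s - i))) = (if s = 0 then 1 else 0)" if "s \<le> Suc r" for s
    proof (cases "s = Suc r")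
      case True
      have "(\<Sum>i\<le>Suc r. e i * ((-1) ^ (Suc r - i) * ?h (Suc r - i))) =
        (-1) ^ Suc r * ?h (Suc r) + (\<Sum>i=1..Suc r. e i * ((-1) ^ (Suc r - i) * ?h (Suc r - i)))"
      proof -
        have "(\<Sum>i\<le>Suc r. F i) = F 0 + (\<Sum>i=1..Suc r. F i)" for F :: "nat \<Rightarrow> complex"
        proof -
          have "{..Suc r} = insert 0 {1..Suc r}" by auto
          then show ?thesis by (simp only:) (subst sum.insert, auto)
        qed
        then show ?thesis by (simp only: assms mult_1_left diff_zero)
      qed
      also have "(\<Sum>i=1..Suc r. e i * ((-1) ^ (Suc r - i) * ?h (Suc r - i))) = ?S"
        by (intro sum.cong) auto
      also have "(-1) ^ Suc r * ?h (Suc r) = - ?S"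
      proof -
        have "(-1) ^ Suc r * ((-1) ^ Suc r * ?S) = ?S"
          by (simp only: mult.assoc[symmetric] power_add[symmetric] mult_2[symmetric]) simp
        then show ?thesis by (simp only: fun_upd_same mult_minus_right)
      qed
      finally show ?thesis using True by simp
    next
      case False
      then have "(\<Sum>i\<le>s. e i * ((-1) ^ (s - i) * ?h (s - i))) = (\<Sum>i\<le>s. e i * ((-1) ^ (s - i) * h (s - i)))"
        using that by (intro sum.cong) auto
      then show ?thesis using h False that by simp
    qed
    then show ?case by blast
  qed
  then show thesis using that by blast
qed

text \<open>The product of E with \<open>root_poly\<close> is 1 up to degree N - 1, so below N the
  complete functions are the signed coefficients of \<open>root_poly\<close>. Its degree n gives the
  vanishing above n, and its leading coefficient gives h_n = 1.\<close>

lemma variety_point_in_variety: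
  assumes n: "n \<ge> 2" "k \<ge> 1" and sig: "sig \<in> partitions n k"
  shows "variety_point n k sig \<in> variety n k"
proof -
  let ?y = "bethe_point n k sig" and ?v = "variety_point n k sig"
  let ?E = "bethe_poly n k ?y" and ?R = "root_poly n ?y"
  note y = bethe_roots_bethe_point[OF n(1) sig]
  have e: "(if i = 0 then 1 else if i \<le> k then ?v i else 0) = coeff ?E i" for i
    using coeff_bethe_poly_0[OF n(1) y] degree_bethe_poly[OF n(1) y]
    by (auto simp: variety_point_def eigenvalue_def coeff_eq_0)
  have complete: "eval_poly ?v (complete_e k r) = (-1) ^ r * coeff ?R r" if r: "r < n + k" for r
  proof (rule eval_complete_e, unfold e)
    fix s assume s: "s \<le> r"
    have "(\<Sum>i\<le>s. coeff ?E i * ((-1) ^ (s - i) * ((-1) ^ (s - i) * coeff ?R (s - i)))) =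
      (\<Sum>i\<le>s. coeff ?E i * coeff ?R (s - i))"
      by (intro sum.cong refl) (simp add: mult.assoc[symmetric] power_add[symmetric] mult_2[symmetric])
    also have "\<dots> = coeff (?E * ?R) s" by (simp only: coeff_mult)
    also have "\<dots> = (if s = 0 then 1 else 0)"
      using s r by (simp add: bethe_poly_mult[OF n(1) y])
    finally show "(\<Sum>i\<le>s. coeff ?E i * ((-1) ^ (s - i) * ((-1) ^ (s - i) * coeff ?R (s - i)))) = (if s = 0 then 1 else 0)" .
  qed
  have "coeff ?R n = (-1) ^ n"
    using degree_root_poly[OF n(1) y] lead_coeff_root_poly[OF n(1) y] by simp
  then have "eval_poly ?v (complete_e k n) = 1"
    using complete[of n] n by (simp add: power_add[symmetric] mult_2[symmetric])
  moreover have "eval_poly ?v (complete_e k r) = 0" if "r \<in> {n + 1..n + k - 1}" for r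
  proof -
    have "r < n + k" "n < r" using that n by auto
    then show ?thesis using complete[of r] degree_root_poly[OF n(1) y] by (simp add: coeff_eq_0)
  qed
  ultimately show ?thesis by (simp add: variety_def variety_point_def eval_poly_simps)
qed

lemma variety_subset:
  assumes n: "n \<ge> 2" "k \<ge> 1" and v: "v \<in> variety n k"
  obtains sig where "sig \<in> partitions n k" "v = variety_point n k sig"
proof -
  define e where "e i = (if i = 0 then 1 else if i \<le> k then v i else 0)" for i
  obtain h where h: "\<And>s. s \<le> n + k \<Longrightarrow> (\<Sum>i\<le>s. e i * ((-1) ^ (s - i) * h (s - i))) = (if s = 0 then 1 else 0)"
    using ex_complete[of e "n + k"] by (auto simp: e_def)
  have hr: "eval_poly v (complete_e k r) = h r" if "r \<le> n + k" for r
    using h that unfolding e_def by (intro eval_complete_e) auto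
  have hn: "h n = 1" using v hr[of n] by (simp add: variety_def eval_poly_simps)
  have h0: "h r = 0" if "n < r" "r < n + k" for r
  proof -
    have "r \<in> {n + 1..n + k - 1}" using that by auto
    then show ?thesis using v hr[of r] that by (simp add: variety_def del: atLeastAtMost_iff)
  qed
  let ?E = "\<Sum>i\<le>k. Polynomial.monom (e i) i"
  let ?H = "\<Sum>s\<le>n. Polynomial.monom ((-1) ^ s * h s) s"
  have cE: "coeff ?E i = e i" for i by (simp add: coeff_sum e_def)
  have cH: "coeff ?H i = (if i \<le> n then (-1) ^ i * h i else 0)" for i by (simp add: coeff_sum)
  have degE: "degree ?E \<le> k" by (rule degree_le) (simp only: cE, simp add: e_def)
  have degH: "degree ?H = n"
    by (intro antisym degree_le le_degree allI impI) (simp_all only: cH, simp_all add: hn)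
  \<comment> \<open>The defining equations leave the coefficient in degree \<open>n + k\<close>
    free; it defines \<zeta>.\<close>
  let ?z = "- coeff (?E * ?H) (n + k)"
  have EH: "?E * ?H = 1 - Polynomial.monom ?z (n + k)"
  proof (rule poly_eqI)
    fix s
    consider "s < n + k" | "s = n + k" | "s > n + k" by linarith
    then show "coeff (?E * ?H) s = coeff (1 - Polynomial.monom ?z (n + k)) s"
    proof cases
      case 1
      have "coeff (?E * ?H) s = (\<Sum>i\<le>s. e i * ((-1) ^ (s - i) * h (s - i)))"
        unfolding coeff_mult cE cH using 1 h0 by (intro sum.cong refl) auto
      then show ?thesis using h[of s] 1 by simp
    next
      case 2
      then show ?thesis using n by simp
    next
      case 3
      have "degree (?E * ?H) \<le> k + n"
        by (rule order_trans[OF degree_mult_le]) (intro add_mono degE, simp add: degH)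
      then show ?thesis using 3 by (simp add: coeff_eq_0)
    qed
  qed
  have "coeff ?H 0 = 1" using h[of 0] by (simp only: cH) (simp add: e_def)
  then obtain y where y: "?H = (\<Prod>j<n. [:1, - y j:])" "\<And>j. j < n \<Longrightarrow> y j \<noteq> 0"
    using poly_factor_reciprocal_roots[OF _ degH] by blast
  have R: "root_poly n y = ?H" using y by (simp only: root_poly_def)
  have "coeff (root_poly n y) n = (-1) ^ n" unfolding R cH by (simp add: hn)
  from bethe_rootsI[OF n(1) EH[folded R] y(2) this]
  have "bethe_roots n k y (- coeff (?E * root_poly n y) (n + k))" "?E = bethe_poly n k y"
    unfolding R by auto
  then obtain sig where sig: "sig \<in> partitions n k" "\<And>r. coeff ?E r = eigenvalue n k sig r"
    using bethe_poly_spectrum[OF n(1)] by metis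
  have "v i = variety_point n k sig i" for i
    using v sig(2)[of i] by (simp only: cE) (auto simp: variety_def variety_point_def e_def split: if_splits)
  then show thesis using that sig(1) by blast
qed

lemma vanishing_ideal_variety:
  assumes "n \<ge> 2" "k \<ge> 1"
  shows "vanishing_ideal k (variety n k) = {f \<in> polys k. \<forall>sig\<in>partitions n k. eval_poly (variety_point n k sig) f = 0}"
  unfolding vanishing_ideal_def
  using variety_point_in_variety[OF assms] variety_subset[OF assms] by (metis (lifting))

section \<open>The isomorphism and the fusion rule\<close>

text \<open>The isomorphism as a relation: the eigenvalue of \<open>f\<close> on the functional of
  each weight is the value of \<open>p\<close> at the corresponding point. Algebra operations are
  compared before any choice of representatives.\<close>

definition represents :: "nat \<Rightarrow> nat \<Rightarrow> (cvec \<Rightarrow> cvec) \<Rightarrow> cpoly \<Rightarrow> bool" where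
  "represents n k f p \<longleftrightarrow> f \<in> carrier (End_alg n k) \<and> p \<in> polys k \<and>
     (\<forall>sig\<in>partitions n k. \<forall>v\<in>CP n k. pairing (S_functional n k sig) (f v) =
        eval_poly (variety_point n k sig) p * pairing (S_functional n k sig) v)"

text \<open>Congruence modulo the vanishing ideal for polynomials in \<open>polys k\<close>,
  expressed through the parametrised points.\<close>

definition same_values :: "nat \<Rightarrow> nat \<Rightarrow> cpoly \<Rightarrow> cpoly \<Rightarrow> bool" where
  "same_values n k p q \<longleftrightarrow>
     (\<forall>sig\<in>partitions n k. eval_poly (variety_point n k sig) p = eval_poly (variety_point n k sig) q)"

section \<open>The endomorphism algebra\<close>

lemma End_alg_simps:
  "carrier (End_alg n k) = {f \<in> CP n k \<rightarrow>\<^sub>E CP n k.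
        (\<forall>u\<in>CP n k. \<forall>v\<in>CP n k. f (u + v) = f u + f v) \<and>
        (\<forall>c. \<forall>v\<in>CP n k. f (scale c v) = scale c (f v))}"
  "f \<otimes>\<^bsub>End_alg n k\<^esub> g = compose (CP n k) f g"
  "\<one>\<^bsub>End_alg n k\<^esub> = (\<lambda>v\<in>CP n k. v)"
  "\<zero>\<^bsub>End_alg n k\<^esub> = (\<lambda>v\<in>CP n k. 0)"
  "f \<oplus>\<^bsub>End_alg n k\<^esub> g = (\<lambda>v\<in>CP n k. f v + g v)"
  "c \<odot>\<^bsub>End_alg n k\<^esub> f = (\<lambda>v\<in>CP n k. scale c (f v))"
  by (simp_all add: End_alg_def)

lemma End_algD:
  assumes "f \<in> carrier (End_alg n k)"
  shows "v \<in> CP n k \<Longrightarrow> f v \<in> CP n k" "f \<in> extensional (CP n k)"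
    "u \<in> CP n k \<Longrightarrow> v \<in> CP n k \<Longrightarrow> f (u + v) = f u + f v"
    "v \<in> CP n k \<Longrightarrow> f (scale c v) = scale c (f v)"
  using assms by (auto simp: End_alg_simps PiE_def)

lemma End_algI:
  assumes "\<And>v. v \<in> CP n k \<Longrightarrow> f v \<in> CP n k"
    "\<And>u v. u \<in> CP n k \<Longrightarrow> v \<in> CP n k \<Longrightarrow> f (u + v) = f u + f v"
    "\<And>c v. v \<in> CP n k \<Longrightarrow> f (scale c v) = scale c (f v)"
  shows "restrict f (CP n k) \<in> carrier (End_alg n k)"
  using assms by (auto simp: End_alg_simps CP_add CP_scale)

lemma End_alg_closed:
  assumes f: "f \<in> carrier (End_alg n k)" and g: "g \<in> carrier (End_alg n k)"
  shows "f \<otimes>\<^bsub>End_alg n k\<^esub> g \<in> carrier (End_alg n k)" "f \<oplus>\<^bsub>End_alg n k\<^esub> g \<in> carrier (End_alg n k)"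
    "c \<odot>\<^bsub>End_alg n k\<^esub> f \<in> carrier (End_alg n k)"
proof -
  show "f \<otimes>\<^bsub>End_alg n k\<^esub> g \<in> carrier (End_alg n k)"
    unfolding End_alg_simps(2) compose_def
    by (rule End_algI) (simp_all add: End_algD[OF f] End_algD[OF g])
  show "f \<oplus>\<^bsub>End_alg n k\<^esub> g \<in> carrier (End_alg n k)"
    unfolding End_alg_simps(5)
    by (rule End_algI) (simp_all add: End_algD[OF f] End_algD[OF g] CP_add scale_simps ac_simps)
  show "c \<odot>\<^bsub>End_alg n k\<^esub> f \<in> carrier (End_alg n k)"
    unfolding End_alg_simps(6)
    by (rule End_algI) (simp_all add: End_algD[OF f] CP_scale scale_simps mult.commute)
qed

lemma End_alg_one: "\<one>\<^bsub>End_alg n k\<^esub> \<in> carrier (End_alg n k)"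
  and End_alg_zero: "\<zero>\<^bsub>End_alg n k\<^esub> \<in> carrier (End_alg n k)"
  unfolding End_alg_simps(3,4) by (rule End_algI; simp add: CP_zero scale_simps)+

lemma abelian_group_End_alg: "abelian_group (End_alg n k)"
proof (rule abelian_groupI)
  fix f assume f: "f \<in> carrier (End_alg n k)"
  show "\<zero>\<^bsub>End_alg n k\<^esub> \<oplus>\<^bsub>End_alg n k\<^esub> f = f"
    using End_algD(2)[OF f] by (auto simp: End_alg_simps(4,5) fun_eq_iff extensional_def)
  have "(-1) \<odot>\<^bsub>End_alg n k\<^esub> f \<oplus>\<^bsub>End_alg n k\<^esub> f = \<zero>\<^bsub>End_alg n k\<^esub>"
  proof -
    have "scale (-1) u + u = 0" for u by (rule poly_mapping_eqI) (simp add: lookup_add)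
    then show ?thesis by (auto simp: End_alg_simps(4-6) fun_eq_iff)
  qed
  then show "\<exists>g\<in>carrier (End_alg n k). g \<oplus>\<^bsub>End_alg n k\<^esub> f = \<zero>\<^bsub>End_alg n k\<^esub>"
    using End_alg_closed(3)[OF f f] by blast
next
  fix f g h assume "f \<in> carrier (End_alg n k)" "g \<in> carrier (End_alg n k)"
  then show "f \<oplus>\<^bsub>End_alg n k\<^esub> g \<in> carrier (End_alg n k)" by (rule End_alg_closed(2))
  show "f \<oplus>\<^bsub>End_alg n k\<^esub> g = g \<oplus>\<^bsub>End_alg n k\<^esub> f"
    by (simp add: End_alg_simps(5) add.commute)
  show "f \<oplus>\<^bsub>End_alg n k\<^esub> g \<oplus>\<^bsub>End_alg n k\<^esub> h = f \<oplus>\<^bsub>End_alg n k\<^esub> (g \<oplus>\<^bsub>End_alg n k\<^esub> h)"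
    by (auto simp: End_alg_simps(5) fun_eq_iff add.assoc)
qed (rule End_alg_zero)

text \<open>Writes negation as a scalar multiple, so that closure under scalars provides the
  additive inverses of a subring.\<close>

lemma a_inv_End_alg:
  assumes f: "f \<in> carrier (End_alg n k)"
  shows "\<ominus>\<^bsub>End_alg n k\<^esub> f = (-1) \<odot>\<^bsub>End_alg n k\<^esub> f"
proof -
  interpret abelian_group "End_alg n k" by (rule abelian_group_End_alg)
  have "scale (-1) u + u = 0" for u by (rule poly_mapping_eqI) (simp add: lookup_add)
  then have "(-1) \<odot>\<^bsub>End_alg n k\<^esub> f \<oplus>\<^bsub>End_alg n k\<^esub> f = \<zero>\<^bsub>End_alg n k\<^esub>"
    by (auto simp: End_alg_simps(4-6) fun_eq_iff)
  then show ?thesis by (rule minus_equality) (use End_alg_closed(3)[OF f f] f in auto)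
qed

context
  fixes n k :: nat
  assumes n: "n \<ge> 2" and k: "k \<ge> 1"
begin

lemma represents_unique:
  assumes "represents n k f p" "represents n k g q" "same_values n k p q"
  shows "f = g"
proof
  fix v
  have fg: "f \<in> carrier (End_alg n k)" "g \<in> carrier (End_alg n k)" using assms by (auto simp: represents_def)
  show "f v = g v"
  proof (cases "v \<in> CP n k")
    case True
    then show ?thesis
      using assms fg by (intro CP_eqI[OF n]) (auto simp: represents_def same_values_def End_algD)
  next
    case False
    then show ?thesis using End_algD(2)[OF fg(1)] End_algD(2)[OF fg(2)] by (simp add: extensional_def)
  qed
qed

text \<open>The vector \<open>S_vector n k sig\<close> pairs to 1 with its own functional and
  thereby reads off the eigenvalue.\<close>

lemma represents_same_values:
  assumes "represents n k f p" "represents n k f q"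
  shows "same_values n k p q"
  unfolding same_values_def
proof
  fix sig assume sig: "sig \<in> partitions n k"
  have "pairing (S_functional n k sig) (S_vector n k sig) = 1"
    using sum_S_functional[OF n sig sig] by (simp add: pairing_S_vector)
  then show "eval_poly (variety_point n k sig) p = eval_poly (variety_point n k sig) q"
    using assms sig S_vector_CP[of n k sig] unfolding represents_def by (metis mult.right_neutral)
qed

lemma represents_polys: "represents n k f p \<Longrightarrow> p \<in> polys k"
  by (simp add: represents_def)

lemma represents_add:
  "represents n k f p \<Longrightarrow> represents n k g q \<Longrightarrow> represents n k (f \<oplus>\<^bsub>End_alg n k\<^esub> g) (p + q)"
  unfolding represents_def
  by (intro conjI) (auto simp: End_alg_closed polys_add, simp add: End_alg_simps(5) pairing_add eval_poly_simps distrib_right)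

lemma represents_mult:
  "represents n k f p \<Longrightarrow> represents n k g q \<Longrightarrow> represents n k (f \<otimes>\<^bsub>End_alg n k\<^esub> g) (p * q)"
  unfolding represents_def
  by (intro conjI) (auto simp: End_alg_closed polys_mult,
    simp add: End_alg_simps(2) compose_eq End_algD eval_poly_simps mult.assoc)

lemma represents_one: "represents n k \<one>\<^bsub>End_alg n k\<^esub> 1"
  unfolding represents_def
  by (intro conjI) (auto simp: End_alg_one polys_closed, simp add: End_alg_simps(3) eval_poly_simps)

lemma represents_zero: "represents n k \<zero>\<^bsub>End_alg n k\<^esub> 0"
  unfolding represents_def
  by (intro conjI) (auto simp: End_alg_zero polys_closed, simp add: End_alg_simps(4) eval_poly_simps)

lemma represents_smult: "represents n k f p \<Longrightarrow> represents n k (c \<odot>\<^bsub>End_alg n k\<^esub> f) (Const c * p)"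
  unfolding represents_def
  by (intro conjI) (auto simp: End_alg_closed polys_mult polys_closed,
    simp add: End_alg_simps(6) pairing_scale eval_poly_simps mult.assoc)

lemma represents_finsum:
  assumes "finite X" "\<And>x. x \<in> X \<Longrightarrow> represents n k (f x) (p x)"
  shows "represents n k (\<Oplus>\<^bsub>End_alg n k\<^esub>x\<in>X. f x) (\<Sum>x\<in>X. p x)"
  using assms
proof (induction X rule: finite_induct)
  case empty
  interpret abelian_group "End_alg n k" by (rule abelian_group_End_alg)
  show ?case using represents_zero by simp
next
  case (insert a X)
  interpret abelian_group "End_alg n k" by (rule abelian_group_End_alg)
  have "f \<in> X \<rightarrow> carrier (End_alg n k)" "f a \<in> carrier (End_alg n k)"
    using insert.prems by (auto simp: represents_def)
  then have "(\<Oplus>\<^bsub>End_alg n k\<^esub>x\<in>insert a X. f x) = f a \<oplus>\<^bsub>End_alg n k\<^esub> (\<Oplus>\<^bsub>End_alg n k\<^esub>x\<in>X. f x)"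
    using insert.hyps by (intro finsum_insert)
  then show ?case using insert by (simp add: represents_add)
qed

section \<open>Eigenvalues of the plactic Schur polynomials\<close>

lemma linear_op_plactic_schur: "linear_op (plactic_schur n lam)"
proof -
  have "linear_op (\<lambda>v. \<Sum>p | p permutes {1..n-1}. scale (of_int (sign p))
          (oprod (map (\<lambda>i. plactic_h n (int (lam i) - int i + int (p i))) [1..<n]) v))"
    by (intro linear_op_sum_fun linear_op_scaled linear_op_oprod) (auto simp: linear_op_plactic_h)
  then show ?thesis unfolding plactic_schur_def[abs_def] .
qed

lemma oprod_plactic_h:
  assumes "v \<in> CP n k" "sig \<in> partitions n k"
  shows "oprod (map (\<lambda>i. plactic_h n (r i)) is) v \<in> CP n k"
    and "pairing (S_functional n k sig) (oprod (map (\<lambda>i. plactic_h n (r i)) is) v) =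
      (\<Prod>i\<leftarrow>is. icoeff (bethe_poly n k (bethe_point n k sig)) (r i)) * pairing (S_functional n k sig) v"
proof (induction "is")
  case (Cons i "is")
  {
    case 1
    then show ?case using Cons by (simp add: plactic_h_CP n)
  next
    case 2
    then show ?case using Cons by (simp add: pairing_S_functional_h n assms)
  }
qed (use assms in simp_all)

text \<open>On a joint eigenfunctional each operator product in the Leibniz sum becomes a product of
  scalars. What remains is the Jacobi-Trudi determinant in the coefficients of E, which are the
  values of the \<open>elem_e\<close>.\<close>

lemma represents_plactic_schur: "represents n k (plactic_schur_level n k lam) (dual_jt_poly n k lam)"
proof -
  let ?h = "\<lambda>p. map (\<lambda>i. plactic_h n (int (lam i) - int i + int (p i))) [1..<n]"
  have P: "(\<lambda>_. 0) \<in> partitions n k" by (simp add: partitions_def)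
  have "plactic_schur n lam v \<in> CP n k" if "v \<in> CP n k" for v
    unfolding plactic_schur_def by (intro CP_sum CP_scale oprod_plactic_h(1)[OF that P])
  then have "plactic_schur_level n k lam \<in> carrier (End_alg n k)"
    unfolding plactic_schur_level_def
    using linear_op_plactic_schur by (intro End_algI) (auto simp: linear_op_def)
  moreover have "pairing (S_functional n k sig) (plactic_schur_level n k lam v) =
      eval_poly (variety_point n k sig) (dual_jt_poly n k lam) * pairing (S_functional n k sig) v"
    if sig: "sig \<in> partitions n k" and v: "v \<in> CP n k" for sig v
  proof -
    let ?q = "icoeff (bethe_poly n k (bethe_point n k sig))"
    have "pairing (S_functional n k sig) (plactic_schur_level n k lam v) =
      (\<Sum>p | p permutes {1..n-1}. of_int (sign p) *
        pairing (S_functional n k sig) (oprod (?h p) v))"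
      using v by (simp add: plactic_schur_level_def plactic_schur_def pairing_sum pairing_scale)
    also have "\<dots> = (\<Sum>p | p permutes {1..n-1}. of_int (sign p) *
        (\<Prod>i=1..n-1. ?q (int (lam i) - int i + int (p i)))) * pairing (S_functional n k sig) v"
      unfolding sum_distrib_right
    proof (rule sum.cong[OF refl])
      fix p
      have "(\<Prod>i\<leftarrow>[1..<n]. ?q (int (lam i) - int i + int (p i))) =
        (\<Prod>i=1..n-1. ?q (int (lam i) - int i + int (p i)))"
        using n by (subst prod.distinct_set_conv_list[symmetric]) (auto intro!: prod.cong)
      then show "of_int (sign p) * pairing (S_functional n k sig) (oprod (?h p) v) =
        of_int (sign p) * (\<Prod>i=1..n-1. ?q (int (lam i) - int i + int (p i))) * pairing (S_functional n k sig) v"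
        by (simp only: oprod_plactic_h(2)[OF v sig] mult.assoc)
    qed
    also have "(\<Sum>p | p permutes {1..n-1}. of_int (sign p) *
        (\<Prod>i=1..n-1. ?q (int (lam i) - int i + int (p i)))) =
      det (mat (n - 1) (n - 1) (\<lambda>(i, j). ?q (int (lam (i + 1)) - int (i + 1) + int (j + 1))))"
      by (rule sum_permutes_shift)
    also have "\<dots> = eval_poly (variety_point n k sig) (dual_jt_poly n k lam)"
      unfolding eval_dual_jt_poly_variety_point[OF n sig]
      by (intro arg_cong[where f = det] cong_mat) (auto simp: algebra_simps)
    finally show ?thesis .
  qed
  ultimately show ?thesis by (simp add: represents_def polys_dual_jt_poly)
qed

section \<open>The generated subalgebra\<close>

lemma F'_alg_simps:
  "carrier (F'_alg n k) = \<Inter>{B. plactic_schur_level n k ` partitions n k \<subseteq> B \<and> subring B (End_alg n k) \<and>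
     (\<forall>c. \<forall>x\<in>B. c \<odot>\<^bsub>End_alg n k\<^esub> x \<in> B)}"
  "f \<otimes>\<^bsub>F'_alg n k\<^esub> g = f \<otimes>\<^bsub>End_alg n k\<^esub> g" "f \<oplus>\<^bsub>F'_alg n k\<^esub> g = f \<oplus>\<^bsub>End_alg n k\<^esub> g"
  "\<one>\<^bsub>F'_alg n k\<^esub> = \<one>\<^bsub>End_alg n k\<^esub>" "c \<odot>\<^bsub>F'_alg n k\<^esub> f = c \<odot>\<^bsub>End_alg n k\<^esub> f"
  by (simp_all add: F'_alg_def generated_subalg_def)

lemma subring_End_alg_closed:
  assumes "subring B (End_alg n k)"
  shows "\<one>\<^bsub>End_alg n k\<^esub> \<in> B" "f \<in> B \<Longrightarrow> g \<in> B \<Longrightarrow> f \<otimes>\<^bsub>End_alg n k\<^esub> g \<in> B"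
    "f \<in> B \<Longrightarrow> g \<in> B \<Longrightarrow> f \<oplus>\<^bsub>End_alg n k\<^esub> g \<in> B"
proof -
  interpret subring B "End_alg n k" by fact
  show "\<one>\<^bsub>End_alg n k\<^esub> \<in> B" by simp
  assume fg: "f \<in> B" "g \<in> B"
  then show "f \<otimes>\<^bsub>End_alg n k\<^esub> g \<in> B" by simp
  have "subgroup B (add_monoid (End_alg n k))" by (rule subgroup_axioms)
  from subgroup.m_closed[OF this fg] show "f \<oplus>\<^bsub>End_alg n k\<^esub> g \<in> B" by simp
qed

lemma F'_alg_memI:
  assumes "\<And>B. plactic_schur_level n k ` partitions n k \<subseteq> B \<Longrightarrow> subring B (End_alg n k) \<Longrightarrow>
     (\<And>c x. x \<in> B \<Longrightarrow> c \<odot>\<^bsub>End_alg n k\<^esub> x \<in> B) \<Longrightarrow> f \<in> B"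
  shows "f \<in> carrier (F'_alg n k)"
  unfolding F'_alg_simps(1) using assms by simp

lemma F'_alg_memD:
  assumes "f \<in> carrier (F'_alg n k)" "plactic_schur_level n k ` partitions n k \<subseteq> B"
    "subring B (End_alg n k)" "\<And>c x. x \<in> B \<Longrightarrow> c \<odot>\<^bsub>End_alg n k\<^esub> x \<in> B"
  shows "f \<in> B"
  using assms unfolding F'_alg_simps(1) by simp

lemma F'_alg_closed:
  shows "f \<in> carrier (F'_alg n k) \<Longrightarrow> g \<in> carrier (F'_alg n k) \<Longrightarrow> f \<otimes>\<^bsub>End_alg n k\<^esub> g \<in> carrier (F'_alg n k)"
    and "f \<in> carrier (F'_alg n k) \<Longrightarrow> g \<in> carrier (F'_alg n k) \<Longrightarrow> f \<oplus>\<^bsub>End_alg n k\<^esub> g \<in> carrier (F'_alg n k)"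
    and "\<one>\<^bsub>End_alg n k\<^esub> \<in> carrier (F'_alg n k)"
    and "f \<in> carrier (F'_alg n k) \<Longrightarrow> c \<odot>\<^bsub>End_alg n k\<^esub> f \<in> carrier (F'_alg n k)"
    and "lam \<in> partitions n k \<Longrightarrow> plactic_schur_level n k lam \<in> carrier (F'_alg n k)"
proof -
  assume "f \<in> carrier (F'_alg n k)" "g \<in> carrier (F'_alg n k)"
  note fg = F'_alg_memD[OF this(1)] F'_alg_memD[OF this(2)]
  show "f \<otimes>\<^bsub>End_alg n k\<^esub> g \<in> carrier (F'_alg n k)"
    by (rule F'_alg_memI) (rule subring_End_alg_closed(2), assumption, (rule fg; assumption)+)
  show "f \<oplus>\<^bsub>End_alg n k\<^esub> g \<in> carrier (F'_alg n k)"
    by (rule F'_alg_memI) (rule subring_End_alg_closed(3), assumption, (rule fg; assumption)+)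
next
  show "\<one>\<^bsub>End_alg n k\<^esub> \<in> carrier (F'_alg n k)"
    by (rule F'_alg_memI) (rule subring_End_alg_closed(1))
next
  assume f: "f \<in> carrier (F'_alg n k)"
  show "c \<odot>\<^bsub>End_alg n k\<^esub> f \<in> carrier (F'_alg n k)"
  proof (rule F'_alg_memI)
    fix B assume B: "plactic_schur_level n k ` partitions n k \<subseteq> B" "subring B (End_alg n k)"
      "\<And>c x. x \<in> B \<Longrightarrow> c \<odot>\<^bsub>End_alg n k\<^esub> x \<in> B"
    then show "c \<odot>\<^bsub>End_alg n k\<^esub> f \<in> B" using F'_alg_memD[OF f B] by blast
  qed
next
  assume "lam \<in> partitions n k"
  then show "plactic_schur_level n k lam \<in> carrier (F'_alg n k)"
    by (intro F'_alg_memI) blast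
qed

text \<open>By minimality of the generated subalgebra, this subring contains it, so each of its
  elements has a representing polynomial.\<close>

lemma subring_represented: "subring {f. \<exists>p. represents n k f p} (End_alg n k)"
proof (intro subring.intro subgroup.intro submonoid.intro)
  show "{f. \<exists>p. represents n k f p} \<subseteq> carrier (add_monoid (End_alg n k))"
    "{f. \<exists>p. represents n k f p} \<subseteq> carrier (End_alg n k)"
    by (auto simp: represents_def)
  fix f assume f: "f \<in> {f. \<exists>p. represents n k f p}"
  then have "f \<in> carrier (End_alg n k)" by (auto simp: represents_def)
  then have "inv\<^bsub>add_monoid (End_alg n k)\<^esub> f = (-1) \<odot>\<^bsub>End_alg n k\<^esub> f"
    using a_inv_End_alg by (simp add: a_inv_def)
  then show "inv\<^bsub>add_monoid (End_alg n k)\<^esub> f \<in> {f. \<exists>p. represents n k f p}"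
    using f represents_smult by auto
  fix g assume "g \<in> {f. \<exists>p. represents n k f p}"
  then obtain p q where "represents n k f p" "represents n k g q" using f by blast
  then show "f \<otimes>\<^bsub>add_monoid (End_alg n k)\<^esub> g \<in> {f. \<exists>p. represents n k f p}"
    "f \<otimes>\<^bsub>End_alg n k\<^esub> g \<in> {f. \<exists>p. represents n k f p}"
    using represents_add[of f p g q] represents_mult[of f p g q] by auto
qed (use represents_zero represents_one in auto)

lemma F'_alg_represented:
  assumes "f \<in> carrier (F'_alg n k)"
  shows "\<exists>p. represents n k f p"
proof -
  let ?B = "{f. \<exists>p. represents n k f p}"
  have "plactic_schur_level n k ` partitions n k \<subseteq> ?B" using represents_plactic_schur by blast
  moreover have "\<forall>c. \<forall>x\<in>?B. c \<odot>\<^bsub>End_alg n k\<^esub> x \<in> ?B" using represents_smult by blast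
  ultimately have "f \<in> ?B" using F'_alg_memD[OF assms _ subring_represented] by blast
  then show ?thesis by simp
qed

text \<open>One-row partitions supply the coordinates e_i, which gives surjectivity. Their matrices
  are upper triangular, with 1 on the diagonal after the first row.\<close>

lemma dual_jt_poly_row:
  assumes "i \<in> {1..k}"
  shows "(\<lambda>t. if t = 1 then i else 0) \<in> partitions n k" "dual_jt_poly n k (\<lambda>t. if t = 1 then i else 0) = Var i"
proof -
  show "(\<lambda>t. if t = 1 then i else 0) \<in> partitions n k" using assms n by (auto simp: partitions_def)
  let ?lam = "\<lambda>t. if t = (1 :: nat) then i else 0"
  have "dual_jt_poly n k ?lam = (\<Prod>r<n - 1. elem_e k (int (?lam (r + 1)) - int r + int r))"
    unfolding dual_jt_poly_def by (rule det_upper_triangular_mat) (auto simp: elem_e_def)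
  also have "\<dots> = (\<Prod>r<n - 1. if r = 0 then Var i else 1)"
    using assms by (intro prod.cong) (auto simp: elem_e_def)
  also have "\<dots> = Var i" using n by (simp add: prod.delta)
  finally show "dual_jt_poly n k ?lam = Var i" .
qed

lemma single_eq_Const_Var:
  "Poly_Mapping.single m c = Const c * (\<Prod>i\<in>Poly_Mapping.keys m. Var i ^ Poly_Mapping.lookup m i)"
proof -
  have "Var i ^ e = Poly_Mapping.single (Poly_Mapping.single i e) 1" for i e
    by (induction e) (simp_all add: Var_def mult_single single_add[symmetric])
  moreover have "(\<Prod>i\<in>I. Poly_Mapping.single (g i) (1 :: complex)) = Poly_Mapping.single (\<Sum>i\<in>I. g i) 1"
    for I :: "nat set" and g :: "nat \<Rightarrow> nat \<Rightarrow>\<^sub>0 nat"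
    by (induction I rule: infinite_finite_induct) (simp_all add: mult_single)
  ultimately show ?thesis
    by (simp add: Const_def mult_single sum_singles)
qed

lemma F'_alg_onto:
  assumes "p \<in> polys k"
  shows "\<exists>f\<in>carrier (F'_alg n k). represents n k f p"
proof -
  let ?Q = "\<lambda>p. \<exists>f\<in>carrier (F'_alg n k). represents n k f p"
  have add: "?Q (p + q)" and mult: "?Q (p * q)" if pq: "?Q p" "?Q q" for p q
  proof -
    obtain f g where fg: "f \<in> carrier (F'_alg n k)" "represents n k f p"
      "g \<in> carrier (F'_alg n k)" "represents n k g q" using pq by blast
    show "?Q (p + q)" using represents_add[OF fg(2,4)] F'_alg_closed(2)[OF fg(1,3)] by (rule bexI)
    show "?Q (p * q)" using represents_mult[OF fg(2,4)] F'_alg_closed(1)[OF fg(1,3)] by (rule bexI)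
  qed
  have const: "?Q (Const c)" for c
  proof (rule bexI)
    show "c \<odot>\<^bsub>End_alg n k\<^esub> \<one>\<^bsub>End_alg n k\<^esub> \<in> carrier (F'_alg n k)"
      by (intro F'_alg_closed(4) F'_alg_closed(3))
    show "represents n k (c \<odot>\<^bsub>End_alg n k\<^esub> \<one>\<^bsub>End_alg n k\<^esub>) (Const c)"
      using represents_smult[OF represents_one, of c] by simp
  qed
  have var: "?Q (Var i)" if "i \<in> {1..k}" for i
    using represents_plactic_schur[of "\<lambda>t. if t = 1 then i else 0", unfolded dual_jt_poly_row(2)[OF that]]
      F'_alg_closed(5)[OF dual_jt_poly_row(1)[OF that]] by (rule bexI)
  have one: "?Q 1" and zero: "?Q 0" using const[of 1] const[of 0] by (simp_all add: Const_hom)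
  have power: "?Q (p ^ e)" if "?Q p" for p and e :: nat
    using that by (induction e) (auto intro: one mult)
  have prod: "?Q (\<Prod>i\<in>I. g i)" if "\<And>i. i \<in> I \<Longrightarrow> ?Q (g i)" for I :: "nat set" and g
    using that by (induction I rule: infinite_finite_induct) (auto intro: one mult)
  have sum: "?Q (\<Sum>i\<in>I. g i)" if "\<And>i. i \<in> I \<Longrightarrow> ?Q (g i)" for I :: "(nat \<Rightarrow>\<^sub>0 nat) set" and g
    using that by (induction I rule: infinite_finite_induct) (auto intro: zero add)
  have "?Q (\<Sum>m\<in>Poly_Mapping.keys p. Poly_Mapping.single m (Poly_Mapping.lookup p m))"
    unfolding single_eq_Const_Var
    using assms unfolding polys_def by (intro sum mult const prod power var) blast
  then show ?thesis by (simp add: sum_singles)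
qed

section \<open>The coordinate ring\<close>

lemma poly_alg_simps:
  "carrier (poly_alg k) = polys k" "p \<oplus>\<^bsub>poly_alg k\<^esub> q = p + q" "p \<otimes>\<^bsub>poly_alg k\<^esub> q = p * q"
  "\<one>\<^bsub>poly_alg k\<^esub> = 1" "c \<odot>\<^bsub>poly_alg k\<^esub> p = Const c * p"
  by (simp_all add: poly_alg_def)

text \<open>A coset is the set of all polynomials with prescribed values at the points; independence
  of representatives reduces to comparing values.\<close>

lemma coord_class_eq:
  assumes "p \<in> polys k"
  shows "coord_class n k p = {q \<in> polys k. same_values n k p q}"
proof -
  let ?I = "vanishing_ideal k (variety n k)"
  have "coord_class n k p = (\<lambda>i. i + p) ` ?I"
    by (auto simp: coord_class_def a_r_coset_def' poly_alg_simps)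
  also have "\<dots> = {q \<in> polys k. same_values n k p q}"
  proof (intro equalityI subsetI)
    fix q assume "q \<in> (\<lambda>i. i + p) ` ?I"
    then show "q \<in> {q \<in> polys k. same_values n k p q}"
      using assms by (auto simp: vanishing_ideal_variety[OF n k] polys_add same_values_def eval_poly_simps)
  next
    fix q assume q: "q \<in> {q \<in> polys k. same_values n k p q}"
    then have "q - p \<in> ?I"
      using assms polys_add[of q k "- p"] polys_closed(5)[of p k]
      by (auto simp: vanishing_ideal_variety[OF n k] same_values_def eval_poly_simps)
    then show "q \<in> (\<lambda>i. i + p) ` ?I" by (intro image_eqI[of _ _ "q - p"]) auto
  qed
  finally show ?thesis .
qed

lemma same_values_refl: "same_values n k p p"
  and same_values_sym: "same_values n k p q \<Longrightarrow> same_values n k q p"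
  by (auto simp: same_values_def)

lemma same_values_mult: "same_values n k p p' \<Longrightarrow> same_values n k q q' \<Longrightarrow> same_values n k (p * q) (p' * q')"
  by (simp add: same_values_def eval_poly_simps)

lemma coord_class_eq_iff:
  assumes "p \<in> polys k" "q \<in> polys k"
  shows "coord_class n k p = coord_class n k q \<longleftrightarrow> same_values n k p q"
proof
  assume "coord_class n k p = coord_class n k q"
  then have "q \<in> coord_class n k p" using assms same_values_refl by (simp add: coord_class_eq)
  then show "same_values n k p q" using assms by (simp add: coord_class_eq)
next
  assume "same_values n k p q"
  then have "same_values n k p r = same_values n k q r" for r by (simp add: same_values_def)
  then show "coord_class n k p = coord_class n k q" using assms by (simp only: coord_class_eq)
qed

lemma coord_alg_simps:
  "carrier (coord_alg n k) = coord_class n k ` polys k"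
  "X \<otimes>\<^bsub>coord_alg n k\<^esub> Y = (\<Union>a\<in>X. \<Union>b\<in>Y. coord_class n k (a * b))"
  "X \<oplus>\<^bsub>coord_alg n k\<^esub> Y = {a + b | a b. a \<in> X \<and> b \<in> Y}"
  "\<one>\<^bsub>coord_alg n k\<^esub> = coord_class n k 1"
  "c \<odot>\<^bsub>coord_alg n k\<^esub> X = {a + Const c * b | a b. a \<in> vanishing_ideal k (variety n k) \<and> b \<in> X}"
  by (auto simp: coord_alg_def quot_alg_def ring.defs module.defs FactRing_def A_RCOSETS_def'
      rcoset_mult_def set_add_def' coord_class_def poly_alg_simps)

lemma coord_class_hom:
  assumes p: "p \<in> polys k" and q: "q \<in> polys k"
  shows "coord_class n k p \<otimes>\<^bsub>coord_alg n k\<^esub> coord_class n k q = coord_class n k (p * q)"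
    and "coord_class n k p \<oplus>\<^bsub>coord_alg n k\<^esub> coord_class n k q = coord_class n k (p + q)"
    and "c \<odot>\<^bsub>coord_alg n k\<^esub> coord_class n k p = coord_class n k (Const c * p)"
proof -
  have "coord_class n k (a * b) = coord_class n k (p * q)"
    if "a \<in> coord_class n k p" "b \<in> coord_class n k q" for a b
    using that p q by (subst coord_class_eq_iff)
      (auto simp: coord_class_eq polys_mult intro: same_values_mult same_values_sym)
  moreover have "p \<in> coord_class n k p" "q \<in> coord_class n k q"
    using p q by (simp_all add: coord_class_eq same_values_refl)
  ultimately show "coord_class n k p \<otimes>\<^bsub>coord_alg n k\<^esub> coord_class n k q = coord_class n k (p * q)"
    unfolding coord_alg_simps by blast
  show "coord_class n k p \<oplus>\<^bsub>coord_alg n k\<^esub> coord_class n k q = coord_class n k (p + q)"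
  proof (intro equalityI subsetI)
    fix r assume "r \<in> coord_class n k p \<oplus>\<^bsub>coord_alg n k\<^esub> coord_class n k q"
    then show "r \<in> coord_class n k (p + q)"
      using p q by (auto simp: coord_alg_simps coord_class_eq polys_add same_values_def eval_poly_simps)
  next
    fix r assume r: "r \<in> coord_class n k (p + q)"
    have "r - p \<in> coord_class n k q"
      using r p q polys_add[of r k "- p"] polys_closed(5)[of p k]
      by (auto simp: coord_class_eq polys_add same_values_def eval_poly_simps eq_diff_eq add.commute)
    moreover have "p \<in> coord_class n k p" using p by (simp add: coord_class_eq same_values_refl)
    moreover have "r = p + (r - p)" by simp
    ultimately show "r \<in> coord_class n k p \<oplus>\<^bsub>coord_alg n k\<^esub> coord_class n k q"
      unfolding coord_alg_simps by blast
  qed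
  show "c \<odot>\<^bsub>coord_alg n k\<^esub> coord_class n k p = coord_class n k (Const c * p)"
  proof (intro equalityI subsetI)
    fix r assume "r \<in> c \<odot>\<^bsub>coord_alg n k\<^esub> coord_class n k p"
    then show "r \<in> coord_class n k (Const c * p)"
      using p by (auto simp: coord_alg_simps coord_class_eq polys_add polys_mult polys_closed
          vanishing_ideal_variety[OF n k] same_values_def eval_poly_simps)
  next
    fix r assume r: "r \<in> coord_class n k (Const c * p)"
    have cp: "Const c * p \<in> polys k" using p by (simp add: polys_mult polys_closed)
    have "r - Const c * p \<in> vanishing_ideal k (variety n k)"
      using r cp polys_add[of r k "- (Const c * p)"] polys_closed(5)[OF cp]
      by (auto simp: coord_class_eq vanishing_ideal_variety[OF n k] same_values_def eval_poly_simps)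
    moreover have "p \<in> coord_class n k p" using p by (simp add: coord_class_eq same_values_refl)
    moreover have "r = (r - Const c * p) + Const c * p" by simp
    ultimately show "r \<in> c \<odot>\<^bsub>coord_alg n k\<^esub> coord_class n k p"
      unfolding coord_alg_simps by blast
  qed
qed

text \<open>The choice is harmless, since two polynomials representing the same operator have the
  same class.\<close>

definition spectral_map :: "(cvec \<Rightarrow> cvec) \<Rightarrow> cpoly set" where
  "spectral_map f = coord_class n k (SOME p. represents n k f p)"

lemma spectral_map_eq:
  assumes "represents n k f p"
  shows "spectral_map f = coord_class n k p"
proof -
  let ?q = "SOME p. represents n k f p"
  have q: "represents n k f ?q" using assms by (rule someI)
  from coord_class_eq_iff[OF represents_polys[OF q] represents_polys[OF assms]] represents_same_values[OF q assms] show ?thesis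
    unfolding spectral_map_def by (rule iffD2)
qed

text \<open>Operators and classes are both determined by the values at the points, which gives
  injectivity; surjectivity holds because every polynomial represents some operator of the
  algebra.\<close>

lemma spectral_map_iso: "spectral_map \<in> alg_iso (F'_alg n k) (coord_alg n k)"
proof -
  have rep: "\<exists>p. represents n k f p \<and> p \<in> polys k" if "f \<in> carrier (F'_alg n k)" for f
    using F'_alg_represented[OF that] by (auto simp: represents_def)
  have "spectral_map \<in> Ring.ring_hom (F'_alg n k) (coord_alg n k)"
  proof (rule ring_hom_memI)
    fix f assume "f \<in> carrier (F'_alg n k)"
    then obtain p where p: "represents n k f p" "p \<in> polys k" using rep by blast
    then show "spectral_map f \<in> carrier (coord_alg n k)"
      by (simp add: spectral_map_eq coord_alg_simps)
    fix g assume "g \<in> carrier (F'_alg n k)"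
    then obtain q where q: "represents n k g q" "q \<in> polys k" using rep by blast
    show "spectral_map (f \<otimes>\<^bsub>F'_alg n k\<^esub> g) = spectral_map f \<otimes>\<^bsub>coord_alg n k\<^esub> spectral_map g"
      using p q by (simp add: F'_alg_simps spectral_map_eq[OF represents_mult] spectral_map_eq coord_class_hom)
    show "spectral_map (f \<oplus>\<^bsub>F'_alg n k\<^esub> g) = spectral_map f \<oplus>\<^bsub>coord_alg n k\<^esub> spectral_map g"
      using p q by (simp add: F'_alg_simps spectral_map_eq[OF represents_add] spectral_map_eq coord_class_hom)
  next
    show "spectral_map \<one>\<^bsub>F'_alg n k\<^esub> = \<one>\<^bsub>coord_alg n k\<^esub>"
      by (simp add: F'_alg_simps coord_alg_simps spectral_map_eq[OF represents_one])
  qed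
  moreover have "bij_betw spectral_map (carrier (F'_alg n k)) (carrier (coord_alg n k))"
    unfolding bij_betw_def
  proof
    show "inj_on spectral_map (carrier (F'_alg n k))"
    proof (rule inj_onI)
      fix f g assume fg: "f \<in> carrier (F'_alg n k)" "g \<in> carrier (F'_alg n k)" "spectral_map f = spectral_map g"
      obtain p q where pq: "represents n k f p" "p \<in> polys k" "represents n k g q" "q \<in> polys k"
        using rep fg(1,2) by metis
      then have "same_values n k p q" using fg(3) by (simp add: spectral_map_eq coord_class_eq_iff)
      then show "f = g" using represents_unique pq by blast
    qed
    show "spectral_map ` carrier (F'_alg n k) = carrier (coord_alg n k)"
    proof (intro equalityI subsetI)
      fix X assume "X \<in> spectral_map ` carrier (F'_alg n k)"
      then show "X \<in> carrier (coord_alg n k)"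
        using rep by (auto simp: coord_alg_simps spectral_map_eq) (metis image_eqI spectral_map_eq)
    next
      fix X assume "X \<in> carrier (coord_alg n k)"
      then obtain p where p: "p \<in> polys k" "X = coord_class n k p" by (auto simp: coord_alg_simps)
      then obtain f where "f \<in> carrier (F'_alg n k)" "represents n k f p" using F'_alg_onto by blast
      then show "X \<in> spectral_map ` carrier (F'_alg n k)" using p spectral_map_eq by blast
    qed
  qed
  moreover have "spectral_map (c \<odot>\<^bsub>F'_alg n k\<^esub> f) = c \<odot>\<^bsub>coord_alg n k\<^esub> spectral_map f"
    if f: "f \<in> carrier (F'_alg n k)" for c f
  proof -
    obtain p where p: "represents n k f p" "p \<in> polys k" using rep[OF f] by blast
    then show ?thesis
      by (simp add: F'_alg_simps spectral_map_eq[OF represents_smult] spectral_map_eq coord_class_hom)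
  qed
  ultimately show ?thesis by (simp add: alg_iso_def ring_iso_def)
qed

lemma spectral_map_schur:
  assumes lam: "lam \<in> partitions n k"
  shows "spectral_map (plactic_schur_level n k lam) = coord_class n k (schur_e k (transpose_part lam))"
  unfolding spectral_map_eq[OF represents_plactic_schur]
  using eval_schur_e_transpose_part[OF lam] schur_e_transpose_part(1)[OF lam] polys_dual_jt_poly
  by (subst coord_class_eq_iff) (auto simp: same_values_def)

section \<open>The Verlinde formula\<close>

lemma S_matrix_zero_nonzero:
  assumes "sig \<in> partitions n k"
  shows "S_matrix n k (\<lambda>_. 0) sig \<noteq> 0"
proof -
  have "alt_det n (bethe_point n k sig) (\<lambda>i. n - Suc i) \<noteq> 0"
    using bethe_roots_bethe_point[OF n assms] by (intro vandermonde_nonzero) (simp add: bethe_roots_def)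
  moreover have "S_const n k \<noteq> 0" using n by (simp add: S_const_def)
  ultimately show ?thesis using n by (simp add: S_matrix_alt_det part_heights_def[abs_def])
qed

text \<open>The Jacobi-Trudi determinant is a ratio of alternants, in which the constant factor of S
  cancels.\<close>

lemma eval_dual_jt_poly_S_matrix:
  assumes sig: "sig \<in> partitions n k" and lam: "lam \<in> partitions n k"
  shows "eval_poly (variety_point n k sig) (dual_jt_poly n k lam) = S_matrix n k lam sig / S_matrix n k (\<lambda>_. 0) sig"
proof -
  have bd: "lam i \<le> k" for i
    using lam by (cases "i = 0") (auto simp: partitions_def intro: order_trans[of "lam i" "lam 1" k])
  have "lam n = 0" using lam n by (simp add: partitions_def)
  note jt = jacobi_trudi[of n k _ _ lam, OF n bethe_roots_bethe_point[OF n sig] bd this]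
  have "S_matrix n k lam sig = eval_poly (variety_point n k sig) (dual_jt_poly n k lam) * S_matrix n k (\<lambda>_. 0) sig"
    using jt n by (simp add: S_matrix_alt_det eval_dual_jt_poly_variety_point[OF n sig] part_heights_def[abs_def] mult_ac)
  then show ?thesis using S_matrix_zero_nonzero[OF sig] by simp
qed

text \<open>At the point of \<open>sig\<close> the sum over \<open>nu\<close> is an inner product of
  two columns of S; unitarity leaves only the summand of the Verlinde formula at \<open>sig\<close>,
  which is the product of the two eigenvalues.\<close>

lemma same_values_fusion:
  assumes lam: "lam \<in> partitions n k" and mu: "mu \<in> partitions n k"
  shows "same_values n k (dual_jt_poly n k lam * dual_jt_poly n k mu)
    (\<Sum>nu\<in>partitions n k. Const (fusion_coeff n k lam mu nu) * dual_jt_poly n k nu)"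
  unfolding same_values_def
proof
  fix sig assume sig: "sig \<in> partitions n k"
  let ?S = "S_matrix n k" and ?P = "partitions n k"
  let ?c = "\<lambda>tau. ?S lam tau * ?S mu tau / ?S (\<lambda>_. 0) tau"
  have "eval_poly (variety_point n k sig) (\<Sum>nu\<in>?P. Const (fusion_coeff n k lam mu nu) * dual_jt_poly n k nu) =
    (\<Sum>nu\<in>?P. fusion_coeff n k lam mu nu * (?S nu sig / ?S (\<lambda>_. 0) sig))"
    by (simp add: eval_poly_simps eval_dual_jt_poly_S_matrix sig)
  also have "\<dots> = (\<Sum>nu\<in>?P. \<Sum>tau\<in>?P. ?c tau * (?S nu sig * cnj (?S nu tau)) / ?S (\<lambda>_. 0) sig)"
    unfolding fusion_coeff_def sum_distrib_right by (intro sum.cong refl) simp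
  also have "\<dots> = (\<Sum>tau\<in>?P. \<Sum>nu\<in>?P. ?c tau * (?S nu sig * cnj (?S nu tau)) / ?S (\<lambda>_. 0) sig)"
    by (rule sum.swap)
  also have "\<dots> = (\<Sum>tau\<in>?P. ?c tau * (if sig = tau then 1 else 0) / ?S (\<lambda>_. 0) sig)"
    unfolding sum_divide_distrib[symmetric] sum_distrib_left[symmetric]
    by (intro arg_cong2[where f = "(/)"] refl sum.cong) (simp only: S_matrix_unitary[OF n sig])
  also have "\<dots> = (\<Sum>tau\<in>?P. if sig = tau then ?c tau / ?S (\<lambda>_. 0) sig else 0)"
    by (intro sum.cong) auto
  also have "\<dots> = ?c sig / ?S (\<lambda>_. 0) sig"
    using sig finite_partitions[OF n] by simp
  also have "\<dots> = eval_poly (variety_point n k sig) (dual_jt_poly n k lam * dual_jt_poly n k mu)"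
    by (simp add: eval_poly_simps eval_dual_jt_poly_S_matrix sig lam mu)
  finally show "eval_poly (variety_point n k sig) (dual_jt_poly n k lam * dual_jt_poly n k mu) =
    eval_poly (variety_point n k sig) (\<Sum>nu\<in>?P. Const (fusion_coeff n k lam mu nu) * dual_jt_poly n k nu)"
    by (rule sym)
qed

end

theorem corollary5p4:
  fixes n k :: nat
  assumes "n \<ge> 2" and "k \<ge> 1"
  shows "(\<exists>h \<in> alg_iso (F'_alg n k) (coord_alg n k).
            \<forall>lam \<in> partitions n k.
              h (plactic_schur_level n k lam) = coord_class n k (schur_e k (transpose_part lam)))
       \<and> (\<forall>lam \<in> partitions n k. \<forall>mu \<in> partitions n k.
            plactic_schur_level n k lam \<otimes>\<^bsub>End_alg n k\<^esub> plactic_schur_level n k mu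
            = (\<Oplus>\<^bsub>End_alg n k\<^esub> nu \<in> partitions n k.
                 fusion_coeff n k lam mu nu \<odot>\<^bsub>End_alg n k\<^esub> plactic_schur_level n k nu))"
proof (intro conjI ballI)
  show "\<exists>h \<in> alg_iso (F'_alg n k) (coord_alg n k).
      \<forall>lam \<in> partitions n k.
        h (plactic_schur_level n k lam) = coord_class n k (schur_e k (transpose_part lam))"
    using spectral_map_iso[OF assms] spectral_map_schur[OF assms] by blast
  fix lam mu assume P: "lam \<in> partitions n k" "mu \<in> partitions n k"
  show "plactic_schur_level n k lam \<otimes>\<^bsub>End_alg n k\<^esub> plactic_schur_level n k mu
      = (\<Oplus>\<^bsub>End_alg n k\<^esub> nu \<in> partitions n k.
           fusion_coeff n k lam mu nu \<odot>\<^bsub>End_alg n k\<^esub> plactic_schur_level n k nu)"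
  \<comment> \<open>Both sides are operators represented by polynomials, so it suffices to compare
    values at the points.\<close>
  proof (rule represents_unique[OF assms])
    show "represents n k (plactic_schur_level n k lam \<otimes>\<^bsub>End_alg n k\<^esub> plactic_schur_level n k mu)
        (dual_jt_poly n k lam * dual_jt_poly n k mu)"
      by (intro represents_mult represents_plactic_schur assms)
    show "represents n k (\<Oplus>\<^bsub>End_alg n k\<^esub> nu \<in> partitions n k.
           fusion_coeff n k lam mu nu \<odot>\<^bsub>End_alg n k\<^esub> plactic_schur_level n k nu)
        (\<Sum>nu\<in>partitions n k. Const (fusion_coeff n k lam mu nu) * dual_jt_poly n k nu)"
      by (intro represents_finsum represents_smult represents_plactic_schur assms finite_partitions)
    show "same_values n k (dual_jt_poly n k lam * dual_jt_poly n k mu)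
        (\<Sum>nu\<in>partitions n k. Const (fusion_coeff n k lam mu nu) * dual_jt_poly n k nu)"
      by (rule same_values_fusion[OF assms P])
  qed
qed

end
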